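(* The problem $3$-Fix-Promise is $\mathsf{NP}$-hard when restricted to the class of planar graphs.
   Context: All graphs are finite, simple and undirected. An $r$-coloring of a graph $G$ is any map $c:V(G)\to[r]$ (not necessarily proper); it is proper if adjacent vertices receive distinct colors; $\chi(G)$ is the chromatic number. A recoloring changes the color of one vertex. A swap between two distinct vertices $u,v$ assigns to $u$ the color of $v$ and to $v$ the color of $u$; a coloring $c$ is a permutation of a coloring $c_0$ if $c$ can be obtained from $c_0$ by finitely many swaps. $r$-Fix-Promise (for fixed $r$) is the promise problem: input a graph $G$, an $r$-coloring $c$ of $G$ and a positive integer $k$, with the promise that $\chi(G)=r$ and $c$ is a permutation of some optimal proper vertex-coloring of $G$; decide whether $c$ can be turned into a proper $r$-coloring of $G$ using at most $k$ recolorings. (An algorithm solves a promise problem if it answers correctly on all inputs satisfying the promise.) *)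

theory Defs
  imports
    "HOL-Analysis.Analysis"
    "HOL-Computational_Algebra.Polynomial"
    "Graph_Theory.Pair_Digraph"
begin

section \<open>Turing machines and polynomial time\<close>

text \<open>
  Deterministic multi-tape machines. States and tape symbols are initial segments of the natural
  numbers; state 0 is initial and state 1 is the halting state. Symbol 0 is the blank, symbols 1
  and 2 are the bits. Tapes are infinite in both directions. Tape 0 carries the input and
  tape 1 the output; on each tape the head starts on cell 0.
\<close>

record tm =
  tm_tapes :: nat
  tm_states :: nat
  tm_symbols :: nat
  tm_delta :: "nat \<Rightarrow> nat list \<Rightarrow> nat \<times> (nat \<times> int) list"

definition valid_tm :: "tm \<Rightarrow> bool" where
  "valid_tm M \<longleftrightarrow>
     tm_tapes M \<ge> 2 \<and> tm_states M \<ge> 2 \<and> tm_symbols M \<ge> 3 \<and>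
     (\<forall>q<tm_states M. \<forall>ss. length ss = tm_tapes M \<and> set ss \<subseteq> {..<tm_symbols M} \<longrightarrow>
        (case tm_delta M q ss of (q', as) \<Rightarrow>
           q' < tm_states M \<and> length as = tm_tapes M \<and>
           (\<forall>(a, d)\<in>set as. a < tm_symbols M \<and> d \<in> {-1, 0, 1})))"

text \<open>A tape is its contents together with the head position.\<close>

type_synonym tape = "(int \<Rightarrow> nat) \<times> int"
type_synonym tm_config = "nat \<times> tape list"

fun tape_read :: "tape \<Rightarrow> nat" where
  "tape_read (T, i) = T i"

fun tape_act :: "tape \<Rightarrow> nat \<times> int \<Rightarrow> tape" where
  "tape_act (T, i) (a, d) = (T(i := a), i + d)"

fun tm_step :: "tm \<Rightarrow> tm_config \<Rightarrow> tm_config" where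
  "tm_step M (q, ts) =
     (if q = 1 then (q, ts)
      else case tm_delta M q (map tape_read ts) of (q', as) \<Rightarrow> (q', map2 tape_act ts as))"

definition bit_symbol :: "bool \<Rightarrow> nat" where
  "bit_symbol b = (if b then 2 else 1)"

definition word_tape :: "bool list \<Rightarrow> tape" where
  "word_tape x =
     ((\<lambda>i. if 0 \<le> i \<and> i < int (length x) then bit_symbol (x ! nat i) else 0), 0)"

definition tm_init :: "tm \<Rightarrow> bool list \<Rightarrow> tm_config" where
  "tm_init M x = (0, word_tape x # replicate (tm_tapes M - 1) (word_tape []))"

text \<open>The output is the word on tape 1 from cell 0 up to the first blank.\<close>

definition tm_outputs_within :: "tm \<Rightarrow> bool list \<Rightarrow> nat \<Rightarrow> bool list \<Rightarrow> bool" where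
  "tm_outputs_within M x t y \<longleftrightarrow>
     (case (tm_step M ^^ t) (tm_init M x) of (q, ts) \<Rightarrow>
        q = 1 \<and> (\<forall>i<length y. fst (ts ! 1) (int i) = bit_symbol (y ! i)) \<and>
        fst (ts ! 1) (int (length y)) = 0)"

definition polytime_computable :: "(bool list \<Rightarrow> bool list) \<Rightarrow> bool" where
  "polytime_computable f \<longleftrightarrow>
     (\<exists>M (p :: nat poly). valid_tm M \<and>
        (\<forall>x. tm_outputs_within M x (poly p (length x)) (f x)))"


section \<open>NP and NP-hardness of promise problems\<close>

type_synonym language = "bool list set"

definition encode_pair :: "bool list \<Rightarrow> bool list \<Rightarrow> bool list" where
  "encode_pair x w = concat (map (\<lambda>b. [b, b]) x) @ [False, True] @ w"

definition NP :: "language set" where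
  "NP = {L. \<exists>V (p :: nat poly). polytime_computable V \<and>
           (\<forall>x. x \<in> L \<longleftrightarrow>
              (\<exists>w. length w \<le> poly p (length x) \<and> V (encode_pair x w) = [True]))}"

text \<open>The inputs that satisfy the promise are the yes-instances and the no-instances.\<close>

record promise_problem =
  yes_instances :: language
  no_instances :: language

definition NP_hard :: "promise_problem \<Rightarrow> bool" where
  "NP_hard P \<longleftrightarrow>
     (\<forall>L\<in>NP. \<exists>f. polytime_computable f \<and>
        (\<forall>x. (x \<in> L \<longrightarrow> f x \<in> yes_instances P) \<and> (x \<notin> L \<longrightarrow> f x \<in> no_instances P)))"


section \<open>Colorings\<close>

text \<open>
  A finite simple undirected graph is a \<^const>\<open>pair_graph\<close>: each edge is represented by its two
  orientations.
\<close>

definition colorings :: "'a pair_pre_digraph \<Rightarrow> nat \<Rightarrow> ('a \<Rightarrow> nat) set" where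
  "colorings G r = pverts G \<rightarrow>\<^sub>E {1..r}"

definition proper_coloring :: "'a pair_pre_digraph \<Rightarrow> nat \<Rightarrow> ('a \<Rightarrow> nat) \<Rightarrow> bool" where
  "proper_coloring G r c \<longleftrightarrow> c \<in> colorings G r \<and> (\<forall>(u, v)\<in>parcs G. c u \<noteq> c v)"

definition chromatic_number :: "'a pair_pre_digraph \<Rightarrow> nat" where
  "chromatic_number G = (LEAST r. \<exists>c. proper_coloring G r c)"

definition recoloring :: "'a pair_pre_digraph \<Rightarrow> nat \<Rightarrow> ('a \<Rightarrow> nat) \<Rightarrow> ('a \<Rightarrow> nat) \<Rightarrow> bool" where
  "recoloring G r c c' \<longleftrightarrow> (\<exists>v\<in>pverts G. \<exists>a\<in>{1..r}. a \<noteq> c v \<and> c' = c(v := a))"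

definition swap :: "'a pair_pre_digraph \<Rightarrow> ('a \<Rightarrow> nat) \<Rightarrow> ('a \<Rightarrow> nat) \<Rightarrow> bool" where
  "swap G c c' \<longleftrightarrow>
     (\<exists>u\<in>pverts G. \<exists>v\<in>pverts G. u \<noteq> v \<and> c' = c(u := c v, v := c u))"

definition permutation_of :: "'a pair_pre_digraph \<Rightarrow> ('a \<Rightarrow> nat) \<Rightarrow> ('a \<Rightarrow> nat) \<Rightarrow> bool" where
  "permutation_of G c c\<^sub>0 \<longleftrightarrow> (swap G)\<^sup>*\<^sup>* c\<^sub>0 c"

definition fixable :: "'a pair_pre_digraph \<Rightarrow> nat \<Rightarrow> ('a \<Rightarrow> nat) \<Rightarrow> nat \<Rightarrow> bool" where
  "fixable G r c k \<longleftrightarrow>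
     (\<exists>m\<le>k. \<exists>c'. (recoloring G r ^^ m) c c' \<and> proper_coloring G r c')"


section \<open>Planar graphs\<close>

text \<open>
  A planar drawing, with the complex numbers as the plane: vertices are distinct points, the edge
  \<open>{u, v}\<close> is a simple arc between its end vertices that meets no other vertex, and distinct edges
  meet only in common end vertices.
\<close>

definition planar_drawing ::
    "'a pair_pre_digraph \<Rightarrow> ('a \<Rightarrow> complex) \<Rightarrow> ('a set \<Rightarrow> real \<Rightarrow> complex) \<Rightarrow> bool" where
  "planar_drawing G \<phi> \<gamma> \<longleftrightarrow>
     inj_on \<phi> (pverts G) \<and>
     (\<forall>(u, v)\<in>parcs G.
        arc (\<gamma> {u, v}) \<and>
        {pathstart (\<gamma> {u, v}), pathfinish (\<gamma> {u, v})} = {\<phi> u, \<phi> v} \<and>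
        path_image (\<gamma> {u, v}) \<inter> \<phi> ` pverts G = {\<phi> u, \<phi> v}) \<and>
     (\<forall>(u, v)\<in>parcs G. \<forall>(u', v')\<in>parcs G. {u, v} \<noteq> {u', v'} \<longrightarrow>
        path_image (\<gamma> {u, v}) \<inter> path_image (\<gamma> {u', v'}) \<subseteq> \<phi> ` ({u, v} \<inter> {u', v'}))"

definition planar :: "'a pair_pre_digraph \<Rightarrow> bool" where
  "planar G \<longleftrightarrow> (\<exists>\<phi> \<gamma>. planar_drawing G \<phi> \<gamma>)"


section \<open>The problem Fix-Promise\<close>

text \<open>Binary representation, least significant bit first.\<close>

fun binary_word :: "nat \<Rightarrow> bool list" where
  "binary_word k = (if k = 0 then [] else odd k # binary_word (k div 2))"

declare binary_word.simps [simp del]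

text \<open>
  Input graphs have vertex set \<open>{..<n}\<close>. An instance is written as \<open>n\<close> in unary, the rows of the
  adjacency matrix, the colors of the vertices in unary, and \<open>k\<close> in binary.
\<close>

definition encode_instance :: "nat pair_pre_digraph \<Rightarrow> (nat \<Rightarrow> nat) \<Rightarrow> nat \<Rightarrow> bool list" where
  "encode_instance G c k =
     (let n = card (pverts G) in
        replicate n True @ [False] @
        concat (map (\<lambda>u. map (\<lambda>v. (u, v) \<in> parcs G) [0..<n]) [0..<n]) @
        concat (map (\<lambda>v. replicate (c v) True @ [False]) [0..<n]) @
        binary_word k)"

definition fix_instance :: "nat \<Rightarrow> nat pair_pre_digraph \<Rightarrow> (nat \<Rightarrow> nat) \<Rightarrow> nat \<Rightarrow> bool" where
  "fix_instance r G c k \<longleftrightarrow>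
     pair_graph G \<and> (\<exists>n. pverts G = {..<n}) \<and> c \<in> colorings G r \<and> k > 0"

definition fix_promise :: "nat \<Rightarrow> 'a pair_pre_digraph \<Rightarrow> ('a \<Rightarrow> nat) \<Rightarrow> bool" where
  "fix_promise r G c \<longleftrightarrow>
     chromatic_number G = r \<and>
     (\<exists>c\<^sub>0. proper_coloring G (chromatic_number G) c\<^sub>0 \<and> permutation_of G c c\<^sub>0)"

definition Fix_Promise :: "nat \<Rightarrow> nat pair_pre_digraph set \<Rightarrow> promise_problem" where
  "Fix_Promise r \<G> =
     \<lparr>yes_instances = {encode_instance G c k | G c k.
        fix_instance r G c k \<and> G \<in> \<G> \<and> fix_promise r G c \<and> fixable G r c k},
      no_instances = {encode_instance G c k | G c k.
        fix_instance r G c k \<and> G \<in> \<G> \<and> fix_promise r G c \<and> \<not> fixable G r c k}\<rparr>"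

end

theory Submission
  imports Defs
begin

text \<open>
  The computation of an NP verifier is a tableau, that is, a labelling of a rectangle in which
  neighbouring labels are compatible. Replacing every label by a bundle of boolean wires turns the
  tableau into a rectangle of tiles of seven kinds, and every tile into a piece of a grid graph in
  which some vertices have a prescribed and some a forbidden color; planarity is free, because
  crossing wires are one of the tile kinds.

  Prescribed and forbidden colors are enforced by the budget. The given coloring puts color \<open>a\<close> on a
  vertex and on one or two pendant neighbours of it, so that at least one recoloring is needed there.
  If the budget is the number of vertices with pendant neighbours, exactly one recoloring is
  available at each of them and none elsewhere: a vertex without pendant neighbours keeps its color,
  one with two pendant neighbours must itself abandon \<open>a\<close>, and one with a single pendant neighbour may
  end with any color. The promise is cheap: the grid is bipartite, a triangle at every
  vertex makes the chromatic number 3, and three isolated vertices of distinct colors at every vertex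
  allow the swaps that lead to the given coloring from a proper one.

  The reduction is written in a small loop language whose programs are simulated by multi-tape
  machines with constant overhead per step.
\<close>

section \<open>A loop language for multi-tape machines\<close>

text \<open>The promise holds for yes- and no-instances alike, so 3-colorability cannot carry the
  hardness: a checkerboard coloring always exists, and only the distance from the given coloring to
  the proper ones encodes the computation. The budget leaves no slack because a vertex and its
  pendant neighbours form disjoint groups, each of which costs at least one recoloring in every
  proper coloring. The set of tableau labels depends on the verifier alone, so the block that
  replaces a tableau cell has constant size and is hard-wired into the program; the input enters
  only through the size of the rectangle and its first and last row. A block need not force exactly
  one label wire to be true: its constraints hold for all true wires at once, so any true admissible
  wire may be chosen. Apart from one binary counter, the loops of the program only append to a
  register that they do not read, so that the costs of nested loops multiply instead of iterating;
  hence the adjacency matrix is streamed site by site, from data visible in a single tableau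
  cell.\<close>

text \<open>
  The alphabet contains the cells of the tableau: in the initial row the cells with a blank, a bit of
  the input or an unconstrained bit of the certificate (\<open>Wild\<close>), and the cell just before the input (\<open>Pre\<close>);
  in the final row the two output cells that must hold a 1 and a blank (\<open>Acc2\<close>, \<open>Acc0\<close>). The two flags
  of a cell mark the first and the last column.
\<close>

datatype ck = Blank | Zero | One | Wild | Pre | Mid | Acc2 | Acc0

datatype sym = Bit bool | Cell ck bool bool

instance ck :: finite
proof
  have "(UNIV :: ck set) \<subseteq> {Blank, Zero, One, Wild, Pre, Mid, Acc2, Acc0}"
    using ck.exhaust by blast
  then show "finite (UNIV :: ck set)" by (rule finite_subset) simp
qed

instance sym :: finite
proof
  have "(UNIV :: sym set) \<subseteq> range Bit \<union> range (\<lambda>(k, a, b). Cell k a b)"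
  proof
    fix s :: sym
    show "s \<in> range Bit \<union> range (\<lambda>(k, a, b). Cell k a b)"
      by (cases s) (auto intro: range_eqI[where x = "(_, _, _)"])
  qed
  then show "finite (UNIV :: sym set)" by (rule finite_subset) simp
qed

text \<open>Branching occurs only through \<open>For\<close>, whose body depends on the symbol just
  read; since \<open>sym\<close> is finite, a program still has finitely many control
  points.\<close>

datatype cmd = Skip | App nat sym | Incr nat | Seq cmd cmd | For nat "sym \<Rightarrow> cmd"

fun binary_inc :: "sym list \<Rightarrow> sym list" where
  "binary_inc [] = [Bit True]"
| "binary_inc (a # xs) =
     (if a = Bit True then Bit False # binary_inc xs
      else if a = Bit False then Bit True # xs else a # xs)"

primrec exec :: "cmd \<Rightarrow> (nat \<Rightarrow> sym list) \<Rightarrow> nat \<Rightarrow> sym list" where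
  "exec Skip \<sigma> = \<sigma>"
| "exec (App i a) \<sigma> = \<sigma>(i := \<sigma> i @ [a])"
| "exec (Incr i) \<sigma> = \<sigma>(i := binary_inc (\<sigma> i))"
| "exec (Seq c d) \<sigma> = exec d (exec c \<sigma>)"
| "exec (For i b) \<sigma> = fold (\<lambda>a. exec (b a)) (\<sigma> i) \<sigma>"

text \<open>The 2 per iteration are the step \<open>Scan\<close>, which reads the next symbol, and
  the step \<open>Adv\<close>, which passes it after the body.\<close>

primrec fold_time :: "('a \<Rightarrow> 's \<Rightarrow> 's) \<Rightarrow> ('a \<Rightarrow> 's \<Rightarrow> nat) \<Rightarrow> 'a list \<Rightarrow> 's \<Rightarrow> nat" where
  "fold_time e t [] s = 0"
| "fold_time e t (a # as) s = t a s + 2 + fold_time e t as (e a s)"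

text \<open>Steps of the carry phase alone: after the carry stops, the head still walks over the
  rest of the word to the blank behind it.\<close>

fun inc_time :: "sym list \<Rightarrow> nat" where
  "inc_time [] = 1"
| "inc_time (a # xs) = (if a = Bit True then Suc (inc_time xs) else 2 + length xs)"

text \<open>Exact step counts of the compiled machine. In \<open>For\<close>, one step dispatches,
  one more step than the register has symbols rewinds past the left end, and a last
  \<open>Scan\<close> meets the blank.\<close>

primrec time :: "cmd \<Rightarrow> (nat \<Rightarrow> sym list) \<Rightarrow> nat" where
  "time Skip \<sigma> = 1"
| "time (App i a) \<sigma> = 1"
| "time (Incr i) \<sigma> = length (\<sigma> i) + 2 + inc_time (\<sigma> i)"
| "time (Seq c d) \<sigma> = 1 + time c \<sigma> + time d (exec c \<sigma>)"
| "time (For i b) \<sigma> =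
     length (\<sigma> i) + 3 + fold_time (\<lambda>a. exec (b a)) (\<lambda>a. time (b a)) (\<sigma> i) \<sigma>"

primrec regs :: "cmd \<Rightarrow> nat set" where
  "regs Skip = {}"
| "regs (App i a) = {i}"
| "regs (Incr i) = {i}"
| "regs (Seq c d) = regs c \<union> regs d"
| "regs (For i b) = insert i (\<Union>a. regs (b a))"

text \<open>The head on tape \<open>i\<close> serves as the loop counter, so the body must not touch
  register \<open>i\<close>; in particular, nested loops run over distinct registers.\<close>

primrec wf_cmd :: "cmd \<Rightarrow> bool" where
  "wf_cmd Skip = True"
| "wf_cmd (App i a) = True"
| "wf_cmd (Incr i) = True"
| "wf_cmd (Seq c d) = (wf_cmd c \<and> wf_cmd d)"
| "wf_cmd (For i b) = (\<forall>a. i \<notin> regs (b a) \<and> wf_cmd (b a))"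

lemma exec_other: "j \<notin> regs c \<Longrightarrow> exec c \<sigma> j = \<sigma> j"
proof (induction c arbitrary: \<sigma>)
  case (For i b)
  have "fold (\<lambda>a. exec (b a)) xs s j = s j" for xs s
    using For by (induction xs arbitrary: s) auto
  then show ?case by simp
qed auto

subsection \<open>Abstract machine\<close>

text \<open>The control states of the simulating machine are stacks of such instructions; the tail
  of the list is the continuation.\<close>

datatype micro = Do cmd | Rew nat "sym \<Rightarrow> cmd" | Scan nat "sym \<Rightarrow> cmd" | Adv nat "sym \<Rightarrow> cmd"
  | RewC nat | Carry nat | Fwd nat

text \<open>Every step acts on a single tape; a step that only changes the stack rewrites tape 0
  with the symbol just read.\<close>

fun trans :: "micro list \<Rightarrow> (nat \<Rightarrow> sym option) \<Rightarrow> micro list \<times> nat \<times> sym option \<times> int" where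
  "trans [] rd = ([], 0, rd 0, 0)"
| "trans (Do Skip # K) rd = (K, 0, rd 0, 0)"
| "trans (Do (App i a) # K) rd = (K, i, Some a, 1)"
| "trans (Do (Incr i) # K) rd = (RewC i # K, i, rd i, -1)"
| "trans (Do (Seq c d) # K) rd = (Do c # Do d # K, 0, rd 0, 0)"
| "trans (Do (For i b) # K) rd = (Rew i b # K, i, rd i, -1)"
| "trans (Rew i b # K) rd =
     (if rd i = None then (Scan i b # K, i, None, 1) else (Rew i b # K, i, rd i, -1))"
| "trans (Scan i b # K) rd =
     (case rd i of None \<Rightarrow> (K, i, None, 0) | Some a \<Rightarrow> (Do (b a) # Adv i b # K, i, Some a, 0))"
| "trans (Adv i b # K) rd = (Scan i b # K, i, rd i, 1)"
| "trans (RewC i # K) rd =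
     (if rd i = None then (Carry i # K, i, None, 1) else (RewC i # K, i, rd i, -1))"
| "trans (Carry i # K) rd =
     (if rd i = None then (K, i, Some (Bit True), 1)
      else if rd i = Some (Bit True) then (Carry i # K, i, Some (Bit False), 1)
      else if rd i = Some (Bit False) then (Fwd i # K, i, Some (Bit True), 1)
      else (Fwd i # K, i, rd i, 1))"
| "trans (Fwd i # K) rd = (if rd i = None then (K, i, None, 0) else (Fwd i # K, i, rd i, 1))"

text \<open>The stacks that can occur above the initial continuation while \<open>c\<close> runs.
  Their depth is bounded by the nesting of \<open>c\<close>, which is what makes the stack machine
  finite.\<close>

primrec pts :: "cmd \<Rightarrow> micro list set" where
  "pts Skip = {[Do Skip]}"
| "pts (App i a) = {[Do (App i a)]}"
| "pts (Incr i) = {[Do (Incr i)], [RewC i], [Carry i], [Fwd i]}"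
| "pts (Seq c d) = {[Do (Seq c d)]} \<union> (\<lambda>p. p @ [Do d]) ` pts c \<union> pts d"
| "pts (For i b) = {[Do (For i b)], [Rew i b], [Scan i b], [Adv i b]} \<union>
     (\<Union>a. (\<lambda>p. p @ [Adv i b]) ` pts (b a))"

lemma finite_pts: "finite (pts c)"
  by (induction c) auto

lemma Do_in_pts: "[Do c] \<in> pts c"
  by (cases c) auto

lemma trans_move: "trans ks rd = (ks', i, w, d) \<Longrightarrow> d \<in> {-1, 0, 1}"
  by (cases "(ks, rd)" rule: trans.cases) (auto split: if_splits option.splits)

text \<open>Uniform in the continuation \<open>K\<close>: a transition changes only the part of the
  stack that belongs to \<open>c\<close>, and the empty list signals that \<open>c\<close> is
  finished.\<close>

lemma trans_pts:
  assumes "p \<in> pts c"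
  shows "\<exists>p' i w d. p' \<in> insert [] (pts c) \<and> (\<forall>K. trans (p @ K) rd = (p' @ K, i, w, d))"
  using assms
proof (induction c arbitrary: p)
  case (Incr i)
  then show ?case by (cases "rd i = None"; cases "rd i = Some (Bit True)"; cases "rd i = Some (Bit False)") auto
next
  case (Seq c d)
  then consider "p = [Do (Seq c d)]" | p0 where "p0 \<in> pts c" "p = p0 @ [Do d]" | "p \<in> pts d"
    by auto
  then show ?case
  proof cases
    case 1
    then show ?thesis using Do_in_pts[of c] by (auto intro!: exI[of _ "[Do c, Do d]"] image_eqI)
  next
    case 2
    from Seq.IH(1)[OF 2(1)] obtain p' i w e where
      *: "p' \<in> insert [] (pts c)" "\<forall>K. trans (p0 @ K) rd = (p' @ K, i, w, e)" by blast
    have "p' @ [Do d] \<in> insert [] (pts (Seq c d))" using *(1) Do_in_pts[of d] by auto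
    moreover have "\<forall>K. trans (p @ K) rd = ((p' @ [Do d]) @ K, i, w, e)" using * 2 by simp
    ultimately show ?thesis by blast
  next
    case 3
    from Seq.IH(2)[OF 3] show ?thesis by fastforce
  qed
next
  case (For i b)
  then consider "p = [Do (For i b)]" | "p = [Rew i b]" | "p = [Scan i b]" | "p = [Adv i b]"
    | a p0 where "p0 \<in> pts (b a)" "p = p0 @ [Adv i b]"
    by auto
  then show ?case
  proof cases
    case 2
    then show ?thesis by (cases "rd i = None") auto
  next
    case 3
    show ?thesis
    proof (cases "rd i")
      case None
      then show ?thesis using 3 by auto
    next
      case (Some a)
      have "[Do (b a), Adv i b] \<in> insert [] (pts (For i b))"
        using Do_in_pts[of "b a"] by (auto intro!: image_eqI bexI)
      moreover have "\<forall>K. trans (p @ K) rd = ([Do (b a), Adv i b] @ K, i, Some a, 0)"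
        using 3 Some by simp
      ultimately show ?thesis by blast
    qed
  next
    case 5
    from For.IH[OF rangeI 5(1)] obtain p' j w e where
      *: "p' \<in> insert [] (pts (b a))" "\<forall>K. trans (p0 @ K) rd = (p' @ K, j, w, e)" by blast
    have "p' @ [Adv i b] \<in> insert [] (pts (For i b))" using *(1) by auto
    moreover have "\<forall>K. trans (p @ K) rd = ((p' @ [Adv i b]) @ K, j, w, e)" using * 5 by simp
    ultimately show ?thesis by blast
  qed auto
qed auto

lemma trans_reg:
  assumes "p \<in> pts c" "trans (p @ K) rd = (ks', i, w, d)"
  shows "i \<in> insert 0 (regs c)"
  using assms
proof (induction c arbitrary: p K)
  case (Seq c d)
  from Seq.prems(1) consider "p = [Do (Seq c d)]" | p0 where "p0 \<in> pts c" "p = p0 @ [Do d]" | "p \<in> pts d"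
    by auto
  then show ?case
  proof cases
    case 2
    then show ?thesis using Seq.IH(1)[of p0 "Do d # K"] Seq.prems(2) by auto
  next
    case 3
    then show ?thesis using Seq.IH(2)[of p K] Seq.prems(2) by auto
  qed (use Seq.prems in auto)
next
  case (For i b)
  from For.prems(1) consider "p = [Do (For i b)]" | "p = [Rew i b]" | "p = [Scan i b]" | "p = [Adv i b]"
    | a p0 where "p0 \<in> pts (b a)" "p = p0 @ [Adv i b]"
    by auto
  then show ?case
  proof cases
    case 5
    then show ?thesis using For.IH[OF rangeI, of p0 a "Adv i b # K"] For.prems(2) by auto
  qed (use For.prems in \<open>auto split: if_splits option.splits\<close>)
qed (auto split: if_splits)

section \<open>Runs of the stack machine on tapes that hold register contents\<close>

type_synonym atapes = "nat \<Rightarrow> (int \<Rightarrow> sym option) \<times> int"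

fun astep :: "micro list \<times> atapes \<Rightarrow> micro list \<times> atapes" where
  "astep (ks, T) = (case trans ks (\<lambda>j. fst (T j) (snd (T j))) of (ks', i, w, d) \<Rightarrow>
     (ks', T(i := ((fst (T i))(snd (T i) := w), snd (T i) + d))))"

definition list_tape :: "sym list \<Rightarrow> int \<Rightarrow> sym option" where
  "list_tape xs = (\<lambda>z. if 0 \<le> z \<and> z < int (length xs) then Some (xs ! nat z) else None)"

definition conf :: "(nat \<Rightarrow> sym list) \<Rightarrow> (nat \<Rightarrow> int) \<Rightarrow> atapes" where
  "conf \<sigma> h = (\<lambda>j. (list_tape (\<sigma> j), h j))"

text \<open>Invariant between commands: the heads of the registers in \<open>S\<close> stand on the
  first blank, ready to append, while all other heads are wherever an enclosing loop left
  them.\<close>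

definition at_end :: "nat set \<Rightarrow> (nat \<Rightarrow> sym list) \<Rightarrow> (nat \<Rightarrow> int) \<Rightarrow> nat \<Rightarrow> int" where
  "at_end S \<sigma> h = (\<lambda>j. if j \<in> S then int (length (\<sigma> j)) else h j)"

lemma list_tape_snoc: "(list_tape xs)(int (length xs) := Some a) = list_tape (xs @ [a])"
  by (auto simp: list_tape_def nth_append fun_eq_iff)

lemma list_tape_nth: "i < length xs \<Longrightarrow> list_tape xs (int i) = Some (xs ! i)"
  by (auto simp: list_tape_def)

lemma list_tape_end [simp]: "list_tape xs (int (length xs)) = None" "list_tape xs (-1) = None"
  by (auto simp: list_tape_def)

lemma list_tape_middle:
  "list_tape (ys @ a # xs) (int (length ys)) = Some a"
  "(list_tape (ys @ a # xs))(int (length ys) := Some a') = list_tape (ys @ a' # xs)"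
  by (auto simp: list_tape_def fun_eq_iff nth_append nth_Cons')

lemma astep_conf:
  assumes "trans ks (\<lambda>j. list_tape (\<sigma> j) (h j)) = (ks', i, w, d)"
    and "(list_tape (\<sigma> i))(h i := w) = list_tape (\<sigma>' i)"
    and "\<And>j. j \<noteq> i \<Longrightarrow> \<sigma>' j = \<sigma> j" "\<And>j. j \<noteq> i \<Longrightarrow> h' j = h j" "h' i = h i + d"
  shows "(astep ^^ Suc 0) (ks, conf \<sigma> h) = (ks', conf \<sigma>' h')"
proof -
  have "(conf \<sigma> h)(i := (list_tape (\<sigma>' i), h i + d)) = conf \<sigma>' h'"
    using assms(3-5) by (auto simp: conf_def fun_eq_iff)
  then show ?thesis using assms(1,2) by (simp add: conf_def)
qed

lemma astep_conf_keep:
  assumes "trans ks (\<lambda>j. list_tape (\<sigma> j) (h j)) = (ks', i, list_tape (\<sigma> i) (h i), d)"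
    and "\<And>j. j \<noteq> i \<Longrightarrow> h' j = h j" "h' i = h i + d"
  shows "(astep ^^ Suc 0) (ks, conf \<sigma> h) = (ks', conf \<sigma> h')"
  using assms by (intro astep_conf) auto

lemma funpow_add_apply: "(f ^^ m) x = y \<Longrightarrow> (f ^^ n) y = z \<Longrightarrow> (f ^^ (m + n)) x = z"
  by (auto simp: funpow_add add.commute[of m n])

text \<open>Shared by the rewinding phases of loops and of increments: the head walks left to the
  blank in cell -1 and steps back to cell 0.\<close>

lemma run_rew_gen:
  assumes step: "\<And>rd K. trans (r # K) rd =
     (if rd i = None then (s # K, i, None, 1) else (r # K, i, rd i, -1))"
    and "n \<le> length (\<sigma> i)"
  shows "(astep ^^ Suc n) (r # K, conf \<sigma> (h(i := int n - 1))) = (s # K, conf \<sigma> (h(i := 0)))"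
  using assms(2)
proof (induction n)
  case 0
  show ?case by (rule astep_conf_keep[where i = i and d = 1]) (simp_all add: step)
next
  case (Suc n)
  have 1: "(astep ^^ Suc 0) (r # K, conf \<sigma> (h(i := int (Suc n) - 1))) = (r # K, conf \<sigma> (h(i := int n - 1)))"
    by (rule astep_conf_keep[where i = i and d = "-1"]) (use Suc.prems in \<open>simp_all add: step list_tape_nth\<close>)
  from funpow_add_apply[OF 1 Suc.IH] Suc.prems show ?case by (metis Suc_leD add_Suc plus_nat.add_0)
qed

lemma run_rew:
  "n \<le> length (\<sigma> i) \<Longrightarrow>
   (astep ^^ Suc n) (Rew i b # K, conf \<sigma> (h(i := int n - 1))) = (Scan i b # K, conf \<sigma> (h(i := 0)))"
  by (rule run_rew_gen) simp_all

lemma run_rewC: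
  "n \<le> length (\<sigma> i) \<Longrightarrow>
   (astep ^^ Suc n) (RewC i # K, conf \<sigma> (h(i := int n - 1))) = (Carry i # K, conf \<sigma> (h(i := 0)))"
  by (rule run_rew_gen) simp_all

lemma run_fwd:
  assumes "n \<le> length (\<sigma> i)"
  shows "(astep ^^ Suc n) (Fwd i # K, conf \<sigma> (h(i := int (length (\<sigma> i) - n)))) =
    (K, conf \<sigma> (h(i := int (length (\<sigma> i)))))"
  using assms
proof (induction n)
  case 0
  show ?case by (rule astep_conf_keep[where i = i and d = 0]) simp_all
next
  case (Suc n)
  let ?k = "length (\<sigma> i) - Suc n"
  have k: "?k < length (\<sigma> i)" using Suc.prems by simp
  have 1: "(astep ^^ Suc 0) (Fwd i # K, conf \<sigma> (h(i := int ?k))) =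
      (Fwd i # K, conf \<sigma> (h(i := int (length (\<sigma> i) - n))))"
    by (rule astep_conf_keep[where i = i and d = 1])
      (use Suc.prems in \<open>simp_all add: list_tape_nth[OF k] del: of_nat_diff\<close>)
  from funpow_add_apply[OF 1 Suc.IH] Suc.prems show ?case by (metis Suc_leD add_Suc plus_nat.add_0)
qed

lemma run_carry:
  assumes "\<sigma> i = ys @ xs"
  shows "(astep ^^ inc_time xs) (Carry i # K, conf \<sigma> (h(i := int (length ys)))) =
    (K, conf (\<sigma>(i := ys @ binary_inc xs)) (h(i := int (length (ys @ binary_inc xs)))))"
  using assms
proof (induction xs arbitrary: ys \<sigma>)
  case Nil
  have "(astep ^^ Suc 0) (Carry i # K, conf \<sigma> (h(i := int (length ys)))) =
      (K, conf (\<sigma>(i := ys @ [Bit True])) (h(i := int (length (ys @ [Bit True])))))"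
    by (rule astep_conf[where i = i and d = 1 and w = "Some (Bit True)"])
      (use Nil in \<open>simp_all add: list_tape_snoc\<close>)
  then show ?case by (simp only: inc_time.simps binary_inc.simps One_nat_def)
next
  case (Cons a xs)
  show ?case
  proof (cases "a = Bit True")
    case True
    then have a: "binary_inc (a # xs) = Bit False # binary_inc xs"
      "inc_time (a # xs) = Suc 0 + inc_time xs" by simp_all
    let ?s = "\<sigma>(i := ys @ Bit False # xs)"
    have 1: "(astep ^^ Suc 0) (Carry i # K, conf \<sigma> (h(i := int (length ys)))) =
        (Carry i # K, conf ?s (h(i := int (length (ys @ [Bit False])))))"
      by (rule astep_conf[where i = i and d = 1 and w = "Some (Bit False)"])
        (use Cons.prems True in \<open>simp_all add: list_tape_middle\<close>)
    have "?s i = (ys @ [Bit False]) @ xs" by simp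
    from Cons.IH[of ?s "ys @ [Bit False]", OF this]
    have 2: "(astep ^^ inc_time xs) (Carry i # K, conf ?s (h(i := int (length (ys @ [Bit False]))))) =
      (K, conf (\<sigma>(i := ys @ binary_inc (a # xs))) (h(i := int (length (ys @ binary_inc (a # xs))))))"
      unfolding a by (simp only: fun_upd_upd append_assoc append_Cons append_Nil)
    from funpow_add_apply[OF 1 2] show ?thesis by (simp only: a(2))
  next
    case False
    let ?a = "if a = Bit False then Bit True else a"
    have a: "binary_inc (a # xs) = ?a # xs"
      "inc_time (a # xs) = Suc 0 + Suc (length xs)" using False by simp_all
    let ?s = "\<sigma>(i := ys @ ?a # xs)"
    have 1: "(astep ^^ Suc 0) (Carry i # K, conf \<sigma> (h(i := int (length ys)))) =
        (Fwd i # K, conf ?s (h(i := int (length (?s i) - length xs))))"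
      by (rule astep_conf[where i = i and d = 1 and w = "Some ?a"])
        (use Cons.prems False in \<open>simp_all add: list_tape_middle\<close>)
    have "length xs \<le> length (?s i)" by simp
    from run_fwd[of "length xs" ?s i K h, OF this]
    have 2: "(astep ^^ Suc (length xs)) (Fwd i # K, conf ?s (h(i := int (length (?s i) - length xs)))) =
      (K, conf (\<sigma>(i := ys @ binary_inc (a # xs))) (h(i := int (length (ys @ binary_inc (a # xs))))))"
      unfolding a by (simp only: fun_upd_same)
    from funpow_add_apply[OF 1 2] show ?thesis by (simp only: a(2))
  qed
qed

lemma at_end_absorb: "at_end S \<sigma> (at_end S' \<sigma> h) = at_end (S \<union> S') \<sigma> h"
  by (auto simp: at_end_def)

text \<open>The continuation \<open>K\<close> and the foreign heads \<open>h\<close> are arbitrary,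
  so that the induction hypotheses apply inside sequences and loops; the step count is exact, so
  runs compose by adding.\<close>

lemma run_cmd:
  assumes "wf_cmd c"
  shows "(astep ^^ time c \<sigma>) (Do c # K, conf \<sigma> (at_end (regs c) \<sigma> h)) =
    (K, conf (exec c \<sigma>) (at_end (regs c) (exec c \<sigma>) h))"
  using assms
proof (induction c arbitrary: \<sigma> h K)
  case Skip
  have "(astep ^^ Suc 0) (Do Skip # K, conf \<sigma> (at_end {} \<sigma> h)) = (K, conf \<sigma> (at_end {} \<sigma> h))"
    by (rule astep_conf_keep[where i = 0 and d = 0]) simp_all
  then show ?case by simp
next
  case (App i a)
  have "(astep ^^ Suc 0) (Do (App i a) # K, conf \<sigma> (at_end {i} \<sigma> h)) =
      (K, conf (\<sigma>(i := \<sigma> i @ [a])) (at_end {i} (\<sigma>(i := \<sigma> i @ [a])) h))"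
    by (rule astep_conf[where i = i and d = 1 and w = "Some a"])
      (simp_all add: at_end_def list_tape_snoc)
  then show ?case by (simp only: exec.simps regs.simps time.simps One_nat_def)
next
  case (Incr i)
  let ?n = "length (\<sigma> i)"
  let ?h = "at_end {i} \<sigma> h"
  have 1: "(astep ^^ Suc 0) (Do (Incr i) # K, conf \<sigma> ?h) =
      (RewC i # K, conf \<sigma> (?h(i := int ?n - 1)))"
    by (rule astep_conf_keep[where i = i and d = "-1"]) (simp_all add: at_end_def)
  have 2: "(astep ^^ inc_time (\<sigma> i)) (Carry i # K, conf \<sigma> (?h(i := 0))) =
     (K, conf (\<sigma>(i := binary_inc (\<sigma> i))) (?h(i := int (length (binary_inc (\<sigma> i))))))"
    using run_carry[of \<sigma> i "[]" "\<sigma> i" K ?h] by simp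
  have 3: "?h(i := int (length (binary_inc (\<sigma> i)))) =
      at_end {i} (\<sigma>(i := binary_inc (\<sigma> i))) h"
    by (auto simp: at_end_def)
  have 4: "Suc 0 + (Suc ?n + inc_time (\<sigma> i)) = time (Incr i) \<sigma>" by simp
  from funpow_add_apply[OF 1 funpow_add_apply[OF run_rewC[of ?n \<sigma> i K ?h, OF order_refl] 2]]
  show ?case unfolding 3 4 by (simp only: exec.simps regs.simps)
next
  case (Seq c d)
  have 0: "(astep ^^ Suc 0) (Do (Seq c d) # K, conf \<sigma> (at_end (regs c \<union> regs d) \<sigma> h)) =
      (Do c # Do d # K, conf \<sigma> (at_end (regs c) \<sigma> (at_end (regs d) \<sigma> h)))"
    by (rule astep_conf_keep[where i = 0 and d = 0]) (simp_all add: at_end_absorb)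
  let ?s = "exec c \<sigma>"
  \<comment> \<open>A register used by \<open>d\<close> alone keeps its length under
    \<open>c\<close>, so the two head conditions can be exchanged.\<close>
  have e: "at_end (regs c) ?s (at_end (regs d) \<sigma> h) = at_end (regs d) ?s (at_end (regs c) ?s h)"
    by (auto simp: at_end_def exec_other)
  have 1: "(astep ^^ time c \<sigma>) (Do c # Do d # K, conf \<sigma> (at_end (regs c) \<sigma> (at_end (regs d) \<sigma> h)))
    = (Do d # K, conf ?s (at_end (regs d) ?s (at_end (regs c) ?s h)))"
    using Seq.IH(1)[of \<sigma> "Do d # K" "at_end (regs d) \<sigma> h"] Seq.prems e by simp
  have e2: "at_end (regs d) (exec d ?s) (at_end (regs c) ?s h) =
     at_end (regs c \<union> regs d) (exec d ?s) h"
    by (auto simp: at_end_def exec_other)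
  have 2: "(astep ^^ time d ?s) (Do d # K, conf ?s (at_end (regs d) ?s (at_end (regs c) ?s h)))
    = (K, conf (exec d ?s) (at_end (regs c \<union> regs d) (exec d ?s) h))"
    using Seq.IH(2)[of ?s K "at_end (regs c) ?s h"] Seq.prems e2 by simp
  have 3: "Suc 0 + (time c \<sigma> + time d ?s) = time (Seq c d) \<sigma>" by simp
  from funpow_add_apply[OF 0 funpow_add_apply[OF 1 2]] show ?case unfolding 3 by simp
next
  case (For i b)
  let ?S = "\<Union>a. regs (b a)"
  have iS: "i \<notin> ?S" using For.prems by auto
  \<comment> \<open>Loop invariant: the head of tape \<open>i\<close> stands behind the processed
    prefix \<open>ys\<close>. For the body it is a foreign head, because \<open>i\<close> is not
    among its registers.\<close>
  have scan: "(astep ^^ (Suc (fold_time (\<lambda>a. exec (b a)) (\<lambda>a. time (b a)) xs s)))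
      (Scan i b # K, conf s (at_end ?S s (h(i := int (length ys))))) =
      (K, conf (fold (\<lambda>a. exec (b a)) xs s)
        (at_end ?S (fold (\<lambda>a. exec (b a)) xs s) (h(i := int (length (s i))))))"
    if "s i = ys @ xs" for s xs ys
    using that
  proof (induction xs arbitrary: s ys)
    case Nil
    have "(astep ^^ Suc 0) (Scan i b # K, conf s (at_end ?S s (h(i := int (length ys))))) =
      (K, conf s (at_end ?S s (h(i := int (length (s i))))))"
      by (rule astep_conf_keep[where i = i and d = 0]) (use Nil iS in \<open>simp_all add: at_end_def\<close>)
    then show ?case by (simp only: fold_time.simps fold_simps id_apply)
  next
    case (Cons a xs)
    let ?h = "h(i := int (length ys))"
    let ?s = "exec (b a) s"
    have rd: "list_tape (s i) (int (length ys)) = Some a"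
      using Cons.prems by (auto simp: list_tape_middle)
    have si: "?s i = s i" using For.prems by (simp add: exec_other)
    have hS: "at_end ?S s ?h = at_end (regs (b a)) s (at_end ?S s ?h)"
      by (auto simp: at_end_def)
    have 1: "(astep ^^ Suc 0) (Scan i b # K, conf s (at_end ?S s ?h)) =
        (Do (b a) # Adv i b # K, conf s (at_end (regs (b a)) s (at_end ?S s ?h)))"
      unfolding hS[symmetric]
      by (rule astep_conf_keep[where i = i and d = 0]) (use rd iS in \<open>simp_all add: at_end_def\<close>)
    have e2: "at_end (regs (b a)) ?s (at_end ?S s ?h) = at_end ?S ?s ?h"
      by (auto simp: at_end_def exec_other)
    have 2: "(astep ^^ time (b a) s)
        (Do (b a) # Adv i b # K, conf s (at_end (regs (b a)) s (at_end ?S s ?h))) =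
        (Adv i b # K, conf ?s (at_end ?S ?s ?h))"
      using For.IH[OF rangeI, of a s "Adv i b # K" "at_end ?S s ?h"] For.prems e2 by simp
    have 3: "(astep ^^ Suc 0) (Adv i b # K, conf ?s (at_end ?S ?s ?h)) =
        (Scan i b # K, conf ?s (at_end ?S ?s (h(i := int (length (ys @ [a]))))))"
      by (rule astep_conf_keep[where i = i and d = 1]) (use iS in \<open>simp_all add: at_end_def\<close>)
    have "?s i = (ys @ [a]) @ xs" using si Cons.prems by simp
    note IH = Cons.IH[of ?s "ys @ [a]", OF this]
    have 4: "Suc 0 + (time (b a) s + (Suc 0 +
        Suc (fold_time (\<lambda>a. exec (b a)) (\<lambda>a. time (b a)) xs ?s))) =
      Suc (fold_time (\<lambda>a. exec (b a)) (\<lambda>a. time (b a)) (a # xs) s)" by simp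
    from funpow_add_apply[OF 1 funpow_add_apply[OF 2 funpow_add_apply[OF 3 IH]]]
    show ?case unfolding 4 si by (simp only: fold_simps)
  qed
  let ?n = "length (\<sigma> i)"
  let ?h = "at_end (insert i ?S) \<sigma> h"
  have 1: "(astep ^^ Suc 0) (Do (For i b) # K, conf \<sigma> ?h) = (Rew i b # K, conf \<sigma> (?h(i := int ?n - 1)))"
    by (rule astep_conf_keep[where i = i and d = "-1"]) (simp_all add: at_end_def)
  have e: "?h(i := 0) = at_end ?S \<sigma> (h(i := int (length ([] :: sym list))))"
    using iS by (auto simp: at_end_def fun_eq_iff)
  have fi: "fold (\<lambda>a. exec (b a)) xs s i = s i" for xs s
    using For.prems by (induction xs arbitrary: s) (auto simp: exec_other)
  have e2: "at_end ?S s (h(i := int (length (\<sigma> i)))) = at_end (insert i ?S) s h" if "s i = \<sigma> i" for s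
    using iS that by (auto simp: at_end_def fun_eq_iff)
  have 2: "(astep ^^ Suc ?n) (Rew i b # K, conf \<sigma> (?h(i := int ?n - 1))) =
      (Scan i b # K, conf \<sigma> (at_end ?S \<sigma> (h(i := int (length ([] :: sym list))))))"
    using run_rew[of ?n \<sigma> i b K ?h] unfolding e by blast
  have 3: "Suc 0 + (Suc ?n + Suc (fold_time (\<lambda>a. exec (b a)) (\<lambda>a. time (b a)) (\<sigma> i) \<sigma>)) =
      time (For i b) \<sigma>" by simp
  have "\<sigma> i = [] @ \<sigma> i" by simp
  from funpow_add_apply[OF 1 funpow_add_apply[OF 2 scan[of \<sigma> "[]" "\<sigma> i", OF this]]]
  show ?case unfolding 3 e2[of "fold (\<lambda>a. exec (b a)) (\<sigma> i) \<sigma>", OF fi]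
    by (simp only: exec.simps regs.simps)
qed

subsection \<open>Compilation to Turing machines\<close>

fun ck_index :: "ck \<Rightarrow> nat" where
  "ck_index Blank = 0" | "ck_index Zero = 1" | "ck_index One = 2" | "ck_index Wild = 3"
| "ck_index Pre = 4" | "ck_index Mid = 5" | "ck_index Acc2 = 6" | "ck_index Acc0 = 7"

fun sym_code :: "sym option \<Rightarrow> nat" where
  "sym_code None = 0"
| "sym_code (Some (Bit b)) = bit_symbol b"
| "sym_code (Some (Cell k a b)) = 3 + 4 * ck_index k + 2 * of_bool a + of_bool b"

lemma ck_index_le: "ck_index k \<le> 7"
  by (cases k) auto

lemma ck_index_eq: "ck_index k = ck_index k' \<longleftrightarrow> k = k'"
  by (cases k; cases k') auto

lemma sym_code_less: "sym_code s < 35"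
proof (cases s rule: sym_code.cases)
  case (3 k a b)
  then show ?thesis using ck_index_le[of k] by (simp add: of_bool_def)
qed (auto simp: bit_symbol_def)

lemma inj_sym_code: "inj sym_code"
proof (rule injI)
  fix s t assume eq: "sym_code s = sym_code t"
  have *: "k = k' \<and> a = a' \<and> b = b'"
    if "sym_code (Some (Cell k a b)) = sym_code (Some (Cell k' a' b'))" for k a b k' a' b'
  proof -
    have "4 * ck_index k + (2 * of_bool a + of_bool b) = 4 * ck_index k' + (2 * of_bool a' + of_bool b')"
      using that by simp
    moreover have "2 * of_bool a + of_bool b < (4::nat)" "2 * of_bool a' + of_bool b' < (4::nat)"
      by (auto simp: of_bool_def)
    ultimately have "ck_index k = ck_index k'" "2 * of_bool a + of_bool b = (2 * of_bool a' + of_bool b' :: nat)"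
      by presburger+
    then show ?thesis by (auto simp: ck_index_eq of_bool_def split: if_splits)
  qed
  show "s = t"
    using eq * by (cases s rule: sym_code.cases; cases t rule: sym_code.cases)
      (auto simp: bit_symbol_def split: if_splits)
qed

text \<open>The machine model reserves state 0 for the start and state 1 for halting, so the
  numbering of the stacks must hit these two values.\<close>

lemma bij_with_two_values:
  assumes "finite Q" "a \<in> Q" "b \<in> Q" "a \<noteq> b"
  shows "\<exists>f. bij_betw f Q {..<card Q} \<and> f a = 0 \<and> f b = Suc 0"
proof -
  have "card (Q - {a, b}) = card {2..<card Q}"
    using assms by (simp add: card_Diff_subset)
  then obtain g where g: "bij_betw g (Q - {a, b}) {2..<card Q}"
    using assms(1) by (metis finite_Diff finite_atLeastLessThan finite_same_card_bij)
  have "card {a, b} \<le> card Q" using assms by (intro card_mono) auto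
  then have "2 \<le> card Q" using assms(4) by simp
  then have 1: "{..<card Q} = {0, 1} \<union> {2..<card Q}" by auto
  have 2: "{a, b} \<union> (Q - {a, b}) = Q" using assms by auto
  have "bij_betw (\<lambda>q. if q \<in> {a, b} then (if q = a then 0 else 1) else g q) ({a, b} \<union> (Q - {a, b}))
      ({0, 1} \<union> {2..<card Q})"
  proof (rule bij_betw_disjoint_Un)
    show "bij_betw (\<lambda>q. if q = a then 0 else (1::nat)) {a, b} {0, 1}"
      using assms(4) by (auto simp: bij_betw_def)
  qed (use g in auto)
  then show ?thesis unfolding 1 2 using assms(4)
    by (intro exI[of _ "\<lambda>q. if q \<in> {a, b} then (if q = a then 0 else 1) else g q"]) auto
qed

text \<open>A transition depends only on tape 0 and on the tape that it acts on. This bridges the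
  infinitely many abstract tapes and the \<open>R\<close> tapes of the machine.\<close>

lemma trans_cong:
  assumes "rd 0 = rd' 0" "rd (fst (snd (trans ks rd))) = rd' (fst (snd (trans ks rd)))"
  shows "trans ks rd = trans ks rd'"
  using assms by (cases "(ks, rd)" rule: trans.cases) (auto split: if_splits option.splits dest: sym)

definition init_regs :: "bool list \<Rightarrow> nat \<Rightarrow> sym list" where
  "init_regs x = (\<lambda>i. if i = 0 then map Bit x else [])"

lemma funpow_fixed: "f x = x \<Longrightarrow> (f ^^ n) x = x"
  by (induction n) auto

lemma astep_Nil: "astep ([], T) = ([], T)"
  by (auto simp: fun_eq_iff)

theorem polytime_computable_exec:
  assumes wf: "wf_cmd c" and regs: "regs c \<subseteq> {..<R}" "2 \<le> R"
    and out: "\<And>x. exec c (init_regs x) 1 = map Bit (f x)"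
    and time: "\<And>x. time c (init_regs x) \<le> poly p (length x)"
  shows "polytime_computable f"
proof -
  \<comment> \<open>The input head starts on cell 0, but \<open>run_cmd\<close> expects the heads of
    used registers at the end; \<open>Fwd 0\<close> first carries it there.\<close>
  let ?s = "[Fwd 0, Do c]"
  define Q where "Q = insert [] (insert ?s (pts c))"
  have finQ: "finite Q" unfolding Q_def by (simp add: finite_pts)
  obtain num where num: "bij_betw num Q {..<card Q}" "num ?s = 0" "num [] = Suc 0"
    using bij_with_two_values[OF finQ, of ?s "[]"] unfolding Q_def by blast
  define unnum where "unnum = inv_into Q num"
  define dec where "dec = inv sym_code"
  have dec: "dec (sym_code a) = a" for a unfolding dec_def by (rule inv_f_f[OF inj_sym_code])
  have unnum: "unnum (num ks) = ks" if "ks \<in> Q" for ks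
    using bij_betw_inv_into_left[OF num(1) that] unfolding unnum_def .
  have unnumQ: "unnum q \<in> Q" if "q < card Q" for q
  proof -
    have "q \<in> num ` Q" using num(1) that unfolding bij_betw_def by simp
    then show ?thesis unfolding unnum_def by (rule inv_into_into)
  qed
  have transQ: "fst (trans ks rd) \<in> Q \<and> fst (snd (trans ks rd)) < R" if ks: "ks \<in> Q" for ks rd
  proof -
    consider "ks = []" | "ks = ?s" | "ks \<in> pts c" using ks unfolding Q_def by blast
    then show ?thesis
    proof cases
      case 1
      then show ?thesis using regs(2) by (simp add: Q_def)
    next
      case 2
      have "trans ?s rd = (if rd 0 = None then ([Do c], 0, None, 0) else (?s, 0, rd 0, 1))" by simp
      then show ?thesis using 2 regs(2) Do_in_pts[of c] unfolding Q_def by (cases "rd 0 = None") simp_all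
    next
      case 3
      obtain p' i w d where p': "p' \<in> insert [] (pts c)" "\<forall>K. trans (ks @ K) rd = (p' @ K, i, w, d)"
        using trans_pts[OF 3] by blast
      have *: "trans (ks @ []) rd = (p', i, w, d)" using p'(2)[rule_format, of "[]"] by simp
      have "i \<in> insert 0 (regs c)" using trans_reg[OF 3 *] .
      then have "i < R" using regs by auto
      moreover have "p' \<in> Q" using p'(1) unfolding Q_def by blast
      ultimately show ?thesis using * by simp
    qed
  qed
  define \<delta> where "\<delta> = (\<lambda>q ss. case trans (unnum q) (\<lambda>j. dec (ss ! j)) of (ks', i, w, d) \<Rightarrow>
    (num ks', map (\<lambda>j. if j = i then (sym_code w, d) else (ss ! j, 0)) [0..<R]))"
  define M where "M = \<lparr>tm_tapes = R, tm_states = card Q, tm_symbols = 35, tm_delta = \<delta>\<rparr>"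
  have "{?s, []} \<subseteq> Q" unfolding Q_def by blast
  then have "card {?s, []} \<le> card Q" using finQ by (intro card_mono)
  then have card2: "2 \<le> card Q" by simp
  have numQ: "num ks < card Q" if "ks \<in> Q" for ks
    using bij_betwE[OF num(1)] that by blast
  have valid: "valid_tm M"
    unfolding valid_tm_def
  proof (intro conjI allI impI)
    fix q ss assume q: "q < tm_states M" and ss: "length ss = tm_tapes M \<and> set ss \<subseteq> {..<tm_symbols M}"
    obtain ks' i w d where tr: "trans (unnum q) (\<lambda>j. dec (ss ! j)) = (ks', i, w, d)"
      by (metis prod_cases4)
    have "ks' \<in> Q" using transQ[OF unnumQ, of q "\<lambda>j. dec (ss ! j)"] q tr by (simp add: M_def)
    moreover have "d \<in> {-1, 0, 1}" using trans_move[OF tr] .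
    moreover have "ss ! j < 35" if "j < R" for j
      using ss that by (auto simp: M_def subset_iff)
    ultimately show "case tm_delta M q ss of (q', as) \<Rightarrow> q' < tm_states M \<and> length as = tm_tapes M \<and>
        (\<forall>(a, d)\<in>set as. a < tm_symbols M \<and> d \<in> {-1, 0, 1})"
    proof -
      have "tm_delta M q ss = (num ks', map (\<lambda>j. if j = i then (sym_code w, d) else (ss ! j, 0)) [0..<R])"
        unfolding M_def \<delta>_def using tr by simp
      moreover have "num ks' < card Q" using numQ \<open>ks' \<in> Q\<close> by blast
      ultimately show ?thesis
        using sym_code_less[of w] \<open>d \<in> {-1, 0, 1}\<close> \<open>\<And>j. j < R \<Longrightarrow> ss ! j < 35\<close>
        unfolding M_def by auto
    qed
  qed (use regs card2 in \<open>auto simp: M_def\<close>)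
  define cfg where "cfg = (\<lambda>(ks, T :: atapes).
    (num ks, map (\<lambda>j. (\<lambda>z. sym_code (fst (T j) z), snd (T j))) [0..<R]))"
  have step: "tm_step M (cfg (ks, T)) = cfg (astep (ks, T)) \<and> fst (astep (ks, T)) \<in> Q"
    if ks: "ks \<in> Q" for ks T
  proof (cases "ks = []")
    case True
    then show ?thesis unfolding True astep_Nil by (simp add: cfg_def num Q_def)
  next
    case False
    have n1: "num ks \<noteq> 1"
    proof
      assume "num ks = 1"
      then have "num ks = num []" using num by simp
      moreover have "[] \<in> Q" unfolding Q_def by blast
      ultimately show False using bij_betw_imp_inj_on[OF num(1)] ks False by (meson inj_onD)
    qed
    let ?ts = "map (\<lambda>j. (\<lambda>z. sym_code (fst (T j) z), snd (T j))) [0..<R]"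
    let ?rd = "\<lambda>j. fst (T j) (snd (T j))"
    let ?rd' = "\<lambda>j. dec (map tape_read ?ts ! j)"
    have Q0: "fst (trans ks rd) \<in> Q \<and> fst (snd (trans ks rd)) < R" for rd using transQ ks by blast
    have rd: "?rd' j = ?rd j" if "j < R" for j using that by (simp add: dec)
    have treq: "trans ks ?rd' = trans ks ?rd"
      by (rule trans_cong) (rule rd, use Q0[of ?rd'] regs in linarith)+
    obtain ks' i w d where tr: "trans ks ?rd = (ks', i, w, d)" by (metis prod_cases4)
    have i: "i < R" and ks': "ks' \<in> Q" using Q0[of ?rd] tr by auto
    have "\<delta> (num ks) (map tape_read ?ts) =
       (num ks', map (\<lambda>j. if j = i then (sym_code w, d) else (map tape_read ?ts ! j, 0)) [0..<R])"
      unfolding \<delta>_def unnum[OF ks] treq tr by (simp only: prod.case)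
    then have "tm_step M (cfg (ks, T)) = (num ks', map2 tape_act ?ts
       (map (\<lambda>j. if j = i then (sym_code w, d) else (map tape_read ?ts ! j, 0)) [0..<R]))"
      using n1 unfolding cfg_def M_def by (simp only: prod.case tm_step.simps if_False tm.simps)
    also have "map2 tape_act ?ts
       (map (\<lambda>j. if j = i then (sym_code w, d) else (map tape_read ?ts ! j, 0)) [0..<R]) =
       map (\<lambda>j. (\<lambda>z. sym_code (fst ((T(i := ((fst (T i))(snd (T i) := w), snd (T i) + d))) j) z),
          snd ((T(i := ((fst (T i))(snd (T i) := w), snd (T i) + d))) j))) [0..<R]"
    proof (rule nth_equalityI)
      fix j assume "j < length (map2 tape_act ?ts
        (map (\<lambda>j. if j = i then (sym_code w, d) else (map tape_read ?ts ! j, 0)) [0..<R]))"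
      then have j: "j < R" by simp
      show "map2 tape_act ?ts
        (map (\<lambda>j. if j = i then (sym_code w, d) else (map tape_read ?ts ! j, 0)) [0..<R]) ! j =
        map (\<lambda>j. (\<lambda>z. sym_code (fst ((T(i := ((fst (T i))(snd (T i) := w), snd (T i) + d))) j) z),
          snd ((T(i := ((fst (T i))(snd (T i) := w), snd (T i) + d))) j))) [0..<R] ! j"
        using j by (cases "j = i") (simp_all add: fun_eq_iff)
    qed simp
    finally show ?thesis using tr ks' by (simp add: cfg_def)
  qed
  have steps: "(tm_step M ^^ n) (cfg (ks, T)) = cfg ((astep ^^ n) (ks, T)) \<and> fst ((astep ^^ n) (ks, T)) \<in> Q"
    if "ks \<in> Q" for n ks T
  proof (induction n)
    case (Suc n)
    then show ?case
      using step[of "fst ((astep ^^ n) (ks, T))" "snd ((astep ^^ n) (ks, T))"]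
      by (simp only: funpow.simps comp_apply prod.collapse)
  qed (use that in simp)
  \<comment> \<open>The summand \<open>[:1, 1:]\<close> pays for the \<open>length x + 1\<close>
    steps of \<open>Fwd 0\<close>.\<close>
  let ?p = "[:1, 1:] + p"
  have "tm_outputs_within M x (poly ?p (length x)) (f x)" for x
  proof -
    let ?\<sigma> = "init_regs x"
    have init: "tm_init M x = cfg (?s, conf ?\<sigma> (\<lambda>_. 0))"
    proof -
      have "word_tape x # replicate (R - 1) (word_tape []) =
        map (\<lambda>j. (\<lambda>z. sym_code (fst (conf ?\<sigma> (\<lambda>_. 0) j) z), snd (conf ?\<sigma> (\<lambda>_. 0) j))) [0..<R]"
      proof (rule nth_equalityI)
        fix j assume "j < length (word_tape x # replicate (R - 1) (word_tape []))"
        then have "j < R" using regs by simp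
        then show "(word_tape x # replicate (R - 1) (word_tape [])) ! j = map (\<lambda>j.
          (\<lambda>z. sym_code (fst (conf ?\<sigma> (\<lambda>_. 0) j) z), snd (conf ?\<sigma> (\<lambda>_. 0) j))) [0..<R] ! j"
          by (cases j) (auto simp add: word_tape_def init_regs_def conf_def list_tape_def fun_eq_iff)
      qed (use regs in simp)
      then show ?thesis by (simp add: tm_init_def cfg_def num M_def)
    qed
    have h0: "(\<lambda>_. 0)(0 := int (length (?\<sigma> 0))) = at_end (regs c) ?\<sigma> ((\<lambda>_. 0)(0 := int (length x)))"
      by (auto simp: at_end_def init_regs_def fun_eq_iff)
    have h1: "(\<lambda>_. 0)(0 := int (length (?\<sigma> 0) - length x)) = (\<lambda>_. 0 :: int)"
      by (auto simp: init_regs_def fun_eq_iff)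
    have "length x \<le> length (?\<sigma> 0)" by (simp add: init_regs_def)
    from run_fwd[of "length x" ?\<sigma> 0 "[Do c]" "\<lambda>_. 0", OF this]
    have 1: "(astep ^^ Suc (length x)) (?s, conf ?\<sigma> (\<lambda>_. 0)) =
        ([Do c], conf ?\<sigma> (at_end (regs c) ?\<sigma> ((\<lambda>_. 0)(0 := int (length x)))))"
      unfolding h0 h1 .
    let ?h = "at_end (regs c) (exec c ?\<sigma>) ((\<lambda>_. 0)(0 := int (length x)))"
    let ?t = "Suc (length x) + time c ?\<sigma>"
    have 2: "(astep ^^ ?t) (?s, conf ?\<sigma> (\<lambda>_. 0)) = ([], conf (exec c ?\<sigma>) ?h)"
      by (rule funpow_add_apply[OF 1 run_cmd[OF wf]])
    \<comment> \<open>The output is inspected after an exact number of steps; the empty stack is a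
      fixed point, so idling fills up the difference.\<close>
    define r where "r = poly p (length x) - time c ?\<sigma>"
    have "poly ?p (length x) = Suc (length x) + poly p (length x)" by simp
    then have r: "poly ?p (length x) = ?t + r"
      using time[of x] unfolding r_def by linarith
    have 3: "(astep ^^ (?t + r)) (?s, conf ?\<sigma> (\<lambda>_. 0)) = ([], conf (exec c ?\<sigma>) ?h)"
      by (rule funpow_add_apply[OF 2 funpow_fixed]) (rule astep_Nil)
    have sQ: "?s \<in> Q" by (simp add: Q_def)
    have 4: "(tm_step M ^^ poly ?p (length x)) (tm_init M x) = cfg ([], conf (exec c ?\<sigma>) ?h)"
      using steps[OF sQ, of "?t + r" "conf ?\<sigma> (\<lambda>_. 0)"] unfolding init r 3 by (rule conjunct1)
    have 5: "fst (snd (cfg ([], conf (exec c ?\<sigma>) ?h)) ! 1) = (\<lambda>z. sym_code (list_tape (map Bit (f x)) z))"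
      using out[of x] regs(2) by (simp add: conf_def cfg_def)
    have 6: "fst (cfg ([], conf (exec c ?\<sigma>) ?h)) = 1" by (simp add: cfg_def num)
    have "sym_code (list_tape (map Bit (f x)) (int i)) = bit_symbol (f x ! i)" if "i < length (f x)" for i
      using that by (simp add: list_tape_def)
    moreover have "sym_code (list_tape (map Bit (f x)) (int (length (f x)))) = 0"
      by (simp add: list_tape_def)
    ultimately show ?thesis
      unfolding tm_outputs_within_def 4 case_prod_beta 5 6 by simp
  qed
  with valid show ?thesis unfolding polytime_computable_def by blast
qed

section \<open>Colouring gadgets\<close>

text \<open>
  A tile has a boolean wire at its left, top, right and bottom side. It is drawn as a list-coloring
  instance on an 8 by 8 grid with ports at \<open>(3, 0)\<close>, \<open>(0, 3)\<close>, \<open>(3, 7)\<close>, \<open>(7, 3)\<close>. An entry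
  \<open>((row, column), (c, l))\<close> of \<open>gsites\<close> prescribes the color \<open>c\<close> if \<open>l = 0\<close>, forbids it if \<open>l = 2\<close>, and
  means no restriction if \<open>l = 1\<close>. A wire is a path of vertices with colors 1 and 2. The crossing and
  the solutions of the gadgets were found by computer search.
\<close>

datatype kind = KFree | KCross | KNand | KJunc | KOr | KVpass | KCap

text \<open>\<open>KOr\<close> is only an implication, since a disjunction column merely has to
  justify a true value at its foot. \<open>KCap\<close> ends a vertical wire with true and starts a
  new one with false. Sides that are not mentioned are free.\<close>

fun krel :: "kind \<Rightarrow> bool \<Rightarrow> bool \<Rightarrow> bool \<Rightarrow> bool \<Rightarrow> bool" where
  "krel KFree l t r b = True"
| "krel KCross l t r b = (l = r \<and> t = b)"
| "krel KNand l t r b = (l = r \<and> t = b \<and> \<not> (l \<and> t))"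
| "krel KJunc l t r b = (l = r \<and> t = b \<and> l = t)"
| "krel KOr l t r b = (b \<longrightarrow> t \<or> l)"
| "krel KVpass l t r b = (t = b)"
| "krel KCap l t r b = (t \<and> \<not> b)"

definition cross_sites :: "((nat \<times> nat) \<times> nat \<times> nat) list" where
  "cross_sites = [
    ((0, 0), (3, 2)), ((0, 1), (3, 2)), ((0, 2), (1, 2)), ((0, 3), (3, 2)), ((0, 4), (2, 2)),
    ((0, 5), (3, 2)), ((0, 6), (3, 2)), ((1, 0), (3, 2)), ((1, 2), (1, 1)), ((1, 3), (3, 2)),
    ((1, 4), (1, 1)), ((1, 5), (3, 2)), ((1, 6), (3, 2)), ((2, 0), (2, 2)), ((2, 1), (1, 1)),
    ((2, 2), (2, 2)), ((2, 3), (1, 2)), ((2, 4), (1, 2)), ((2, 5), (1, 1)), ((2, 6), (1, 2)),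
    ((3, 0), (3, 2)), ((3, 1), (3, 2)), ((3, 2), (2, 2)), ((3, 4), (2, 2)), ((3, 5), (3, 2)),
    ((3, 6), (3, 2)), ((3, 7), (3, 2)), ((4, 0), (1, 2)), ((4, 1), (1, 1)), ((4, 2), (1, 2)),
    ((4, 3), (1, 2)), ((4, 4), (2, 2)), ((4, 5), (1, 1)), ((4, 6), (2, 2)), ((5, 0), (3, 2)),
    ((5, 1), (3, 2)), ((5, 2), (1, 1)), ((5, 3), (3, 2)), ((5, 4), (1, 1)), ((5, 5), (3, 2)),
    ((5, 6), (3, 2)), ((6, 0), (3, 2)), ((6, 1), (3, 2)), ((6, 2), (2, 2)), ((6, 3), (3, 2)),
    ((6, 4), (1, 2)), ((6, 5), (3, 2)), ((6, 6), (3, 2)), ((7, 3), (3, 2))]"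

definition cross_right :: "(nat \<times> nat) list" where
  "cross_right = [
    (0, 0), (0, 1), (0, 4), (0, 5), (1, 1), (1, 2), (1, 3), (1, 4), (2, 0), (2, 1), (2, 2),
    (2, 3), (2, 4), (2, 5), (3, 0), (3, 5), (3, 6), (4, 0), (4, 1), (4, 2), (4, 3), (4, 4),
    (4, 5), (5, 1), (5, 2), (5, 3), (5, 4), (6, 0), (6, 1), (6, 4), (6, 5)]"

definition cross_down :: "(nat \<times> nat) list" where
  "cross_down = [
    (0, 0), (0, 2), (0, 3), (0, 4), (0, 6), (1, 0), (1, 1), (1, 2), (1, 4), (1, 5), (1, 6),
    (2, 1), (2, 2), (2, 4), (2, 5), (3, 1), (3, 2), (3, 4), (3, 5), (4, 0), (4, 1), (4, 2),
    (4, 4), (4, 5), (4, 6), (5, 0), (5, 2), (5, 3), (5, 4), (5, 6), (6, 3)]"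

fun gsites :: "kind \<Rightarrow> ((nat \<times> nat) \<times> nat \<times> nat) list" where
  "gsites KFree = [((3, 0), (3, 2)), ((0, 3), (3, 2)), ((3, 7), (3, 2)), ((7, 3), (3, 2))]"
| "gsites KCross = ((1, 1), (3, 2)) # cross_sites"
| "gsites KNand = ((1, 1), (1, 0)) # cross_sites"
| "gsites KJunc = [((0, 3), (3, 2)), ((1, 3), (3, 2)), ((2, 3), (3, 2)), ((3, 0), (3, 2)), ((3, 1), (3, 2)),
    ((3, 2), (3, 2)), ((3, 3), (3, 2)), ((3, 4), (3, 2)), ((3, 5), (3, 2)), ((3, 6), (3, 2)),
    ((3, 7), (3, 2)), ((4, 3), (3, 2)), ((5, 3), (3, 2)), ((6, 3), (3, 2)), ((7, 3), (3, 2))]"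
| "gsites KOr = [((0, 3), (3, 2)), ((1, 3), (3, 2)), ((2, 3), (3, 2)), ((3, 0), (3, 2)), ((3, 1), (1, 2)),
    ((3, 2), (2, 2)), ((3, 3), (1, 1)), ((3, 7), (3, 2)), ((4, 3), (1, 2)), ((5, 3), (3, 2)),
    ((6, 3), (3, 2)), ((7, 3), (3, 2))]"
| "gsites KVpass = [((0, 3), (3, 2)), ((1, 3), (3, 2)), ((2, 3), (3, 2)), ((3, 0), (3, 2)), ((3, 3), (3, 2)),
    ((3, 7), (3, 2)), ((4, 3), (3, 2)), ((5, 3), (3, 2)), ((6, 3), (3, 2)), ((7, 3), (3, 2))]"
| "gsites KCap = [((3, 0), (3, 2)), ((0, 3), (1, 0)), ((3, 7), (3, 2)), ((7, 3), (1, 0))]"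

fun gright :: "kind \<Rightarrow> (nat \<times> nat) list" where
  "gright KCross = cross_right"
| "gright KNand = cross_right"
| "gright KJunc = [(3, 0), (3, 1), (3, 2), (3, 3), (3, 4), (3, 5), (3, 6)]"
| "gright KOr = [(3, 0), (3, 1), (3, 2)]"
| "gright _ = []"

fun gdown :: "kind \<Rightarrow> (nat \<times> nat) list" where
  "gdown KCross = cross_down"
| "gdown KNand = cross_down"
| "gdown KJunc = [(0, 3), (1, 3), (2, 3), (3, 3), (4, 3), (5, 3), (6, 3)]"
| "gdown KOr = [(0, 3), (1, 3), (2, 3), (3, 3), (4, 3), (5, 3), (6, 3)]"
| "gdown KVpass = [(0, 3), (1, 3), (2, 3), (3, 3), (4, 3), (5, 3), (6, 3)]"
| "gdown _ = []"

section \<open>Soundness and completeness of the tile gadgets\<close>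

definition site_ok :: "nat \<times> nat \<Rightarrow> nat \<Rightarrow> bool" where
  "site_ok cl a \<longleftrightarrow> a \<in> {1, 2, 3} \<and> (snd cl = 0 \<longrightarrow> a = fst cl) \<and> (snd cl = 2 \<longrightarrow> a \<noteq> fst cl)"

definition gadget_colouring :: "kind \<Rightarrow> (nat \<Rightarrow> nat \<Rightarrow> nat) \<Rightarrow> bool" where
  "gadget_colouring k f \<longleftrightarrow>
     list_all (\<lambda>((p, q), cl). site_ok cl (f p q)) (gsites k) \<and>
     list_all (\<lambda>(p, q). f p q \<noteq> f p (q + 1)) (gright k) \<and>
     list_all (\<lambda>(p, q). f p q \<noteq> f (p + 1) q) (gdown k)"

declare One_nat_def [simp del]

lemma site_ok_simps [simp]:
  "site_ok (3, 2) a \<longleftrightarrow> a = 1 \<or> a = 2"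
  "site_ok (2, 2) a \<longleftrightarrow> a = 1 \<or> a = 3"
  "site_ok (1, 2) a \<longleftrightarrow> a = 2 \<or> a = 3"
  "site_ok (1, 1) a \<longleftrightarrow> a = 1 \<or> a = 2 \<or> a = 3"
  "site_ok (1, 0) a \<longleftrightarrow> a = 1"
  by (auto simp: site_ok_def)

text \<open>One corner of the crossing: \<open>m\<close> is the copy of the central bit, whose value 3 forces the two arms
  \<open>x\<close> and \<open>y\<close> to agree and whose other value \<open>a\<close> forbids that both are \<open>3 - a\<close>.\<close>

lemma cross_corner:
  fixes x y m a p s r q1 q2 q3 q4 q5 :: nat
  assumes "x = 1 \<or> x = 2" "y = 1 \<or> y = 2" "a = 1 \<or> a = 2" "m = a \<or> m = 3"
    "p = 1 \<or> p = 2 \<or> p = 3" "r = 1 \<or> r = 2 \<or> r = 3" "s = 1 \<or> s = 2"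
    "q1 = 1 \<or> q1 = 3" "q2 = 1 \<or> q2 = 2" "q3 = 1 \<or> q3 = 2" "q4 = 1 \<or> q4 = 2" "q5 = 2 \<or> q5 = 3"
    "p \<noteq> x" "p \<noteq> m" "r \<noteq> y" "r \<noteq> m" "p \<noteq> s" "s \<noteq> r"
    "p \<noteq> q1" "q1 \<noteq> q2" "q2 \<noteq> q3" "q3 \<noteq> q4" "q4 \<noteq> q5" "q5 \<noteq> r"
  shows "(m = 3 \<longrightarrow> x = y) \<and> (m = a \<longrightarrow> \<not> (x = 3 - a \<and> y = 3 - a)) \<and> (s = 1 \<longrightarrow> a = 1 \<longrightarrow> \<not> (x = 2 \<and> y = 2))"
proof -
  have "p = 3 \<Longrightarrow> r \<noteq> 3" using assms(8-12,19-24) by auto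
  moreover have "m = 3 \<Longrightarrow> p = 3 - x \<and> r = 3 - y \<and> x = y"
    using assms(1-7,13-18) by auto
  moreover have "m = a \<Longrightarrow> x = 3 - a \<Longrightarrow> p = 3" "m = a \<Longrightarrow> y = 3 - a \<Longrightarrow> r = 3"
    using assms(1-7,13-18) by auto
  ultimately show ?thesis using assms(1-7,13-18) by auto
qed

text \<open>A corner colored 3 pushes the site after it to that site's other color, which is also
  the other color of the next corner; hence the next corner is 3 as well. These implications close
  up around the ring, so the four corners broadcast one bit.\<close>

lemma cross_ring:
  fixes a b c d e f g h :: nat
  assumes "a = 1 \<or> a = 3" "b = 2 \<or> b = 3" "c = 2 \<or> c = 3" "d = 1 \<or> d = 3" "e = 1 \<or> e = 3"
    "f = 2 \<or> f = 3" "g = 2 \<or> g = 3" "h = 1 \<or> h = 3"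
    "a \<noteq> b" "b \<noteq> c" "c \<noteq> d" "d \<noteq> e" "e \<noteq> f" "f \<noteq> g" "g \<noteq> h" "h \<noteq> a"
  shows "(a = 3 \<longleftrightarrow> c = 3) \<and> (c = 3 \<longleftrightarrow> e = 3) \<and> (e = 3 \<longleftrightarrow> g = 3)"
  using assms by auto

text \<open>Case split on the bit of the ring. If the corners are 3, all four arms agree. Otherwise
  the corners alternately forbid that two consecutive arms are both 2 or both 1; chasing these
  around the centre, consecutive arms differ, so opposite arms agree. \<open>KNand\<close>
  prescribes color 1 at \<open>(1, 1)\<close>, which rules out color 2 on both the left and the
  upper arm.\<close>

lemma gadget_sound_cross:
  assumes "gadget_colouring k f" "k = KCross \<or> k = KNand"
  shows "krel k (f 3 0 = 1) (f 0 3 = 1) (f 3 7 = 2) (f 7 3 = 2)"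
proof -
  have s11: "f 1 1 = 1 \<or> f 1 1 = 2" "k = KNand \<Longrightarrow> f 1 1 = 1"
    using assms by (auto simp: gadget_colouring_def)
  have A: "list_all (\<lambda>((p, q), cl). site_ok cl (f p q)) cross_sites"
    and R: "list_all (\<lambda>(p, q). f p q \<noteq> f p (q + 1)) cross_right"
    and D: "list_all (\<lambda>(p, q). f p q \<noteq> f (p + 1) q) cross_down"
    using assms by (auto simp: gadget_colouring_def)
  note A' = A[unfolded cross_sites_def, simplified]
  note R' = R[unfolded cross_right_def, simplified]
  note D' = D[unfolded cross_down_def, simplified]
  have "list_all (\<lambda>(p, q). f p (q + 1) \<noteq> f p q) cross_right"
    "list_all (\<lambda>(p, q). f (p + 1) q \<noteq> f p q) cross_down"
    using R D by (auto simp: list_all_iff)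
  note R'' = this(1)[unfolded cross_right_def, simplified] and D'' = this(2)[unfolded cross_down_def, simplified]
  have ring: "(f 2 2 = 3 \<longleftrightarrow> f 2 4 = 3) \<and> (f 2 4 = 3 \<longleftrightarrow> f 4 4 = 3) \<and> (f 4 4 = 3 \<longleftrightarrow> f 4 2 = 3)"
    by (rule cross_ring[of "f 2 2" "f 2 3" "f 2 4" "f 3 4" "f 4 4" "f 4 3" "f 4 2" "f 3 2"]) (simp_all add: A' R' D' R'' D'')
  have c0: "(f 2 2 = 3 \<longrightarrow> f 3 1 = f 1 3) \<and> (f 2 2 = 1 \<longrightarrow> \<not> (f 3 1 = 3 - 1 \<and> f 1 3 = 3 - 1)) \<and>
      (f 1 1 = 1 \<longrightarrow> 1 = (1::nat) \<longrightarrow> \<not> (f 3 1 = 2 \<and> f 1 3 = 2))"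
    by (rule cross_corner[of "f 3 1" "f 1 3" 1 "f 2 2" "f 2 1" "f 1 2" "f 1 1" "f 2 0" "f 1 0" "f 0 0" "f 0 1" "f 0 2"])
      (use s11(1) in \<open>simp_all add: A' R' D' R'' D''\<close>)
  have c1: "(f 2 4 = 3 \<longrightarrow> f 1 3 = f 3 5) \<and> (f 2 4 = 2 \<longrightarrow> \<not> (f 1 3 = 3 - 2 \<and> f 3 5 = 3 - 2)) \<and>
      (f 1 5 = 1 \<longrightarrow> 2 = (1::nat) \<longrightarrow> \<not> (f 1 3 = 2 \<and> f 3 5 = 2))"
    by (rule cross_corner[of "f 1 3" "f 3 5" 2 "f 2 4" "f 1 4" "f 2 5" "f 1 5" "f 0 4" "f 0 5" "f 0 6" "f 1 6" "f 2 6"])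
      (use s11(1) in \<open>simp_all add: A' R' D' R'' D''\<close>)
  have c2: "(f 4 4 = 3 \<longrightarrow> f 3 5 = f 5 3) \<and> (f 4 4 = 1 \<longrightarrow> \<not> (f 3 5 = 3 - 1 \<and> f 5 3 = 3 - 1)) \<and>
      (f 5 5 = 1 \<longrightarrow> 1 = (1::nat) \<longrightarrow> \<not> (f 3 5 = 2 \<and> f 5 3 = 2))"
    by (rule cross_corner[of "f 3 5" "f 5 3" 1 "f 4 4" "f 4 5" "f 5 4" "f 5 5" "f 4 6" "f 5 6" "f 6 6" "f 6 5" "f 6 4"])
      (use s11(1) in \<open>simp_all add: A' R' D' R'' D''\<close>)
  have c3: "(f 4 2 = 3 \<longrightarrow> f 5 3 = f 3 1) \<and> (f 4 2 = 2 \<longrightarrow> \<not> (f 5 3 = 3 - 2 \<and> f 3 1 = 3 - 2)) \<and>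
      (f 5 1 = 1 \<longrightarrow> 2 = (1::nat) \<longrightarrow> \<not> (f 5 3 = 2 \<and> f 3 1 = 2))"
    by (rule cross_corner[of "f 5 3" "f 3 1" 2 "f 4 2" "f 5 2" "f 4 1" "f 5 1" "f 6 2" "f 6 1" "f 6 0" "f 5 0" "f 4 0"])
      (use s11(1) in \<open>simp_all add: A' R' D' R'' D''\<close>)
  have two: "(a = 1) = (b = 2)" "(a = 2) = (b = 1)" if "a = 1 \<or> a = 2" "b = 1 \<or> b = 2" "a \<noteq> b" for a b :: nat
    using that by auto
  have "(f 3 0 = 1) = (f 3 1 = 2)" "(f 0 3 = 1) = (f 1 3 = 2)"
    "(f 3 7 = 2) = (f 3 6 = 1)" "(f 7 3 = 2) = (f 6 3 = 1)" "(f 3 6 = 1) = (f 3 5 = 2)" "(f 6 3 = 1) = (f 5 3 = 2)"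
    by (rule two; simp add: A' R' D' R'' D'')+
  then have ports: "(f 3 0 = 1) = (f 3 1 = 2)" "(f 0 3 = 1) = (f 1 3 = 2)"
    "(f 3 7 = 2) = (f 3 5 = 2)" "(f 7 3 = 2) = (f 5 3 = 2)" by auto
  have arms: "f 3 1 = 1 \<or> f 3 1 = 2" "f 1 3 = 1 \<or> f 1 3 = 2" "f 3 5 = 1 \<or> f 3 5 = 2" "f 5 3 = 1 \<or> f 5 3 = 2"
    and cs: "f 2 2 = 1 \<or> f 2 2 = 3" "f 2 4 = 2 \<or> f 2 4 = 3" "f 4 4 = 1 \<or> f 4 4 = 3" "f 4 2 = 2 \<or> f 4 2 = 3"
    by (simp_all add: A')
  have "f 3 1 = f 3 5 \<and> f 1 3 = f 5 3"
  proof (cases "f 2 2 = 3")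
    case True
    then have "f 2 4 = 3" "f 4 4 = 3" using ring by simp_all
    then show ?thesis using True c0 c1 c2 by simp
  next
    case False
    then have "f 2 2 = 1" "f 2 4 = 2" "f 4 4 = 1" "f 4 2 = 2" using ring cs by metis+
    then have "\<not> (f 3 1 = 2 \<and> f 1 3 = 2)" "\<not> (f 1 3 = 1 \<and> f 3 5 = 1)"
      "\<not> (f 3 5 = 2 \<and> f 5 3 = 2)" "\<not> (f 5 3 = 1 \<and> f 3 1 = 1)"
      using c0 c1 c2 c3 by (simp_all add: One_nat_def)
    then show ?thesis using arms by metis
  qed
  moreover have "k = KNand \<Longrightarrow> \<not> (f 3 1 = 2 \<and> f 1 3 = 2)" using c0 s11 by auto
  ultimately show ?thesis using assms(2) unfolding ports by auto
qed

text \<open>True is color 1 at left and top ports and color 2 at right and bottom ports: a straight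
  wire through a tile has seven edges and so exchanges 1 and 2, and the edge to the next tile
  exchanges them again.\<close>

lemma gadget_sound:
  assumes "gadget_colouring k f"
  shows "krel k (f 3 0 = 1) (f 0 3 = 1) (f 3 7 = 2) (f 7 3 = 2)"
proof -
  have two: "(a = 1) = (b = 2)" "(a = 2) = (b = 1)" if "a = 1 \<or> a = 2" "b = 1 \<or> b = 2" "a \<noteq> b" for a b :: nat
    using that by auto
  consider "k = KCross \<or> k = KNand" | "k = KJunc" | "k = KOr" | "k = KVpass" | "k = KFree \<or> k = KCap"
    by (cases k) auto
  then show ?thesis
  proof cases
    case 1
    then show ?thesis using gadget_sound_cross assms by blast
  next
    case 2
    note A = assms[unfolded 2 gadget_colouring_def, simplified]
    have "(f 3 0 = 1) = (f 3 1 = 2)" "(f 3 1 = 2) = (f 3 2 = 1)" "(f 3 2 = 1) = (f 3 3 = 2)"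
      "(f 3 3 = 2) = (f 3 4 = 1)" "(f 3 4 = 1) = (f 3 5 = 2)" "(f 3 5 = 2) = (f 3 6 = 1)" "(f 3 6 = 1) = (f 3 7 = 2)"
      "(f 0 3 = 1) = (f 1 3 = 2)" "(f 1 3 = 2) = (f 2 3 = 1)" "(f 2 3 = 1) = (f 3 3 = 2)"
      "(f 3 3 = 2) = (f 4 3 = 1)" "(f 4 3 = 1) = (f 5 3 = 2)" "(f 5 3 = 2) = (f 6 3 = 1)" "(f 6 3 = 1) = (f 7 3 = 2)"
      by (rule two; simp add: A)+
    then show ?thesis unfolding 2 by (simp only: krel.simps)
  next
    case 3
    note A = assms[unfolded 3 gadget_colouring_def, simplified]
    have "(f 0 3 = 1) = (f 1 3 = 2)" "(f 1 3 = 2) = (f 2 3 = 1)" "(f 5 3 = 2) = (f 6 3 = 1)" "(f 6 3 = 1) = (f 7 3 = 2)"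
      by (rule two; simp add: A)+
    moreover have "f 5 3 = 2 \<Longrightarrow> f 4 3 = 3" "f 3 0 \<noteq> 1 \<Longrightarrow> f 3 1 = 3" "f 3 1 = 3 \<Longrightarrow> f 3 2 = 1"
      "f 2 3 = 1 \<or> f 2 3 = 2" "f 3 3 = 1 \<or> f 3 3 = 2 \<or> f 3 3 = 3" "f 3 2 \<noteq> f 3 3" "f 2 3 \<noteq> f 3 3" "f 3 3 \<noteq> f 4 3"
      using A by metis+
    ultimately show ?thesis unfolding 3 krel.simps by metis
  next
    case 4
    note A = assms[unfolded 4 gadget_colouring_def, simplified]
    have "(f 0 3 = 1) = (f 1 3 = 2)" "(f 1 3 = 2) = (f 2 3 = 1)" "(f 2 3 = 1) = (f 3 3 = 2)"
      "(f 3 3 = 2) = (f 4 3 = 1)" "(f 4 3 = 1) = (f 5 3 = 2)" "(f 5 3 = 2) = (f 6 3 = 1)" "(f 6 3 = 1) = (f 7 3 = 2)"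
      by (rule two; simp add: A)+
    then show ?thesis unfolding 4 by (simp only: krel.simps)
  next
    case 5
    then show ?thesis using assms by (auto simp: gadget_colouring_def)
  qed
qed

definition port_colouring :: "bool \<Rightarrow> bool \<Rightarrow> bool \<Rightarrow> bool \<Rightarrow> (nat \<Rightarrow> nat \<Rightarrow> nat) \<Rightarrow> bool" where
  "port_colouring l t r b f \<longleftrightarrow> f 3 0 = (if l then 1 else 2) \<and> f 0 3 = (if t then 1 else 2) \<and>
     f 3 7 = (if r then 2 else 1) \<and> f 7 3 = (if b then 2 else 1)"

definition cross_solution :: "bool \<Rightarrow> bool \<Rightarrow> nat list list" where
  "cross_solution l t = (if l then
     if t then
     [[1, 2, 3, 1, 3, 2, 1, 1],
      [2, 2, 1, 2, 1, 2, 2, 1],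
      [3, 1, 3, 2, 3, 1, 3, 1],
      [1, 2, 1, 1, 1, 2, 1, 2],
      [3, 1, 3, 2, 3, 1, 3, 1],
      [2, 2, 1, 2, 1, 2, 2, 1],
      [1, 2, 3, 1, 3, 2, 1, 1],
      [1, 1, 1, 2, 1, 1, 1, 1]]
     else
     [[1, 2, 3, 2, 1, 2, 1, 1],
      [2, 1, 2, 1, 3, 2, 2, 1],
      [1, 3, 1, 3, 2, 1, 3, 1],
      [1, 2, 3, 1, 3, 2, 1, 2],
      [3, 1, 2, 3, 1, 3, 1, 1],
      [2, 2, 3, 1, 2, 1, 2, 1],
      [1, 2, 1, 2, 3, 2, 1, 1],
      [1, 1, 1, 1, 1, 1, 1, 1]]
   else
     if t then
     [[2, 1, 2, 1, 3, 1, 2, 1],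
      [1, 1, 3, 2, 1, 2, 1, 1],
      [3, 2, 1, 3, 2, 3, 2, 1],
      [2, 1, 3, 1, 3, 1, 2, 1],
      [2, 3, 2, 3, 1, 2, 3, 1],
      [1, 2, 1, 2, 3, 1, 1, 1],
      [2, 1, 3, 1, 2, 1, 2, 1],
      [1, 1, 1, 2, 1, 1, 1, 1]]
     else
     [[2, 1, 3, 2, 1, 2, 1, 1],
      [1, 1, 2, 1, 2, 1, 2, 1],
      [3, 2, 3, 2, 3, 2, 3, 1],
      [2, 1, 1, 1, 1, 1, 2, 1],
      [3, 2, 3, 2, 3, 2, 3, 1],
      [1, 1, 2, 1, 2, 1, 1, 1],
      [2, 1, 3, 2, 3, 1, 2, 1],
      [1, 1, 1, 1, 1, 1, 1, 1]])"

definition table_fun :: "nat list list \<Rightarrow> nat \<Rightarrow> nat \<Rightarrow> nat" where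
  "table_fun xs p q = xs ! p ! q"

lemma cross_complete:
  "gadget_colouring KCross (table_fun (cross_solution l t))"
  "port_colouring l t l t (table_fun (cross_solution l t))"
  "\<not> (l \<and> t) \<Longrightarrow> table_fun (cross_solution l t) 1 1 = 1"
  by (cases l; cases t; simp add: gadget_colouring_def port_colouring_def cross_solution_def table_fun_def
      cross_sites_def cross_right_def cross_down_def)+

text \<open>\<open>KNand\<close> differs from \<open>KCross\<close> only at site
  \<open>(1, 1)\<close>, where the tables for the three remaining input pairs already have color
  1.\<close>

lemma nand_complete:
  assumes "\<not> (l \<and> t)"
  shows "gadget_colouring KNand (table_fun (cross_solution l t))"
  using cross_complete(1)[of l t] cross_complete(3)[OF assms] by (simp add: gadget_colouring_def)

definition or_solution :: "bool \<Rightarrow> bool \<Rightarrow> bool \<Rightarrow> bool \<Rightarrow> nat \<Rightarrow> nat \<Rightarrow> nat" where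
  "or_solution l t r b p q =
     (if p = 3 then
        if q = 0 then (if l then 1 else 2) else if q = 1 then (if l then 2 else 3)
        else if q = 2 then (if l \<and> \<not> t then 3 else 1)
        else if q = 3 then (if l \<and> \<not> t then 1 else if b then 2 else 3)
        else (if r then 2 else 1)
      else if p = 0 \<or> p = 2 then (if t then 1 else 2) else if p = 1 then (if t then 2 else 1)
      else if p = 4 then (if b then 3 else 2)
      else if p = 5 \<or> p = 7 then (if b then 2 else 1) else (if b then 1 else 2))"

definition wire_solution :: "bool \<Rightarrow> bool \<Rightarrow> bool \<Rightarrow> bool \<Rightarrow> nat \<Rightarrow> nat \<Rightarrow> nat" where
  "wire_solution l t r b p q =
     (if p = 3 \<and> q = 0 then (if l then 1 else 2) else if p = 3 \<and> q = 7 then (if r then 2 else 1)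
      else if p = 7 then (if b then 2 else 1)
      else if (even (p + q) \<longleftrightarrow> t) then 2 else 1)"

lemma gadget_complete:
  assumes "krel k l t r b"
  shows "\<exists>f. gadget_colouring k f \<and> port_colouring l t r b f"
proof -
  have wire: "gadget_colouring k (wire_solution l t r b) \<and> port_colouring l t r b (wire_solution l t r b)"
    if "k = KFree \<or> k = KJunc \<or> k = KVpass \<or> k = KCap"
    using that assms
    by (elim disjE; cases t; cases b; simp add: gadget_colouring_def port_colouring_def wire_solution_def)
  show ?thesis
proof (cases k)
  case KCross
  then show ?thesis using assms cross_complete[of l t] by auto
next
  case KNand
  then show ?thesis using assms cross_complete[of l t] nand_complete[of l t] by auto
next
  case KOr
  then have "gadget_colouring k (or_solution l t r b) \<and> port_colouring l t r b (or_solution l t r b)"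
    using assms by (cases l; cases t; cases b) (simp_all add: gadget_colouring_def port_colouring_def or_solution_def)
  then show ?thesis by blast
qed (use wire in blast)+
qed

lemma gsites_bounds: "((p, q), cl) \<in> set (gsites k) \<Longrightarrow> p < 8 \<and> q < 8"
  by (cases k) (auto simp: cross_sites_def)

lemma gright_bounds: "(p, q) \<in> set (gright k) \<Longrightarrow> p < 8 \<and> q < 7"
  by (cases k) (auto simp: cross_right_def)

lemma gdown_bounds: "(p, q) \<in> set (gdown k) \<Longrightarrow> p < 7 \<and> q < 8"
  by (cases k) (auto simp: cross_down_def)

lemma distinct_gsites: "distinct (map fst (gsites k))"
  by (cases k) (simp_all add: cross_sites_def)

declare One_nat_def [simp]

section \<open>Recolouring and swapping\<close>

lemma recoloring_card:
  assumes "(recoloring G r ^^ m) c c'" "finite (pverts G)"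
  shows "card {v \<in> pverts G. c v \<noteq> c' v} \<le> m"
  using assms(1)
proof (induction m arbitrary: c')
  case 0
  then show ?case by simp
next
  case (Suc m)
  from Suc.prems obtain d where d: "(recoloring G r ^^ m) c d" "recoloring G r d c'" by (rule relpowp_Suc_E)
  from d(2) obtain w a where w: "w \<in> pverts G" "c' = d(w := a)" unfolding recoloring_def by blast
  have "{v \<in> pverts G. c v \<noteq> c' v} \<subseteq> insert w {v \<in> pverts G. c v \<noteq> d v}" using w by auto
  then have "card {v \<in> pverts G. c v \<noteq> c' v} \<le> card (insert w {v \<in> pverts G. c v \<noteq> d v})"
    using assms(2) by (intro card_mono) auto
  also have "\<dots> \<le> Suc (card {v \<in> pverts G. c v \<noteq> d v})" using assms(2) by (intro card_insert_le_m1) auto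
  also have "\<dots> \<le> Suc m" using Suc.IH[OF d(1)] by simp
  finally show ?case .
qed

lemma recoloring_steps:
  assumes "finite (pverts G)" "c \<in> colorings G r" "c' \<in> colorings G r"
  shows "(recoloring G r ^^ card {v \<in> pverts G. c v \<noteq> c' v}) c c'"
  using assms(2)
proof (induction "card {v \<in> pverts G. c v \<noteq> c' v}" arbitrary: c)
  case 0
  then have "{v \<in> pverts G. c v \<noteq> c' v} = {}" using assms(1) by auto
  then have "c = c'" using 0(2) assms(3) unfolding colorings_def
    by (intro PiE_ext[of c "pverts G" "\<lambda>_. {1..r}" c']) auto
  then show ?case by simp
next
  case (Suc m)
  then have "{v \<in> pverts G. c v \<noteq> c' v} \<noteq> {}" by (metis card.empty nat.distinct(1))
  then obtain w where w: "w \<in> pverts G" "c w \<noteq> c' w" by blast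
  let ?d = "c(w := c' w)"
  have c'w: "c' w \<in> {1..r}" using w(1) assms(3) unfolding colorings_def by (rule PiE_mem[rotated])
  have d: "?d \<in> colorings G r" using Suc.prems w(1) c'w unfolding colorings_def by (auto simp: PiE_def Pi_def extensional_def)
  have eq: "{v \<in> pverts G. c v \<noteq> c' v} = insert w {v \<in> pverts G. ?d v \<noteq> c' v}" using w by auto
  have "card {v \<in> pverts G. c v \<noteq> c' v} = Suc (card {v \<in> pverts G. ?d v \<noteq> c' v})"
    unfolding eq using assms(1) by (subst card_insert_disjoint) auto
  then have m: "m = card {v \<in> pverts G. ?d v \<noteq> c' v}" using Suc.hyps(2) by simp
  from Suc.hyps(1)[OF this d] have "(recoloring G r ^^ m) ?d c'" unfolding m .
  moreover have "recoloring G r c ?d" unfolding recoloring_def using w c'w by force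
  ultimately have "(recoloring G r ^^ Suc m) c c'" by (meson relpowp_Suc_I2)
  then show ?case unfolding Suc.hyps(2) .
qed

text \<open>The least number of recolorings between two colorings is their Hamming distance: one
  recoloring removes at most one disagreement, and disagreements can be removed one at a
  time.\<close>

lemma fixable_iff:
  assumes "finite (pverts G)" "c \<in> colorings G r"
  shows "fixable G r c k \<longleftrightarrow>
    (\<exists>c'. proper_coloring G r c' \<and> card {v \<in> pverts G. c v \<noteq> c' v} \<le> k)"
proof
  assume "fixable G r c k"
  then show "\<exists>c'. proper_coloring G r c' \<and> card {v \<in> pverts G. c v \<noteq> c' v} \<le> k"
  proof -
    from \<open>fixable G r c k\<close> obtain m c' where "m \<le> k" "(recoloring G r ^^ m) c c'" "proper_coloring G r c'"
      unfolding fixable_def by blast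
    then show ?thesis using recoloring_card[OF _ assms(1)] le_trans by blast
  qed
next
  assume "\<exists>c'. proper_coloring G r c' \<and> card {v \<in> pverts G. c v \<noteq> c' v} \<le> k"
  then obtain c' where c': "proper_coloring G r c'" "card {v \<in> pverts G. c v \<noteq> c' v} \<le> k" by blast
  then have "c' \<in> colorings G r" unfolding proper_coloring_def by blast
  from recoloring_steps[OF assms this] c' show "fixable G r c k" unfolding fixable_def by blast
qed

text \<open>Induction on the number of disagreements. Equally large color classes provide a vertex
  that wrongly holds the color wanted at a wrong vertex; swapping the two settles the latter and
  spoils no vertex that was right.\<close>

lemma swap_reachable:
  assumes fin: "finite (pverts G)" and outside: "\<And>v. v \<notin> pverts G \<Longrightarrow> c v = c\<^sub>0 v"
    and hist: "\<And>a. card {v \<in> pverts G. c v = a} = card {v \<in> pverts G. c\<^sub>0 v = a}"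
  shows "permutation_of G c c\<^sub>0"
  unfolding permutation_of_def using outside hist
proof (induction "card {v \<in> pverts G. c v \<noteq> c\<^sub>0 v}" arbitrary: c\<^sub>0 rule: less_induct)
  case less
  show ?case
  proof (cases "{v \<in> pverts G. c v \<noteq> c\<^sub>0 v} = {}")
    case True
    then have "c = c\<^sub>0" using less.prems(1) by (intro ext) blast
    then show ?thesis by simp
  next
    case False
    then obtain v where v: "v \<in> pverts G" "c v \<noteq> c\<^sub>0 v" by blast
    let ?C = "{u \<in> pverts G. c u = c v}" and ?D = "{u \<in> pverts G. c\<^sub>0 u = c v}"
    have "\<not> ?D \<subseteq> ?C"
    proof
      assume "?D \<subseteq> ?C"
      \<comment> \<open>A class contained in another one of the same size equals it, but
        \<open>v\<close> lies in only one of them.\<close>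
      then have "?D = ?C" using fin less.prems(2)[of "c v"] by (intro card_subset_eq) auto
      moreover have "v \<in> ?C" using v(1) by simp
      ultimately have "v \<in> ?D" by simp
      then show False using v(2) by simp
    qed
    then obtain w where w: "w \<in> pverts G" "c\<^sub>0 w = c v" "c w \<noteq> c v" by blast
    have vw: "v \<noteq> w" using v w by auto
    let ?d = "c\<^sub>0(v := c\<^sub>0 w, w := c\<^sub>0 v)"
    have sw: "swap G c\<^sub>0 ?d" unfolding swap_def using v w vw by blast
    have sub: "{u \<in> pverts G. c u \<noteq> ?d u} \<subseteq> {u \<in> pverts G. c u \<noteq> c\<^sub>0 u}" using v w vw by auto
    have "{u \<in> pverts G. c u \<noteq> ?d u} \<subset> {u \<in> pverts G. c u \<noteq> c\<^sub>0 u}"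
    proof (rule psubsetI[OF sub])
      show "{u \<in> pverts G. c u \<noteq> ?d u} \<noteq> {u \<in> pverts G. c u \<noteq> c\<^sub>0 u}" using v w vw by (auto simp: set_eq_iff)
    qed
    then have lt: "card {u \<in> pverts G. c u \<noteq> ?d u} < card {u \<in> pverts G. c u \<noteq> c\<^sub>0 u}"
      using fin by (intro psubset_card_mono) auto
    have hist': "card {u \<in> pverts G. ?d u = a} = card {u \<in> pverts G. c\<^sub>0 u = a}" for a
    proof (rule bij_betw_same_card[of "Transposition.transpose v w"], rule bij_betw_byWitness[of _ "Transposition.transpose v w"])
      show "Transposition.transpose v w ` {u \<in> pverts G. ?d u = a} \<subseteq> {u \<in> pverts G. c\<^sub>0 u = a}"
        using v w vw by (auto simp: Transposition.transpose_def)
      show "Transposition.transpose v w ` {u \<in> pverts G. c\<^sub>0 u = a} \<subseteq> {u \<in> pverts G. ?d u = a}"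
        using v w vw by (auto simp: Transposition.transpose_def)
    qed auto
    have "(swap G)\<^sup>*\<^sup>* ?d c"
    proof (rule less.hyps[OF lt])
      show "c u = ?d u" if "u \<notin> pverts G" for u using less.prems(1)[OF that] that v(1) w(1) by auto
      show "card {u \<in> pverts G. c u = a} = card {u \<in> pverts G. ?d u = a}" for a
        using less.prems(2)[of a] hist'[of a] by (rule trans[OF _ sym])
    qed
    with sw show ?thesis by (rule converse_rtranclp_into_rtranclp)
  qed
qed

section \<open>The graph of a picture\<close>

text \<open>
  Site number \<open>g\<close> of a picture with rows of length \<open>B\<close> becomes the vertices \<open>9 g + s\<close> with \<open>s < 9\<close>: slot 0
  is the vertex of the grid, slots 1 and 2 are its pendant neighbours (of which the first \<open>slv\<close> are
  joined to it), slots 3 to 5 form the triangle and slots 6 to 8 are the isolated vertices.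
  \<open>sr\<close> and \<open>sd\<close> are the edges to the right and downwards.
\<close>

record site =
  scol :: nat
  slv :: nat
  sr :: bool
  sd :: bool

definition list_colouring :: "nat \<Rightarrow> nat \<Rightarrow> (nat \<Rightarrow> nat \<Rightarrow> site) \<Rightarrow> (nat \<Rightarrow> nat \<Rightarrow> nat) \<Rightarrow> bool" where
  "list_colouring A B S f \<longleftrightarrow> (\<forall>i<A. \<forall>j<B. f i j \<in> {1, 2, 3} \<and>
     (slv (S i j) = 0 \<longrightarrow> f i j = scol (S i j)) \<and> (slv (S i j) = 2 \<longrightarrow> f i j \<noteq> scol (S i j)) \<and>
     (sr (S i j) \<longrightarrow> f i j \<noteq> f i (Suc j)) \<and> (sd (S i j) \<longrightarrow> f i j \<noteq> f (Suc i) j))"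

definition slot_adj :: "nat \<Rightarrow> nat \<Rightarrow> nat \<Rightarrow> bool" where
  "slot_adj l s t \<longleftrightarrow> (s = 0 \<and> t = 1 \<and> 1 \<le> l) \<or> (s = 1 \<and> t = 0 \<and> 1 \<le> l) \<or>
     (s = 0 \<and> t = 2 \<and> 2 \<le> l) \<or> (s = 2 \<and> t = 0 \<and> 2 \<le> l) \<or>
     (s \<noteq> t \<and> s \<in> {3, 4, 5} \<and> t \<in> {3, 4, 5})"

locale picture =
  fixes A B :: nat and S :: "nat \<Rightarrow> nat \<Rightarrow> site"
  assumes A: "0 < A" and B: "0 < B"
    and scol: "\<And>i j. scol (S i j) \<in> {1, 2, 3}"
    and slv: "\<And>i j. slv (S i j) \<le> 2"
    and sr: "\<And>i j. j < B \<Longrightarrow> sr (S i j) \<Longrightarrow> Suc j < B"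
    and sd: "\<And>i j. i < A \<Longrightarrow> sd (S i j) \<Longrightarrow> Suc i < A"
begin

definition st :: "nat \<Rightarrow> site" where
  "st g = S (g div B) (g mod B)"

definition link :: "nat \<Rightarrow> nat \<Rightarrow> bool" where
  "link g h \<longleftrightarrow> (sr (st g) \<and> h = g + 1) \<or> (sd (st g) \<and> h = g + B)"

definition adj :: "nat \<Rightarrow> nat \<Rightarrow> bool" where
  "adj u v \<longleftrightarrow> (u div 9 = v div 9 \<and> slot_adj (slv (st (u div 9))) (u mod 9) (v mod 9)) \<or>
     (u mod 9 = 0 \<and> v mod 9 = 0 \<and> (link (u div 9) (v div 9) \<or> link (v div 9) (u div 9)))"

definition graph :: "nat pair_pre_digraph" where
  "graph = \<lparr>pverts = {..<9 * (A * B)}, parcs = {(u, v). u < 9 * (A * B) \<and> v < 9 * (A * B) \<and> adj u v}\<rparr>"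

definition slot_col :: "site \<Rightarrow> nat \<Rightarrow> nat" where
  "slot_col x s = (if s < 3 then scol x else if s < 6 then s - 2 else s - 5)"

definition col :: "nat \<Rightarrow> nat" where
  "col u = (if u < 9 * (A * B) then slot_col (st (u div 9)) (u mod 9) else undefined)"

definition budget :: nat where
  "budget = card {g. g < A * B \<and> 1 \<le> slv (st g)}"

lemma pverts_graph [simp]: "pverts graph = {..<9 * (A * B)}"
  by (simp add: graph_def)

lemma parcs_graph: "(u, v) \<in> parcs graph \<longleftrightarrow> u < 9 * (A * B) \<and> v < 9 * (A * B) \<and> adj u v"
  by (simp add: graph_def)

lemma slot_adj_sym: "slot_adj l s t \<Longrightarrow> slot_adj l t s"
  unfolding slot_adj_def by (elim disjE conjE) simp_all

lemma adj_sym: "adj u v \<Longrightarrow> adj v u"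
  unfolding adj_def by (elim disjE conjE) (simp_all add: slot_adj_sym)

lemma adj_irrefl: "\<not> adj u u"
  unfolding adj_def slot_adj_def link_def using B by auto

lemma pair_graph_graph: "pair_graph graph"
proof -
  have fin: "finite (parcs graph)"
    by (rule finite_subset[of _ "{..<9 * (A * B)} \<times> {..<9 * (A * B)}"]) (auto simp: graph_def)
  have "symmetric (with_proj graph)"
    unfolding symmetric_def by (rule symI) (use adj_sym in \<open>simp add: parcs_graph\<close>)
  then show ?thesis
    by unfold_locales (use fin adj_irrefl in \<open>auto simp: parcs_graph\<close>)
qed

lemma col_colorings: "col \<in> colorings graph 3"
proof -
  have "slot_col (st g) s \<in> {1..3}" if "s < 9" for g s
    using scol[of "g div B" "g mod B"] that by (auto simp: slot_col_def st_def)
  then show ?thesis unfolding colorings_def by (auto simp: col_def PiE_def extensional_def)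
qed

lemma st_link_cases:
  assumes "g < A * B" "link g h"
  shows "h < A * B \<and> (h div B = g div B \<and> h mod B = Suc (g mod B) \<and> sr (S (g div B) (g mod B)) \<or>
    h div B = Suc (g div B) \<and> h mod B = g mod B \<and> sd (S (g div B) (g mod B)))"
proof -
  let ?i = "g div B" and ?j = "g mod B"
  have i: "?i < A" using assms(1) by (simp add: less_mult_imp_div_less)
  have j: "?j < B" using B by simp
  have bound: "i * B + j < A * B" if "i < A" "j < B" for i j
  proof -
    have "i * B + j < Suc i * B" using that by simp
    also have "\<dots> \<le> A * B" using that by (intro mult_le_mono1) simp
    finally show ?thesis .
  qed
  have dm: "(i * B + j) div B = i" "(i * B + j) mod B = j" if "j < B" for i j using that by simp_all
  from assms(2) consider "sr (st g)" "h = g + 1" | "sd (st g)" "h = g + B" unfolding link_def by blast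
  then show ?thesis
  proof cases
    case 1
    have sj: "Suc ?j < B" using sr[OF j] 1 by (simp add: st_def)
    have h: "h = ?i * B + Suc ?j" using 1 by simp
    have "h div B = ?i" "h mod B = Suc ?j" unfolding h by (rule dm[OF sj])+
    moreover have "h < A * B" unfolding h using bound[OF i sj] .
    ultimately show ?thesis using 1 by (simp add: st_def)
  next
    case 2
    have si: "Suc ?i < A" using sd[OF i] 2 by (simp add: st_def)
    have h: "h = Suc ?i * B + ?j" using 2 by simp
    have "h div B = Suc ?i" "h mod B = ?j" unfolding h by (rule dm[OF j])+
    moreover have "h < A * B" unfolding h using bound[OF si j] .
    ultimately show ?thesis using 2 by (simp add: st_def)
  qed
qed

subsection \<open>The promise\<close>

text \<open>
  In a proper coloring of checkerboard type slot 0 gets color \<open>x\<close>. If the given color \<open>a\<close> differs from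
  \<open>x\<close>, exchanging slot 0 with the isolated vertex of color \<open>x\<close> suffices; if it agrees, the pendant
  neighbours are exchanged with the isolated vertices of the two other colors.
\<close>

definition parity_col :: "nat \<Rightarrow> nat" where
  "parity_col g = 1 + (g div B + g mod B) mod 2"

definition slot_perm :: "nat \<Rightarrow> nat \<Rightarrow> nat \<Rightarrow> nat" where
  "slot_perm a x s =
     (if x \<noteq> a then (if s = 0 then 5 + x else if s = 5 + x then 0 else s)
      else let b = (if a = 1 then 2 else 1); d = (if a = 3 then 2 else 3) in
        if s = 1 then 5 + b else if s = 5 + b then 1 else if s = 2 then 5 + d
        else if s = 5 + d then 2 else s)"

lemma slot_perm:
  assumes "a \<in> {1, 2, 3}" "x \<in> {1, 2}" "s < 9"
  shows "slot_perm a x s < 9" "slot_perm a x (slot_perm a x s) = s"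
  using assms by (auto simp: slot_perm_def Let_def)

text \<open>Acts inside each site and is an involution, so precomposing \<open>col\<close> with it
  preserves the size of every color class, as \<open>swap_reachable\<close> requires.\<close>

definition vertex_perm :: "nat \<Rightarrow> nat" where
  "vertex_perm u = 9 * (u div 9) + slot_perm (scol (st (u div 9))) (parity_col (u div 9)) (u mod 9)"

definition base_col :: "nat \<Rightarrow> nat" where
  "base_col u = (if u < 9 * (A * B) then col (vertex_perm u) else undefined)"

lemma parity_col: "parity_col g \<in> {1, 2}"
  unfolding parity_col_def by auto

lemma vertex_perm:
  "vertex_perm u div 9 = u div 9" "vertex_perm (vertex_perm u) = u"
  "u < 9 * (A * B) \<Longrightarrow> vertex_perm u < 9 * (A * B)"
proof -
  let ?p = "slot_perm (scol (st (u div 9))) (parity_col (u div 9))"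
  have a: "scol (st (u div 9)) \<in> {1, 2, 3}" using scol by (simp add: st_def)
  have s: "u mod 9 < 9" by simp
  note p = slot_perm[OF a parity_col[of "u div 9"] s]
  show d: "vertex_perm u div 9 = u div 9" unfolding vertex_perm_def using p(1) by simp
  have m: "vertex_perm u mod 9 = ?p (u mod 9)" unfolding vertex_perm_def using p(1) by simp
  show "vertex_perm (vertex_perm u) = u"
    unfolding vertex_perm_def[of "vertex_perm u"] d m p(2) by simp
  assume "u < 9 * (A * B)"
  then have "u div 9 < A * B" by simp
  then show "vertex_perm u < 9 * (A * B)" unfolding vertex_perm_def using p(1) by linarith
qed

lemma base_col_slots:
  assumes "u < 9 * (A * B)"
  shows "base_col u = slot_col (st (u div 9)) (slot_perm (scol (st (u div 9))) (parity_col (u div 9)) (u mod 9))"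
proof -
  have a: "scol (st (u div 9)) \<in> {1, 2, 3}" using scol by (simp add: st_def)
  have "u mod 9 < 9" by simp
  note p = slot_perm[OF a parity_col[of "u div 9"] this]
  have "vertex_perm u mod 9 = slot_perm (scol (st (u div 9))) (parity_col (u div 9)) (u mod 9)"
    unfolding vertex_perm_def using p(1) by simp
  then show ?thesis using assms vertex_perm(3)[OF assms] by (simp add: base_col_def col_def vertex_perm(1))
qed

lemma slot_col_perm:
  assumes "scol y = a" "a \<in> {1, 2, 3}" "x \<in> {1, 2}"
  shows "slot_col y (slot_perm a x 0) = x"
    and "slot_adj l s t \<Longrightarrow> slot_col y (slot_perm a x s) \<noteq> slot_col y (slot_perm a x t)"
proof -
  show "slot_col y (slot_perm a x 0) = x"
    using assms by (elim insertE emptyE) (simp_all add: slot_col_def slot_perm_def)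
  have "list_all (\<lambda>(s, t). slot_col y (slot_perm a x s) \<noteq> slot_col y (slot_perm a x t))
    [(0, 1), (0, 2), (3, 4), (3, 5), (4, 5)]"
    using assms(2,3) by (elim insertE emptyE) (simp_all add: slot_col_def slot_perm_def assms(1))
  moreover assume "slot_adj l s t"
  then have "(s, t) \<in> set [(0, 1), (0, 2), (3, 4), (3, 5), (4, 5)] \<or> (t, s) \<in> set [(0, 1), (0, 2), (3, 4), (3, 5), (4, 5)]"
    unfolding slot_adj_def by auto
  ultimately show "slot_col y (slot_perm a x s) \<noteq> slot_col y (slot_perm a x t)"
    unfolding list_all_iff by fastforce
qed

lemma adj_cases:
  assumes "adj u v"
  obtains (site) "u div 9 = v div 9" "slot_adj (slv (st (u div 9))) (u mod 9) (v mod 9)"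
    | (fwd) "u mod 9 = 0" "v mod 9 = 0" "link (u div 9) (v div 9)"
    | (bwd) "u mod 9 = 0" "v mod 9 = 0" "link (v div 9) (u div 9)"
  using assms unfolding adj_def by (elim disjE conjE) (assumption | rule that)+

lemma link_parity:
  assumes "g < A * B" "link g h"
  shows "parity_col g \<noteq> parity_col h"
proof -
  have "h div B + h mod B = Suc (g div B + g mod B)" using st_link_cases[OF assms] by (elim conjE disjE) simp_all
  moreover have "Suc n mod 2 \<noteq> n mod 2" for n :: nat by presburger
  ultimately show ?thesis unfolding parity_col_def by (metis add_left_cancel)
qed

lemma base_col_proper: "proper_coloring graph 3 base_col"
  unfolding proper_coloring_def
proof (intro conjI ballI, goal_cases)
  case 1
  have c: "col \<in> {..<9 * (A * B)} \<rightarrow>\<^sub>E {1..3}" using col_colorings unfolding colorings_def by simp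
  have "base_col u \<in> {1..3}" if "u < 9 * (A * B)" for u
    using PiE_mem[OF c, of "vertex_perm u"] vertex_perm(3)[OF that] that by (simp add: base_col_def)
  then show ?case unfolding colorings_def by (auto simp: base_col_def PiE_def extensional_def)
next
  case (2 e)
  obtain u v where e: "e = (u, v)" by force
  then have u: "u < 9 * (A * B)" and v: "v < 9 * (A * B)" and uv: "adj u v" using 2 parcs_graph by auto
  have a: "scol (st g) \<in> {1, 2, 3}" for g using scol by (simp add: st_def)
  have ug: "u div 9 < A * B" "v div 9 < A * B" using u v by auto
  from uv have "base_col u \<noteq> base_col v"
  proof (cases rule: adj_cases)
    case site
    then show ?thesis unfolding base_col_slots[OF u] base_col_slots[OF v]
      using slot_col_perm(2)[OF refl a parity_col, of _ "u mod 9" "v mod 9"] by metis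
  next
    case fwd
    then show ?thesis unfolding base_col_slots[OF u] base_col_slots[OF v]
      using slot_col_perm(1)[OF refl a parity_col] link_parity[OF ug(1)] by metis
  next
    case bwd
    then show ?thesis unfolding base_col_slots[OF u] base_col_slots[OF v]
      using slot_col_perm(1)[OF refl a parity_col] link_parity[OF ug(2)] by metis
  qed
  then show ?case using e by simp
qed

lemma chromatic_number_graph: "chromatic_number graph = 3"
  unfolding chromatic_number_def
proof (rule Least_equality)
  show "\<exists>c. proper_coloring graph 3 c" using base_col_proper by blast
next
  fix r assume "\<exists>c. proper_coloring graph r c"
  then obtain c where c: "proper_coloring graph r c" by blast
  have "0 < A * B" using A B by simp
  then have lt: "3 < 9 * (A * B)" "4 < 9 * (A * B)" "5 < 9 * (A * B)" by linarith+
  have "adj 3 4" "adj 3 5" "adj 4 5" by (simp_all add: adj_def slot_adj_def)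
  then have "(3, 4) \<in> parcs graph" "(3, 5) \<in> parcs graph" "(4, 5) \<in> parcs graph"
    using lt unfolding parcs_graph by blast+
  then have ne: "c 3 \<noteq> c 4" "c 3 \<noteq> c 5" "c 4 \<noteq> c 5" using c unfolding proper_coloring_def by auto
  have "c \<in> {..<9 * (A * B)} \<rightarrow>\<^sub>E {1..r}" using c unfolding proper_coloring_def colorings_def by simp
  then have "c u \<in> {1..r}" if "u < 9 * (A * B)" for u using that by (intro PiE_mem[of c]) auto
  from this[OF lt(1)] this[OF lt(2)] this[OF lt(3)] have "{c 3, c 4, c 5} \<subseteq> {1..r}" by auto
  then have "card {c 3, c 4, c 5} \<le> card {1..r}" by (intro card_mono) auto
  then show "3 \<le> r" using ne by simp
qed

lemma fix_promise_graph: "fix_promise 3 graph col"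
proof -
  have "permutation_of graph col base_col"
  proof (rule swap_reachable)
    fix a
    show "card {v \<in> pverts graph. col v = a} = card {v \<in> pverts graph. base_col v = a}"
      by (rule bij_betw_same_card[of vertex_perm], rule bij_betw_byWitness[of _ vertex_perm])
        (auto simp: base_col_def vertex_perm)
  qed (auto simp: col_def base_col_def)
  then show ?thesis unfolding fix_promise_def chromatic_number_graph using base_col_proper by blast
qed

subsection \<open>Counting recolourings\<close>

definition site_cost :: "(nat \<Rightarrow> nat) \<Rightarrow> nat \<Rightarrow> nat" where
  "site_cost c g = (\<Sum>s<9. of_bool (col (g * 9 + s) \<noteq> c (g * 9 + s)))"

lemma card_changed: "card {v \<in> pverts graph. col v \<noteq> c v} = (\<Sum>g<A * B. site_cost c g)"
proof -
  have "card {v \<in> pverts graph. col v \<noteq> c v} = (\<Sum>u<9 * (A * B). of_bool (col u \<noteq> c u))"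
    by (simp add: sum.If_cases of_bool_def Int_def)
  also have "\<dots> = (\<Sum>g<A * B. sum (\<lambda>u. of_bool (col u \<noteq> c u)) {g * 9..<g * 9 + 9})"
    unfolding sum.nat_group by (simp add: mult.commute)
  also have "\<dots> = (\<Sum>g<A * B. site_cost c g)"
    unfolding site_cost_def
  proof (rule sum.cong[OF refl])
    fix g
    show "sum (\<lambda>u. of_bool (col u \<noteq> c u)) {g * 9..<g * 9 + 9} =
      (\<Sum>s<9. of_bool (col (g * 9 + s) \<noteq> c (g * 9 + s)) :: nat)"
      using sum.shift_bounds_nat_ivl[of "\<lambda>u. of_bool (col u \<noteq> c u) :: nat" 0 "g * 9" 9]
      by (simp add: atLeast0LessThan add.commute)
  qed
  finally show ?thesis .
qed

lemma budget_sum: "budget = (\<Sum>g<A * B. of_bool (1 \<le> slv (st g)))"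
  unfolding budget_def by (simp add: sum.If_cases of_bool_def Int_def lessThan_def)

lemma sum_lessThan_9:
  fixes f :: "nat \<Rightarrow> nat"
  shows "(\<Sum>s<9. f s) = f 0 + f 1 + f 2 + f 3 + f 4 + f 5 + f 6 + f 7 + f 8"
proof -
  have "{..<9} = {0, 1, 2, 3, 4, 5, 6, 7, 8 :: nat}" by auto
  then show ?thesis by (simp add: add.assoc)
qed

lemma col_site: "g < A * B \<Longrightarrow> s < 9 \<Longrightarrow> col (g * 9 + s) = slot_col (st g) s"
  unfolding col_def by simp

text \<open>Slot 0 and its first pendant neighbour start with equal colors, so one of them has to
  change. When the bound is attained, a site without pendant neighbours changes nothing; with two of
  them, keeping slot 0 would force both pendants to change, which costs 2.\<close>

lemma site_cost_ge:
  assumes g: "g < A * B" and c: "proper_coloring graph 3 c"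
  shows "of_bool (1 \<le> slv (st g)) \<le> site_cost c g"
    and "site_cost c g \<le> of_bool (1 \<le> slv (st g)) \<Longrightarrow>
      (slv (st g) = 0 \<longrightarrow> c (9 * g) = scol (st g)) \<and> (slv (st g) = 2 \<longrightarrow> c (9 * g) \<noteq> scol (st g))"
proof -
  let ?a = "scol (st g)"
  have edge: "c (g * 9) \<noteq> c (g * 9 + s)" if "slot_adj (slv (st g)) 0 s" "s < 9" for s
  proof -
    have "(g * 9, g * 9 + s) \<in> parcs graph" using g that by (auto simp: parcs_graph adj_def)
    then show ?thesis using c unfolding proper_coloring_def by auto
  qed
  have cost: "of_bool (c (g * 9) \<noteq> ?a) + of_bool (c (g * 9 + 1) \<noteq> ?a) + of_bool (c (g * 9 + 2) \<noteq> ?a) \<le> site_cost c g"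
    unfolding site_cost_def sum_lessThan_9 using col_site[OF g, of 0] col_site[OF g, of 1] col_site[OF g, of 2]
    by (simp add: slot_col_def eq_commute)
  have l: "slv (st g) = 0 \<or> slv (st g) = 1 \<or> slv (st g) = 2" using slv[of "g div B" "g mod B"] by (auto simp: st_def)
  have 1: "1 \<le> slv (st g) \<Longrightarrow> c (g * 9) \<noteq> c (g * 9 + 1)" using edge[of 1] by (simp add: slot_adj_def)
  have 2: "slv (st g) = 2 \<Longrightarrow> c (g * 9) \<noteq> c (g * 9 + 2)" using edge[of 2] by (simp add: slot_adj_def)
  have e: "9 * g = g * 9" by simp
  show "of_bool (1 \<le> slv (st g)) \<le> site_cost c g"
    using cost 1 by (cases "1 \<le> slv (st g)"; cases "c (g * 9) = ?a") (auto simp: of_bool_def split: if_splits)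
  show "(slv (st g) = 0 \<longrightarrow> c (9 * g) = scol (st g)) \<and> (slv (st g) = 2 \<longrightarrow> c (9 * g) \<noteq> scol (st g))"
    if "site_cost c g \<le> of_bool (1 \<le> slv (st g))"
    unfolding e using cost 1 2 that l by (auto simp: of_bool_def split: if_splits)
qed

lemma fixable_imp_list_colouring:
  assumes "fixable graph 3 col budget"
  shows "\<exists>f. list_colouring A B S f"
proof -
  from assms obtain c where c: "proper_coloring graph 3 c" and
    le: "card {v \<in> pverts graph. col v \<noteq> c v} \<le> budget"
    using fixable_iff[OF _ col_colorings] by auto
  have "(\<Sum>g<A * B. site_cost c g) \<le> (\<Sum>g<A * B. of_bool (1 \<le> slv (st g)))"
    using le unfolding card_changed budget_sum .
  moreover have "(\<Sum>g<A * B. of_bool (1 \<le> slv (st g))) \<le> (\<Sum>g<A * B. site_cost c g)"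
    by (rule sum_mono) (rule site_cost_ge(1)[OF _ c], simp)
  \<comment> \<open>The budget is the sum of the termwise lower bounds, so each of these bounds is
    attained.\<close>
  ultimately have eq: "(\<Sum>g<A * B. of_bool (1 \<le> slv (st g))) = (\<Sum>g<A * B. site_cost c g)" by (rule antisym[rotated])
  have lists: "(slv (st g) = 0 \<longrightarrow> c (9 * g) = scol (st g)) \<and> (slv (st g) = 2 \<longrightarrow> c (9 * g) \<noteq> scol (st g))"
    if g: "g < A * B" for g
  proof (rule site_cost_ge(2)[OF g c], rule eq_refl, rule sym, rule sum_mono_inv[OF eq])
    show "of_bool (1 \<le> slv (st i)) \<le> site_cost c i" if "i \<in> {..<A * B}" for i
      using site_cost_ge(1)[OF _ c] that by simp
  qed (use g in simp_all)
  define f where "f = (\<lambda>i j. c (9 * (i * B + j)))"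
  have "list_colouring A B S f"
    unfolding list_colouring_def
  proof (intro allI impI)
    fix i j assume i: "i < A" and j: "j < B"
    let ?g = "i * B + j"
    have dm: "?g div B = i" "?g mod B = j" using j by simp_all
    have "?g < Suc i * B" using j by simp
    also have "\<dots> \<le> A * B" using i by (intro mult_le_mono1) simp
    finally have g: "?g < A * B" .
    have st: "st ?g = S i j" unfolding st_def dm ..
    have range: "f i j \<in> {1, 2, 3}"
    proof -
      have "c (9 * ?g) \<in> {1..3}" using c g unfolding proper_coloring_def colorings_def by (auto dest: PiE_mem)
      then show ?thesis unfolding f_def by auto
    qed
    have link: "c (9 * ?g) \<noteq> c (9 * h)" if "link ?g h" for h
    proof -
      have "h < A * B" using st_link_cases[OF g that] by blast
      then have "(9 * ?g, 9 * h) \<in> parcs graph" using g that by (auto simp: parcs_graph adj_def)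
      then show ?thesis using c unfolding proper_coloring_def by auto
    qed
    have "sr (S i j) \<longrightarrow> f i j \<noteq> f i (Suc j)"
      using link[of "?g + 1"] unfolding f_def link_def st by simp
    moreover have "sd (S i j) \<longrightarrow> f i j \<noteq> f (Suc i) j"
      using link[of "?g + B"] unfolding f_def link_def st by (simp add: add.commute add.left_commute)
    ultimately show "f i j \<in> {1, 2, 3} \<and> (slv (S i j) = 0 \<longrightarrow> f i j = scol (S i j)) \<and>
      (slv (S i j) = 2 \<longrightarrow> f i j \<noteq> scol (S i j)) \<and> (sr (S i j) \<longrightarrow> f i j \<noteq> f i (Suc j)) \<and>
      (sd (S i j) \<longrightarrow> f i j \<noteq> f (Suc i) j)"
      using range lists[OF g] unfolding st f_def by blast
  qed
  then show ?thesis by blast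
qed

lemma list_colouring_imp_fixable:
  assumes f: "list_colouring A B S f"
  shows "fixable graph 3 col budget"
proof -
  define F where "F = (\<lambda>g. f (g div B) (g mod B))"
  have F: "F g \<in> {1, 2, 3}" "slv (st g) = 0 \<Longrightarrow> F g = scol (st g)" "slv (st g) = 2 \<Longrightarrow> F g \<noteq> scol (st g)"
    "link g h \<Longrightarrow> F g \<noteq> F h" if g: "g < A * B" for g h
  proof -
    have i: "g div B < A" using g by (simp add: less_mult_imp_div_less)
    have j: "g mod B < B" using B by simp
    note f' = f[unfolded list_colouring_def, rule_format, OF i j]
    show "F g \<in> {1, 2, 3}" "slv (st g) = 0 \<Longrightarrow> F g = scol (st g)" "slv (st g) = 2 \<Longrightarrow> F g \<noteq> scol (st g)"
      using f' unfolding F_def st_def by blast+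
    show "link g h \<Longrightarrow> F g \<noteq> F h" using st_link_cases[OF g, of h] f' unfolding F_def by metis
  qed
  \<comment> \<open>One recoloring per site with pendant neighbours: slot 0 itself if its color
    changes, otherwise its single pendant neighbour. Two pendant neighbours occur only with a
    forbidden color, where slot 0 changes anyway.\<close>
  define sc where "sc = (\<lambda>x b s. if s = 0 then b
     else if s = 1 \<and> slv x = 1 \<and> b = scol x then (if scol x = 1 then 2 else 1) else slot_col x s)"
  define c where "c = (\<lambda>u. if u < 9 * (A * B) then sc (st (u div 9)) (F (u div 9)) (u mod 9) else undefined)"
  have a: "scol (st g) \<in> {1, 2, 3}" for g using scol by (simp add: st_def)
  have l: "slv (st g) = 0 \<or> slv (st g) = 1 \<or> slv (st g) = 2" for g
    using slv[of "g div B" "g mod B"] by (auto simp: st_def)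
  have "c \<in> colorings graph 3"
  proof -
    have "sc (st g) (F g) s \<in> {1..3}" if "s < 9" "g < A * B" for g s
      using F(1)[OF that(2)] a[of g] that(1) by (auto simp: sc_def slot_col_def)
    then have "c u \<in> {1..3}" if "u < 9 * (A * B)" for u
      unfolding c_def using that by simp
    then show ?thesis unfolding colorings_def by (auto simp: c_def PiE_def extensional_def)
  qed
  moreover have "c u \<noteq> c v" if "(u, v) \<in> parcs graph" for u v
  proof -
    from that have u: "u < 9 * (A * B)" and v: "v < 9 * (A * B)" and uv: "adj u v" using parcs_graph by auto
    have ug: "u div 9 < A * B" "v div 9 < A * B" using u v by auto
    from uv show ?thesis
    proof (cases rule: adj_cases)
      case site
      have "sc x b s \<noteq> sc x b t" if "slot_adj (slv x) s t" "slv x = 2 \<Longrightarrow> b \<noteq> scol x" "scol x \<in> {1, 2, 3}"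
        "slv x = 0 \<or> slv x = 1 \<or> slv x = 2" for x b s t
      proof -
        have "1 \<le> slv x \<Longrightarrow> sc x b 0 \<noteq> sc x b 1" "2 \<le> slv x \<Longrightarrow> sc x b 0 \<noteq> sc x b 2"
          using that(2-4) by (auto simp: sc_def slot_col_def)
        moreover have "sc x b s \<noteq> sc x b t" if "s \<noteq> t" "s \<in> {3, 4, 5}" "t \<in> {3, 4, 5}"
          using that by (elim insertE emptyE) (simp_all add: sc_def slot_col_def)
        ultimately show ?thesis using that(1) unfolding slot_adj_def by metis
      qed
      from this[OF site(2) F(3)[OF ug(1)] a l] show ?thesis using site(1) u v by (simp add: c_def)
    next
      case fwd
      then show ?thesis using F(4)[OF ug(1) fwd(3)] u v by (simp add: c_def sc_def)
    next
      case bwd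
      then show ?thesis using F(4)[OF ug(2) bwd(3)] u v by (simp add: c_def sc_def)
    qed
  qed
  ultimately have proper: "proper_coloring graph 3 c" unfolding proper_coloring_def by auto
  have "site_cost c g = of_bool (1 \<le> slv (st g))" if g: "g < A * B" for g
  proof -
    have "site_cost c g = (\<Sum>s<9. of_bool (slot_col (st g) s \<noteq> sc (st g) (F g) s))"
      unfolding site_cost_def
    proof (rule sum.cong[OF refl])
      fix s :: nat assume "s \<in> {..<9}"
      then have s: "s < 9" by simp
      have "c (g * 9 + s) = sc (st g) (F g) s" unfolding c_def using g s by simp
      then show "of_bool (col (g * 9 + s) \<noteq> c (g * 9 + s)) = of_bool (slot_col (st g) s \<noteq> sc (st g) (F g) s)"
        using col_site[OF g s] by simp
    qed
    also have "\<dots> = of_bool (1 \<le> slv (st g))"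
      unfolding sum_lessThan_9 using F(1-3)[OF g] a[of g] l[of g]
      by (auto simp: sc_def slot_col_def)
    finally show ?thesis .
  qed
  then have "card {v \<in> pverts graph. col v \<noteq> c v} = budget"
    unfolding card_changed budget_sum by (intro sum.cong) auto
  then show ?thesis using fixable_iff[OF _ col_colorings] proper by auto
qed

theorem fixable_graph_iff: "fixable graph 3 col budget \<longleftrightarrow> (\<exists>f. list_colouring A B S f)"
  using fixable_imp_list_colouring list_colouring_imp_fixable by blast

end

section \<open>Planarity\<close>

text \<open>
  Site \<open>(i, j)\<close> sits at the grid point with real part \<open>j\<close> and imaginary part \<open>i\<close>, and its other eight
  vertices lie within 1/4 of it in both coordinates, off the grid lines. All edges are straight segments.
\<close>

fun slot_x :: "nat \<Rightarrow> real" where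
  "slot_x s = (if s = 1 \<or> s = 4 then 1/4 else if s = 2 \<or> s = 7 then -1/4
     else if s = 3 \<or> s = 5 then 1/8 else if s = 6 \<or> s = 8 then -1/8 else 0)"

fun slot_y :: "nat \<Rightarrow> real" where
  "slot_y s = (if s = 1 \<or> s = 2 then 1/4 else if s = 5 \<or> s = 8 then -1/4
     else if s = 3 \<or> s = 4 \<or> s = 6 \<or> s = 7 then -1/8 else 0)"

declare slot_x.simps [simp del] slot_y.simps [simp del]

definition vpos :: "nat \<times> nat \<times> nat \<Rightarrow> complex" where
  "vpos = (\<lambda>(i, j, s). Complex (real j + slot_x s) (real i + slot_y s))"

text \<open>Each edge is covered by a set given by linear conditions, so that planarity becomes
  linear arithmetic and a finite case distinction over the five edges inside a site; for this it
  suffices that the segment is contained in the set.\<close>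

datatype piece = PH nat nat | PV nat nat | PS nat nat nat nat

text \<open>Linear conditions, relative to the grid point, for the five segments inside a site; the
  box in \<open>img\<close> supplies the remaining bounds. For instance,
  \<open>dx - dy = 3/8\<close> is the line through slots 4 and 5.\<close>

fun local_region :: "nat \<Rightarrow> nat \<Rightarrow> real \<Rightarrow> real \<Rightarrow> bool" where
  "local_region s t dx dy =
     (if t = 1 then dx = dy \<and> 0 \<le> dy else if t = 2 then dx = - dy \<and> 0 \<le> dy
      else if t = 4 then dy = -1/8 \<and> 1/8 \<le> dx
      else if s = 3 then dx = 1/8 \<and> dy \<le> -1/8
      else dx - dy = 3/8 \<and> 1/8 \<le> dx \<and> dy \<le> -1/8)"

declare local_region.simps [simp del]

fun img :: "piece \<Rightarrow> complex set" where
  "img (PH i j) = {z. Im z = real i \<and> real j \<le> Re z \<and> Re z \<le> real j + 1}"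
| "img (PV i j) = {z. Re z = real j \<and> real i \<le> Im z \<and> Im z \<le> real i + 1}"
| "img (PS i j s t) = {z. \<bar>Re z - real j\<bar> \<le> 1/4 \<and> \<bar>Im z - real i\<bar> \<le> 1/4 \<and>
     local_region s t (Re z - real j) (Im z - real i)}"

fun ends :: "piece \<Rightarrow> (nat \<times> nat \<times> nat) set" where
  "ends (PH i j) = {(i, j, 0), (i, Suc j, 0)}"
| "ends (PV i j) = {(i, j, 0), (Suc i, j, 0)}"
| "ends (PS i j s t) = {(i, j, s), (i, j, t)}"

fun valid_piece :: "piece \<Rightarrow> bool" where
  "valid_piece (PS i j s t) = ((s, t) \<in> {(0, 1), (0, 2), (3, 4), (3, 5), (4, 5)})"
| "valid_piece _ = True"

text \<open>Boxes of half-width 1/4 around distinct grid points are disjoint, so boxes that meet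
  belong to the same site.\<close>

lemma of_nat_near: "\<bar>real a - real b\<bar> \<le> 1/2 \<Longrightarrow> a = b"
  by linarith

lemma slot_bounds: "\<bar>slot_x s\<bar> \<le> 1/4" "\<bar>slot_y s\<bar> \<le> 1/4"
  by (simp_all add: slot_x.simps slot_y.simps)

lemma slot_zero: "s < 9 \<Longrightarrow> slot_x s = 0 \<Longrightarrow> s = 0" "s < 9 \<Longrightarrow> slot_y s = 0 \<Longrightarrow> s = 0"
  by (auto simp: slot_x.simps slot_y.simps split: if_splits)

text \<open>Segments inside a site touch the grid lines only at its own grid point; this separates
  them from the edges between sites.\<close>

lemma local_region_axis:
  assumes "(s, t) \<in> {(0, 1), (0, 2), (3, 4), (3, 5), (4, 5)}" "local_region s t dx dy" "dx = 0 \<or> dy = 0"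
  shows "s = 0 \<and> dx = 0 \<and> dy = 0"
  using assms by (auto simp: local_region.simps)

lemma vpos_inj:
  assumes "vpos (i, j, s) = vpos (i', j', s')" "s < 9" "s' < 9"
  shows "i = i' \<and> j = j' \<and> s = s'"
proof -
  have x: "real j + slot_x s = real j' + slot_x s'" and y: "real i + slot_y s = real i' + slot_y s'"
    using assms(1) by (simp_all add: vpos_def)
  have "j = j'" "i = i'" by (rule of_nat_near, use x y slot_bounds[of s] slot_bounds[of s'] in linarith)+
  moreover have "s = s'"
  proof -
    have xy: "slot_x s = slot_x s'" "slot_y s = slot_y s'" using x y calculation by simp_all
    have "s \<in> {0, 1, 2, 3, 4, 5, 6, 7, 8}" "s' \<in> {0, 1, 2, 3, 4, 5, 6, 7, 8}" using assms(2,3) by auto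
    then show ?thesis using xy by (elim insertE emptyE) (simp_all add: slot_x.simps slot_y.simps)
  qed
  ultimately show ?thesis by simp
qed

lemma vpos_in_img:
  assumes "valid_piece p" "vpos (i, j, s) \<in> img p" "s < 9"
  shows "(i, j, s) \<in> ends p"
proof (cases p)
  case (PH i' j')
  then have y: "real i + slot_y s = real i'" and x: "real j' \<le> real j + slot_x s" "real j + slot_x s \<le> real j' + 1"
    using assms(2) by (simp_all add: vpos_def)
  have "i = i'" by (rule of_nat_near) (use y slot_bounds[of s] in linarith)
  then have s: "s = 0" using y slot_zero(2)[OF assms(3)] by simp
  then have "j' \<le> j" "j \<le> Suc j'" using x by (simp_all add: slot_x.simps)
  then have "j = j' \<or> j = Suc j'" by linarith
  then show ?thesis using PH s \<open>i = i'\<close> by auto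
next
  case (PV i' j')
  then have y: "real j + slot_x s = real j'" and x: "real i' \<le> real i + slot_y s" "real i + slot_y s \<le> real i' + 1"
    using assms(2) by (simp_all add: vpos_def)
  have "j = j'" by (rule of_nat_near) (use y slot_bounds[of s] in linarith)
  then have s: "s = 0" using y slot_zero(1)[OF assms(3)] by simp
  then have "i' \<le> i" "i \<le> Suc i'" using x by (simp_all add: slot_y.simps)
  then have "i = i' \<or> i = Suc i'" by linarith
  then show ?thesis using PV s \<open>j = j'\<close> by auto
next
  case (PS i' j' a b)
  then have x: "\<bar>real j + slot_x s - real j'\<bar> \<le> 1/4" and y: "\<bar>real i + slot_y s - real i'\<bar> \<le> 1/4"
    and l: "local_region a b (real j + slot_x s - real j') (real i + slot_y s - real i')"
    using assms(2) by (simp_all add: vpos_def)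
  have ij: "i = i'" "j = j'" by (rule of_nat_near, use x y slot_bounds[of s] in linarith)+
  then have l': "local_region a b (slot_x s) (slot_y s)" using l by simp
  have ab: "(a, b) \<in> {(0, 1), (0, 2), (3, 4), (3, 5), (4, 5)}" using assms(1) PS by simp
  have "s \<in> {0, 1, 2, 3, 4, 5, 6, 7, 8}" using assms(3) by auto
  then have "s = a \<or> s = b"
    using ab l' by (elim insertE emptyE Pair_inject) (simp_all add: slot_x.simps slot_y.simps local_region.simps)
  then show ?thesis using PS ij by auto
qed

lemma vpos_centre: "z = vpos (i, j, 0) \<longleftrightarrow> Re z = real j \<and> Im z = real i"
  by (auto simp: vpos_def slot_x.simps slot_y.simps complex_eq_iff)

lemma PS_PS:
  assumes "valid_piece (PS i j s t)" "valid_piece (PS i' j' s' t')" "z \<in> img (PS i j s t)"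
    "z \<in> img (PS i' j' s' t')" "PS i j s t \<noteq> PS i' j' s' t'"
  shows "z \<in> vpos ` (ends (PS i j s t) \<inter> ends (PS i' j' s' t'))"
proof -
  have bd: "\<bar>Re z - real j\<bar> \<le> 1/4" "\<bar>Re z - real j'\<bar> \<le> 1/4" "\<bar>Im z - real i\<bar> \<le> 1/4" "\<bar>Im z - real i'\<bar> \<le> 1/4"
    using assms(3,4) by simp_all
  have ij: "i = i'" "j = j'" by (rule of_nat_near, use bd in linarith)+
  define dx dy where "dx = Re z - real j" and "dy = Im z - real i"
  have l: "local_region s t dx dy" "local_region s' t' dx dy" using assms(3,4) ij by (simp_all add: dx_def dy_def)
  have v: "(s, t) \<in> {(0, 1), (0, 2), (3, 4), (3, 5), (4, 5)}" "(s', t') \<in> {(0, 1), (0, 2), (3, 4), (3, 5), (4, 5)}"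
    "(s, t) \<noteq> (s', t')" using assms(1,2,5) ij by auto
  \<comment> \<open>\<open>w\<close> is the slot shared by the two segments. Pairs without a common
    slot also end in the last branch, but their linear conditions contradict each other.\<close>
  define w where "w = (if s = s' then s else if t = t' then t else if t = s' then t else s)"
  have w: "w \<in> {s, t} \<inter> {s', t'}" "dx = slot_x w" "dy = slot_y w"
    using v l by (elim insertE emptyE Pair_inject; auto simp: w_def local_region.simps slot_x.simps slot_y.simps)+
  have "z = vpos (i, j, w)" using w(2,3) by (auto simp: vpos_def dx_def dy_def complex_eq_iff)
  moreover have "(i, j, w) \<in> ends (PS i j s t) \<inter> ends (PS i' j' s' t')" using w(1) ij by auto
  ultimately show ?thesis by blast
qed

lemma PS_axis:
  assumes "valid_piece (PS i j s t)" "z \<in> img (PS i j s t)" "p = PH i' j' \<or> p = PV i' j'" "z \<in> img p"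
  shows "z \<in> vpos ` (ends (PS i j s t) \<inter> ends p)"
proof -
  have b: "\<bar>Re z - real j\<bar> \<le> 1/4" "\<bar>Im z - real i\<bar> \<le> 1/4" and l: "local_region s t (Re z - real j) (Im z - real i)"
    using assms(2) by simp_all
  have v: "(s, t) \<in> {(0, 1), (0, 2), (3, 4), (3, 5), (4, 5)}" using assms(1) by simp
  have "Re z - real j = 0 \<or> Im z - real i = 0"
    using assms(3)
  proof
    assume p: "p = PH i' j'"
    have "Im z = real i'" using assms(4) p by simp
    then have "i = i'" by (intro of_nat_near) (use b in linarith)
    then show ?thesis using assms(4) p by simp
  next
    assume p: "p = PV i' j'"
    have "Re z = real j'" using assms(4) p by simp
    then have "j = j'" by (intro of_nat_near) (use b in linarith)
    then show ?thesis using assms(4) p by simp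
  qed
  from local_region_axis[OF v l this] have s: "s = 0" and z: "z = vpos (i, j, 0)" by (auto simp: vpos_centre)
  have "valid_piece p" using assms(3) by auto
  from vpos_in_img[OF this, of i j 0] z assms(4) have "(i, j, 0) \<in> ends p" by simp
  then show ?thesis using s z by auto
qed

lemma axis_centre:
  assumes "p = PH i j \<or> p = PV i j" "q = PH i' j' \<or> q = PV i' j'" "p \<noteq> q" "z \<in> img p" "z \<in> img q"
  shows "\<exists>a b. z = vpos (a, b, 0)"
proof -
  have 1: ?thesis if "Im z = real i" "Re z = real j" for i j using that vpos_centre by blast
  have consec: "x = real (max a b)" if "real a \<le> x" "x \<le> real a + 1" "real b \<le> x" "x \<le> real b + 1" "a \<noteq> b" for a b :: nat and x
    using that by (cases "a < b") (auto simp: max_def)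
  from assms(1,2) show ?thesis
  proof (elim disjE)
    assume p: "p = PH i j" "q = PH i' j'"
    then have "i = i'" using assms(4,5) by simp
    then have "j \<noteq> j'" using assms(3) p by auto
    then show ?thesis using 1 consec[of j "Re z" j'] assms(4,5) p by auto
  next
    assume p: "p = PV i j" "q = PV i' j'"
    then have "j = j'" using assms(4,5) by simp
    then have "i \<noteq> i'" using assms(3) p by auto
    then show ?thesis using 1 consec[of i "Im z" i'] assms(4,5) p by auto
  next
    assume p: "p = PH i j" "q = PV i' j'"
    then show ?thesis using 1 assms(4,5) by auto
  next
    assume p: "p = PV i j" "q = PH i' j'"
    then show ?thesis using 1 assms(4,5) by auto
  qed
qed

lemma img_inter:
  assumes "valid_piece p" "valid_piece q" "p \<noteq> q"
  shows "img p \<inter> img q \<subseteq> vpos ` (ends p \<inter> ends q)"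
proof
  fix z assume "z \<in> img p \<inter> img q"
  then have z: "z \<in> img p" "z \<in> img q" by auto
  have axis: "(\<exists>i j. p = PH i j \<or> p = PV i j) \<or> (\<exists>i j s t. p = PS i j s t)" for p by (cases p) auto
  consider (ss) i j s t i' j' s' t' where "p = PS i j s t" "q = PS i' j' s' t'"
    | (sa) i j s t i' j' where "p = PS i j s t" "q = PH i' j' \<or> q = PV i' j'"
    | (as) i j s t i' j' where "q = PS i j s t" "p = PH i' j' \<or> p = PV i' j'"
    | (aa) i j i' j' where "p = PH i j \<or> p = PV i j" "q = PH i' j' \<or> q = PV i' j'"
    using axis[of p] axis[of q] by metis
  then show "z \<in> vpos ` (ends p \<inter> ends q)"
  proof cases
    case ss
    then show ?thesis using PS_PS assms z by blast
  next
    case sa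
    then show ?thesis using PS_axis[of i j s t z q] assms z by blast
  next
    case as
    then show ?thesis using PS_axis[of i j s t z p] assms z by (metis Int_commute)
  next
    case aa
    from axis_centre[OF aa assms(3) z] obtain a b where ab: "z = vpos (a, b, 0)" by blast
    have "(a, b, 0) \<in> ends p \<inter> ends q"
      using vpos_in_img[OF assms(1), of a b 0] vpos_in_img[OF assms(2), of a b 0] z ab by simp
    then show ?thesis using ab by blast
  qed
qed

lemma closed_segment_Re_Im:
  assumes "z \<in> closed_segment a b"
  obtains w where "0 \<le> w" "w \<le> 1" "Re z = Re a + w * (Re b - Re a)" "Im z = Im a + w * (Im b - Im a)"
proof -
  obtain w where w: "0 \<le> w" "w \<le> 1" and z: "z = (1 - w) *\<^sub>R a + w *\<^sub>R b"
    using assms unfolding closed_segment_def by auto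
  have "Re z = Re a + w * (Re b - Re a)" "Im z = Im a + w * (Im b - Im a)" unfolding z by (simp_all add: algebra_simps)
  with w show thesis using that by blast
qed

lemma segment_PH: "closed_segment (vpos (i, j, 0)) (vpos (i, Suc j, 0)) \<subseteq> img (PH i j)"
proof
  fix z assume "z \<in> closed_segment (vpos (i, j, 0)) (vpos (i, Suc j, 0))"
  then show "z \<in> img (PH i j)"
    by (rule closed_segment_Re_Im) (simp add: vpos_def slot_x.simps slot_y.simps)
qed

lemma segment_PV: "closed_segment (vpos (i, j, 0)) (vpos (Suc i, j, 0)) \<subseteq> img (PV i j)"
proof
  fix z assume "z \<in> closed_segment (vpos (i, j, 0)) (vpos (Suc i, j, 0))"
  then show "z \<in> img (PV i j)"
    by (rule closed_segment_Re_Im) (simp add: vpos_def slot_x.simps slot_y.simps)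
qed

lemma segment_PS:
  assumes "valid_piece (PS i j s t)"
  shows "closed_segment (vpos (i, j, s)) (vpos (i, j, t)) \<subseteq> img (PS i j s t)"
proof
  fix z assume "z \<in> closed_segment (vpos (i, j, s)) (vpos (i, j, t))"
  then obtain w where w: "0 \<le> w" "w \<le> 1"
    and z: "Re z = Re (vpos (i, j, s)) + w * (Re (vpos (i, j, t)) - Re (vpos (i, j, s)))"
      "Im z = Im (vpos (i, j, s)) + w * (Im (vpos (i, j, t)) - Im (vpos (i, j, s)))"
    by (rule closed_segment_Re_Im)
  have r: "Re z - real j = slot_x s + w * (slot_x t - slot_x s)" "Im z - real i = slot_y s + w * (slot_y t - slot_y s)"
    using z by (simp_all add: vpos_def)
  have v: "(s, t) \<in> {(0, 1), (0, 2), (3, 4), (3, 5), (4, 5)}" using assms by simp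
  have "\<bar>slot_x s + w * (slot_x t - slot_x s)\<bar> \<le> 1/4 \<and> \<bar>slot_y s + w * (slot_y t - slot_y s)\<bar> \<le> 1/4 \<and>
    local_region s t (slot_x s + w * (slot_x t - slot_x s)) (slot_y s + w * (slot_y t - slot_y s))"
    using v w by (elim insertE emptyE Pair_inject)
      (simp_all add: local_region.simps slot_x.simps slot_y.simps field_simps)
  then show "z \<in> img (PS i j s t)" using r by simp
qed

lemma segment_in_img:
  assumes "valid_piece p" "a \<in> ends p" "b \<in> ends p" "a \<noteq> b"
  shows "closed_segment (vpos a) (vpos b) \<subseteq> img p"
proof (cases p)
  case (PH i j)
  then have "(a = (i, j, 0) \<and> b = (i, Suc j, 0)) \<or> (b = (i, j, 0) \<and> a = (i, Suc j, 0))" using assms(2-4) by auto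
  then show ?thesis using segment_PH[of i j] closed_segment_commute[of "vpos a" "vpos b"] unfolding PH by metis
next
  case (PV i j)
  then have "(a = (i, j, 0) \<and> b = (Suc i, j, 0)) \<or> (b = (i, j, 0) \<and> a = (Suc i, j, 0))" using assms(2-4) by auto
  then show ?thesis using segment_PV[of i j] closed_segment_commute[of "vpos a" "vpos b"] unfolding PV by metis
next
  case (PS i j s t)
  then have "(a = (i, j, s) \<and> b = (i, j, t)) \<or> (b = (i, j, s) \<and> a = (i, j, t))" using assms(2-4) by auto
  then show ?thesis using segment_PS[of i j s t] closed_segment_commute[of "vpos a" "vpos b"] assms(1) unfolding PS by metis
qed

section \<open>Drawing the graph of a picture with straight segments\<close>

context picture
begin

definition vdec :: "nat \<Rightarrow> nat \<times> nat \<times> nat" where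
  "vdec u = (u div 9 div B, u div 9 mod B, u mod 9)"

lemma vdec_inj: "vdec u = vdec v \<Longrightarrow> u = v"
  unfolding vdec_def by (metis Pair_inject div_mod_decomp)

lemma arc_piece:
  assumes "(u, v) \<in> parcs graph"
  shows "\<exists>p. valid_piece p \<and> ends p = {vdec u, vdec v}"
proof -
  have u: "u div 9 < A * B" "v div 9 < A * B" and uv: "adj u v" using assms unfolding parcs_graph by auto
  from uv show ?thesis
  proof (cases rule: adj_cases)
    case site
    let ?p = "{(0, 1), (0, 2), (3, 4), (3, 5), (4, 5)} :: (nat \<times> nat) set"
    have "(u mod 9, v mod 9) \<in> ?p \<or> (v mod 9, u mod 9) \<in> ?p"
      using site(2) unfolding slot_adj_def by (elim disjE conjE insertE emptyE) simp_all
    then show ?thesis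
    proof
      assume "(u mod 9, v mod 9) \<in> ?p"
      then show ?thesis using site(1)
        by (intro exI[of _ "PS (u div 9 div B) (u div 9 mod B) (u mod 9) (v mod 9)"]) (simp add: vdec_def)
    next
      assume "(v mod 9, u mod 9) \<in> ?p"
      then show ?thesis using site(1)
        by (intro exI[of _ "PS (u div 9 div B) (u div 9 mod B) (v mod 9) (u mod 9)"]) (auto simp add: vdec_def)
    qed
  next
    case fwd
    from st_link_cases[OF u(1) fwd(3)] show ?thesis
    proof (elim conjE disjE)
      assume "v div 9 div B = u div 9 div B" "v div 9 mod B = Suc (u div 9 mod B)"
      then show ?thesis using fwd by (intro exI[of _ "PH (u div 9 div B) (u div 9 mod B)"]) (simp add: vdec_def)
    next
      assume "v div 9 div B = Suc (u div 9 div B)" "v div 9 mod B = u div 9 mod B"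
      then show ?thesis using fwd by (intro exI[of _ "PV (u div 9 div B) (u div 9 mod B)"]) (simp add: vdec_def)
    qed
  next
    case bwd
    from st_link_cases[OF u(2) bwd(3)] show ?thesis
    proof (elim conjE disjE)
      assume "u div 9 div B = v div 9 div B" "u div 9 mod B = Suc (v div 9 mod B)"
      then show ?thesis using bwd by (intro exI[of _ "PH (v div 9 div B) (v div 9 mod B)"]) (auto simp add: vdec_def)
    next
      assume "u div 9 div B = Suc (v div 9 div B)" "u div 9 mod B = v div 9 mod B"
      then show ?thesis using bwd by (intro exI[of _ "PV (v div 9 div B) (v div 9 mod B)"]) (auto simp add: vdec_def)
    qed
  qed
qed

theorem planar_graph: "planar graph"
proof -
  define \<phi> where "\<phi> = (\<lambda>u. vpos (vdec u))"
  \<comment> \<open>Drawings index edges by vertex sets, so minimum and maximum choose an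
    orientation.\<close>
  define \<gamma> where "\<gamma> = (\<lambda>e. linepath (\<phi> (Min e)) (\<phi> (Max e)))"
  have inj: "u = v" if "\<phi> u = \<phi> v" for u v
  proof -
    have "vdec u = vdec v"
      using vpos_inj[of "u div 9 div B" "u div 9 mod B" "u mod 9" "v div 9 div B" "v div 9 mod B" "v mod 9"] that
      unfolding \<phi>_def by (simp add: vdec_def)
    then show ?thesis by (rule vdec_inj)
  qed
  have edge: "\<exists>p. valid_piece p \<and> ends p = {vdec u, vdec v} \<and> path_image (\<gamma> {u, v}) \<subseteq> img p \<and>
      {pathstart (\<gamma> {u, v}), pathfinish (\<gamma> {u, v})} = {\<phi> u, \<phi> v} \<and> arc (\<gamma> {u, v})"
    if uv: "(u, v) \<in> parcs graph" for u v
  proof -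
    from arc_piece[OF uv] obtain p where p: "valid_piece p" "ends p = {vdec u, vdec v}" by blast
    have ne: "u \<noteq> v" using uv adj_irrefl unfolding parcs_graph by auto
    have mm: "(Min {u, v} = u \<and> Max {u, v} = v) \<or> (Min {u, v} = v \<and> Max {u, v} = u)"
      by (cases "u \<le> v") auto
    have seg: "closed_segment (\<phi> u) (\<phi> v) \<subseteq> img p"
      unfolding \<phi>_def by (rule segment_in_img) (use p ne vdec_inj in auto)
    have "path_image (\<gamma> {u, v}) \<subseteq> img p"
      using mm seg unfolding \<gamma>_def by (auto simp: closed_segment_commute)
    moreover have "{pathstart (\<gamma> {u, v}), pathfinish (\<gamma> {u, v})} = {\<phi> u, \<phi> v}"
      using mm unfolding \<gamma>_def by auto
    moreover have "\<phi> (Min {u, v}) \<noteq> \<phi> (Max {u, v})" using mm ne inj by metis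
    then have "arc (\<gamma> {u, v})" unfolding \<gamma>_def by (rule arc_linepath)
    ultimately show ?thesis using p by blast
  qed
  have "planar_drawing graph \<phi> \<gamma>"
    unfolding planar_drawing_def
  proof (intro conjI)
    show "inj_on \<phi> (pverts graph)" using inj by (auto simp: inj_on_def)
    show "\<forall>(u, v)\<in>parcs graph. arc (\<gamma> {u, v}) \<and>
        {pathstart (\<gamma> {u, v}), pathfinish (\<gamma> {u, v})} = {\<phi> u, \<phi> v} \<and>
        path_image (\<gamma> {u, v}) \<inter> \<phi> ` pverts graph = {\<phi> u, \<phi> v}"
    proof (intro ballI, clarify)
      fix u v assume uv: "(u, v) \<in> parcs graph"
      from edge[OF uv] obtain p where p: "valid_piece p" "ends p = {vdec u, vdec v}"
        "path_image (\<gamma> {u, v}) \<subseteq> img p" "{pathstart (\<gamma> {u, v}), pathfinish (\<gamma> {u, v})} = {\<phi> u, \<phi> v}"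
        "arc (\<gamma> {u, v})" by blast
      have V: "u \<in> pverts graph" "v \<in> pverts graph" using uv unfolding parcs_graph by auto
      have "path_image (\<gamma> {u, v}) \<inter> \<phi> ` pverts graph \<subseteq> {\<phi> u, \<phi> v}"
      proof
        fix z assume "z \<in> path_image (\<gamma> {u, v}) \<inter> \<phi> ` pverts graph"
        then obtain w where w: "z = \<phi> w" "\<phi> w \<in> img p" using p(3) by auto
        have "vdec w \<in> ends p"
          using vpos_in_img[OF p(1), of "w div 9 div B" "w div 9 mod B" "w mod 9"] w(2)
          unfolding \<phi>_def by (simp add: vdec_def)
        then have "w = u \<or> w = v" using p(2) vdec_inj by blast
        then show "z \<in> {\<phi> u, \<phi> v}" using w(1) by blast
      qed
      moreover have "{\<phi> u, \<phi> v} \<subseteq> path_image (\<gamma> {u, v})" unfolding p(4)[symmetric]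
        by (simp add: pathstart_in_path_image pathfinish_in_path_image)
      moreover have "{\<phi> u, \<phi> v} \<subseteq> \<phi> ` pverts graph" using V by blast
      ultimately show "arc (\<gamma> {u, v}) \<and> {pathstart (\<gamma> {u, v}), pathfinish (\<gamma> {u, v})} = {\<phi> u, \<phi> v} \<and>
        path_image (\<gamma> {u, v}) \<inter> \<phi> ` pverts graph = {\<phi> u, \<phi> v}" using p(4,5) by blast
    qed
    show "\<forall>(u, v)\<in>parcs graph. \<forall>(u', v')\<in>parcs graph. {u, v} \<noteq> {u', v'} \<longrightarrow>
        path_image (\<gamma> {u, v}) \<inter> path_image (\<gamma> {u', v'}) \<subseteq> \<phi> ` ({u, v} \<inter> {u', v'})"
    proof (intro ballI, clarify)
      fix u v u' v' z assume uv: "(u, v) \<in> parcs graph" and uv': "(u', v') \<in> parcs graph" and ne: "{u, v} \<noteq> {u', v'}"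
        and z: "z \<in> path_image (\<gamma> {u, v})" "z \<in> path_image (\<gamma> {u', v'})"
      from edge[OF uv] obtain p where p: "valid_piece p" "ends p = {vdec u, vdec v}" "path_image (\<gamma> {u, v}) \<subseteq> img p" by blast
      from edge[OF uv'] obtain q where q: "valid_piece q" "ends q = {vdec u', vdec v'}" "path_image (\<gamma> {u', v'}) \<subseteq> img q" by blast
      have injv: "inj vdec" using vdec_inj by (auto simp: inj_def)
      have e: "ends p = vdec ` {u, v}" "ends q = vdec ` {u', v'}" using p q by auto
      have "p \<noteq> q" using ne e inj_image_eq_iff[OF injv] by metis
      from img_inter[OF p(1) q(1) this] z p(3) q(3) have "z \<in> vpos ` (ends p \<inter> ends q)" by blast
      then show "z \<in> \<phi> ` ({u, v} \<inter> {u', v'})"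
        unfolding e image_Int[OF injv, symmetric] \<phi>_def by (simp add: image_image)
    qed
  qed
  then show ?thesis unfolding planar_def by blast
qed

end

section \<open>From boolean tilings to list colourings\<close>

text \<open>Positions outside the gadget get the prescribed color 1: they have no pendant neighbours
  and no grid edges, and contribute nothing to the budget.\<close>

definition gcl :: "kind \<Rightarrow> nat \<Rightarrow> nat \<Rightarrow> nat \<times> nat" where
  "gcl k p q = (case map_of (gsites k) (p, q) of Some cl \<Rightarrow> cl | None \<Rightarrow> (1, 0))"

text \<open>Besides the edges of the gadget, the right and the bottom port are joined to the facing
  port of the next tile, if there is one.\<close>

definition ksite :: "kind \<Rightarrow> bool \<Rightarrow> bool \<Rightarrow> nat \<Rightarrow> nat \<Rightarrow> site" where
  "ksite k lastrow lastcol p q = \<lparr>scol = fst (gcl k p q), slv = snd (gcl k p q),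
     sr = ((p, q) \<in> set (gright k) \<or> p = 3 \<and> q = 7 \<and> \<not> lastcol),
     sd = ((p, q) \<in> set (gdown k) \<or> p = 7 \<and> q = 3 \<and> \<not> lastrow)\<rparr>"

definition kind_picture :: "nat \<Rightarrow> nat \<Rightarrow> (nat \<Rightarrow> nat \<Rightarrow> kind) \<Rightarrow> nat \<Rightarrow> nat \<Rightarrow> site" where
  "kind_picture m n \<kappa> i j = ksite (\<kappa> (i div 8) (j div 8)) (Suc (i div 8) = m) (Suc (j div 8) = n) (i mod 8) (j mod 8)"

definition tile_labelling :: "nat \<Rightarrow> nat \<Rightarrow> (nat \<Rightarrow> nat \<Rightarrow> kind) \<Rightarrow> (nat \<Rightarrow> nat \<Rightarrow> bool) \<Rightarrow> (nat \<Rightarrow> nat \<Rightarrow> bool) \<Rightarrow> bool" where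
  "tile_labelling m n \<kappa> h v \<longleftrightarrow>
     (\<forall>I<m. \<forall>J<n. krel (\<kappa> I J) (h I J) (v I J) (h I (Suc J)) (v (Suc I) J))"

lemma gcl_range: "fst (gcl k p q) \<in> {1, 2, 3}" "snd (gcl k p q) \<le> 2"
proof -
  have "list_all (\<lambda>(_, c, l). c \<in> {1, 2, 3} \<and> l \<le> 2) (gsites k)"
    by (cases k) (simp_all add: cross_sites_def)
  then have "c \<in> {1, 2, 3} \<and> l \<le> 2" if "map_of (gsites k) (p, q) = Some (c, l)" for c l
    using map_of_SomeD[OF that] by (auto simp: list_all_iff)
  then show "fst (gcl k p q) \<in> {1, 2, 3}" "snd (gcl k p q) \<le> 2"
    unfolding gcl_def by (auto split: option.splits)
qed

lemma gcl_gsites: "((p, q), cl) \<in> set (gsites k) \<Longrightarrow> gcl k p q = cl"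
  unfolding gcl_def using map_of_is_SomeI[OF distinct_gsites] by fastforce

lemma picture_kind_picture:
  assumes "0 < m" "0 < n"
  shows "picture (8 * m) (8 * n) (kind_picture m n \<kappa>)"
proof
  fix i j
  show "scol (kind_picture m n \<kappa> i j) \<in> {1, 2, 3}" "slv (kind_picture m n \<kappa> i j) \<le> 2"
    using gcl_range by (simp_all add: kind_picture_def ksite_def)
  show "Suc j < 8 * n" if j: "j < 8 * n" "sr (kind_picture m n \<kappa> i j)"
  proof (rule ccontr)
    assume "\<not> Suc j < 8 * n"
    then have "j = 8 * (n - 1) + 7" using j(1) by linarith
    then have "j mod 8 = 7" "Suc (j div 8) = n" using assms by simp_all
    then show False using j(2) gright_bounds[of "i mod 8" "j mod 8"] by (auto simp: kind_picture_def ksite_def)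
  qed
  show "Suc i < 8 * m" if i: "i < 8 * m" "sd (kind_picture m n \<kappa> i j)"
  proof (rule ccontr)
    assume "\<not> Suc i < 8 * m"
    then have "i = 8 * (m - 1) + 7" using i(1) by linarith
    then have "i mod 8 = 7" "Suc (i div 8) = m" using assms by simp_all
    then show False using i(2) gdown_bounds[of "i mod 8" "j mod 8"] by (auto simp: kind_picture_def ksite_def)
  qed
qed (use assms in simp_all)

lemma block_index: "p < 8 \<Longrightarrow> (8 * I + p) div 8 = (I :: nat)" "p < 8 \<Longrightarrow> (8 * I + p) mod 8 = p"
  by simp_all

lemma list_colouring_imp_labelling:
  assumes f: "list_colouring (8 * m) (8 * n) (kind_picture m n \<kappa>) f"
  shows "\<exists>h v. tile_labelling m n \<kappa> h v"
proof -
  \<comment> \<open>Behind the last tile of a row there is no left port to read, so the right port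
    of that tile is used, with the opposite color convention. The same holds for \<open>v\<close>
    below the last row.\<close>
  define h where "h = (\<lambda>I J. if J < n then f (8 * I + 3) (8 * J) = 1 else f (8 * I + 3) (8 * J - 1) = 2)"
  define v where "v = (\<lambda>I J. if I < m then f (8 * I) (8 * J + 3) = 1 else f (8 * I - 1) (8 * J + 3) = 2)"
  have local: "f (8 * I + p) (8 * J + q) \<in> {1, 2, 3}"
    "snd (gcl (\<kappa> I J) p q) = 0 \<Longrightarrow> f (8 * I + p) (8 * J + q) = fst (gcl (\<kappa> I J) p q)"
    "snd (gcl (\<kappa> I J) p q) = 2 \<Longrightarrow> f (8 * I + p) (8 * J + q) \<noteq> fst (gcl (\<kappa> I J) p q)"
    "(p, q) \<in> set (gright (\<kappa> I J)) \<or> p = 3 \<and> q = 7 \<and> Suc J \<noteq> n \<Longrightarrow> f (8 * I + p) (8 * J + q) \<noteq> f (8 * I + p) (8 * J + Suc q)"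
    "(p, q) \<in> set (gdown (\<kappa> I J)) \<or> p = 7 \<and> q = 3 \<and> Suc I \<noteq> m \<Longrightarrow> f (8 * I + p) (8 * J + q) \<noteq> f (8 * I + Suc p) (8 * J + q)"
    if I: "I < m" and J: "J < n" and p: "p < 8" and q: "q < 8" for I J p q
  proof -
    have i: "8 * I + p < 8 * m" using I p by linarith
    have j: "8 * J + q < 8 * n" using J q by linarith
    have s: "kind_picture m n \<kappa> (8 * I + p) (8 * J + q) = ksite (\<kappa> I J) (Suc I = m) (Suc J = n) p q"
      unfolding kind_picture_def by (simp only: block_index p q)
    note F = f[unfolded list_colouring_def, rule_format, OF i j, unfolded s ksite_def]
    show "f (8 * I + p) (8 * J + q) \<in> {1, 2, 3}"
      "snd (gcl (\<kappa> I J) p q) = 0 \<Longrightarrow> f (8 * I + p) (8 * J + q) = fst (gcl (\<kappa> I J) p q)"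
      "snd (gcl (\<kappa> I J) p q) = 2 \<Longrightarrow> f (8 * I + p) (8 * J + q) \<noteq> fst (gcl (\<kappa> I J) p q)"
      "(p, q) \<in> set (gright (\<kappa> I J)) \<or> p = 3 \<and> q = 7 \<and> Suc J \<noteq> n \<Longrightarrow> f (8 * I + p) (8 * J + q) \<noteq> f (8 * I + p) (8 * J + Suc q)"
      "(p, q) \<in> set (gdown (\<kappa> I J)) \<or> p = 7 \<and> q = 3 \<and> Suc I \<noteq> m \<Longrightarrow> f (8 * I + p) (8 * J + q) \<noteq> f (8 * I + Suc p) (8 * J + q)"
      using F by simp_all
  qed
  have gc: "gadget_colouring (\<kappa> I J) (\<lambda>p q. f (8 * I + p) (8 * J + q))" if I: "I < m" and J: "J < n" for I J
    unfolding gadget_colouring_def list_all_iff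
  proof (intro conjI ballI, goal_cases)
    case (1 x)
    obtain p q cl where x: "x = ((p, q), cl)" by (metis surj_pair)
    have pq: "p < 8" "q < 8" and g: "gcl (\<kappa> I J) p q = cl"
      using gsites_bounds[of p q cl "\<kappa> I J"] gcl_gsites[of p q cl "\<kappa> I J"] 1 x by auto
    show ?case using local(1-3)[OF I J pq] unfolding g x by (simp add: site_ok_def)
  next
    case (2 x)
    obtain p q where x: "x = (p, q)" by force
    then have pq: "p < 8" "q < 8" using gright_bounds[of p q "\<kappa> I J"] 2 by auto
    show ?case using local(4)[OF I J pq] 2 x by simp
  next
    case (3 x)
    obtain p q where x: "x = (p, q)" by force
    then have pq: "p < 8" "q < 8" using gdown_bounds[of p q "\<kappa> I J"] 3 by auto
    show ?case using local(5)[OF I J pq] 3 x by simp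
  qed
  have port: "g 3 0 = 1 \<or> g 3 0 = 2" "g 0 3 = 1 \<or> g 0 3 = 2" "g 3 7 = 1 \<or> g 3 7 = 2" "g 7 3 = 1 \<or> g 7 3 = 2"
    if "gadget_colouring k g" for k g
  proof -
    have "((3, 0), (3, 2)) \<in> set (gsites k)" "((3, 7), (3, 2)) \<in> set (gsites k)"
      "((0, 3), (3, 2)) \<in> set (gsites k) \<or> ((0, 3), (1, 0)) \<in> set (gsites k)"
      "((7, 3), (3, 2)) \<in> set (gsites k) \<or> ((7, 3), (1, 0)) \<in> set (gsites k)"
      by (cases k; simp add: cross_sites_def)+
    moreover have "site_ok cl (g p q)" if "((p, q), cl) \<in> set (gsites k)" for p q cl
      using \<open>gadget_colouring k g\<close> that by (auto simp: gadget_colouring_def list_all_iff)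
    ultimately show "g 3 0 = 1 \<or> g 3 0 = 2" "g 0 3 = 1 \<or> g 0 3 = 2" "g 3 7 = 1 \<or> g 3 7 = 2" "g 7 3 = 1 \<or> g 7 3 = 2"
      by (metis site_ok_simps(1) site_ok_simps(5))+
  qed
  have "tile_labelling m n \<kappa> h v"
    unfolding tile_labelling_def
  proof (intro allI impI)
    fix I J assume I: "I < m" and J: "J < n"
    let ?g = "\<lambda>p q. f (8 * I + p) (8 * J + q)"
    have hn: "h I (Suc J) = (?g 3 7 = 2)"
    proof (cases "Suc J < n")
      case True
      have "?g 3 7 \<noteq> f (8 * I + 3) (8 * J + Suc 7)" using local(4)[OF I J, of 3 7] True by simp
      moreover have "f (8 * I + 3) (8 * J + Suc 7) = 1 \<or> f (8 * I + 3) (8 * J + Suc 7) = 2"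
        using port(1)[OF gc[OF I True]] by (simp add: add.commute)
      moreover have "h I (Suc J) = (f (8 * I + 3) (8 * J + Suc 7) = 1)" using True by (simp add: h_def add.commute)
      ultimately show ?thesis using port(3)[OF gc[OF I J]] by auto
    next
      case False
      then have "h I (Suc J) = (f (8 * I + 3) (8 * Suc J - 1) = 2)" by (simp add: h_def)
      moreover have "8 * Suc J - 1 = 8 * J + 7" by simp
      ultimately show ?thesis by (simp only:)
    qed
    have vn: "v (Suc I) J = (?g 7 3 = 2)"
    proof (cases "Suc I < m")
      case True
      have "?g 7 3 \<noteq> f (8 * I + Suc 7) (8 * J + 3)" using local(5)[OF I J, of 7 3] True by simp
      moreover have "f (8 * I + Suc 7) (8 * J + 3) = 1 \<or> f (8 * I + Suc 7) (8 * J + 3) = 2"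
        using port(2)[OF gc[OF True J]] by (simp add: add.commute)
      moreover have "v (Suc I) J = (f (8 * I + Suc 7) (8 * J + 3) = 1)" using True by (simp add: v_def add.commute)
      ultimately show ?thesis using port(4)[OF gc[OF I J]] by auto
    next
      case False
      then have "v (Suc I) J = (f (8 * Suc I - 1) (8 * J + 3) = 2)" by (simp add: v_def)
      moreover have "8 * Suc I - 1 = 8 * I + 7" by simp
      ultimately show ?thesis by (simp only:)
    qed
    have "h I J = (?g 3 0 = 1)" "v I J = (?g 0 3 = 1)" using I J by (simp_all add: h_def v_def)
    then show "krel (\<kappa> I J) (h I J) (v I J) (h I (Suc J)) (v (Suc I) J)"
      using gadget_sound[OF gc[OF I J]] hn vn by simp
  qed
  then show ?thesis by blast
qed

lemma labelling_imp_list_colouring: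
  assumes hv: "tile_labelling m n \<kappa> h v"
  shows "\<exists>f. list_colouring (8 * m) (8 * n) (kind_picture m n \<kappa>) f"
proof -
  have "\<exists>g. gadget_colouring (\<kappa> I J) g \<and> port_colouring (h I J) (v I J) (h I (Suc J)) (v (Suc I) J) g"
    if "I < m" "J < n" for I J
    using gadget_complete hv that unfolding tile_labelling_def by blast
  then obtain F where F: "gadget_colouring (\<kappa> I J) (F I J)"
    "port_colouring (h I J) (v I J) (h I (Suc J)) (v (Suc I) J) (F I J)" if "I < m" "J < n" for I J
    by metis
  \<comment> \<open>Outside the gadget the color has to be the default 1 of \<open>gcl\<close>,
    whereas gadget solutions are unconstrained there.\<close>
  define F' where "F' = (\<lambda>I J p q. if map_of (gsites (\<kappa> I J)) (p, q) = None then 1 else F I J p q)"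
  define f where "f = (\<lambda>i j. F' (i div 8) (j div 8) (i mod 8) (j mod 8))"
  have ports: "map_of (gsites k) (3, 0) \<noteq> None" "map_of (gsites k) (0, 3) \<noteq> None"
    "map_of (gsites k) (3, 7) \<noteq> None" "map_of (gsites k) (7, 3) \<noteq> None" for k
    by (cases k; simp add: cross_sites_def)+
  have rsite: "map_of (gsites k) (p, q) \<noteq> None \<and> map_of (gsites k) (p, Suc q) \<noteq> None" if "(p, q) \<in> set (gright k)" for k p q
  proof -
    have "list_all (\<lambda>k. list_all (\<lambda>(p, q). map_of (gsites k) (p, q) \<noteq> None \<and>
        map_of (gsites k) (p, Suc q) \<noteq> None) (gright k)) [KFree, KCross, KNand, KJunc, KOr, KVpass, KCap]"
      by code_simp
    moreover have "k \<in> set [KFree, KCross, KNand, KJunc, KOr, KVpass, KCap]" by (cases k) simp_all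
    ultimately have "list_all (\<lambda>(p, q). map_of (gsites k) (p, q) \<noteq> None \<and> map_of (gsites k) (p, Suc q) \<noteq> None) (gright k)"
      unfolding list_all_iff[of _ "[KFree, KCross, KNand, KJunc, KOr, KVpass, KCap]"] by blast
    then show ?thesis using that by (auto simp: list_all_iff)
  qed
  have dsite: "map_of (gsites k) (p, q) \<noteq> None \<and> map_of (gsites k) (Suc p, q) \<noteq> None" if "(p, q) \<in> set (gdown k)" for k p q
  proof -
    have "list_all (\<lambda>k. list_all (\<lambda>(p, q). map_of (gsites k) (p, q) \<noteq> None \<and>
        map_of (gsites k) (Suc p, q) \<noteq> None) (gdown k)) [KFree, KCross, KNand, KJunc, KOr, KVpass, KCap]"
      by code_simp
    moreover have "k \<in> set [KFree, KCross, KNand, KJunc, KOr, KVpass, KCap]" by (cases k) simp_all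
    ultimately have "list_all (\<lambda>(p, q). map_of (gsites k) (p, q) \<noteq> None \<and> map_of (gsites k) (Suc p, q) \<noteq> None) (gdown k)"
      unfolding list_all_iff[of _ "[KFree, KCross, KNand, KJunc, KOr, KVpass, KCap]"] by blast
    then show ?thesis using that by (auto simp: list_all_iff)
  qed
  have F': "F' I J p q = F I J p q" if "map_of (gsites (\<kappa> I J)) (p, q) \<noteq> None" for I J p q
    unfolding F'_def using that by (rule if_not_P)
  have "list_colouring (8 * m) (8 * n) (kind_picture m n \<kappa>) f"
    unfolding list_colouring_def
  proof (intro allI impI)
    fix i j assume i: "i < 8 * m" and j: "j < 8 * n"
    define I J p q where "I = i div 8" and "J = j div 8" and "p = i mod 8" and "q = j mod 8"
    have I: "I < m" and J: "J < n" using i j by (simp_all add: I_def J_def less_mult_imp_div_less)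
    have pq: "p < 8" "q < 8" by (simp_all add: p_def q_def)
    have ij: "i = 8 * I + p" "j = 8 * J + q" by (simp_all add: I_def J_def p_def q_def)
    have fij: "f i j = F' I J p q" by (simp add: f_def I_def J_def p_def q_def)
    note G = F[OF I J]
    have site: "site_ok (gcl (\<kappa> I J) p q) (f i j)"
    proof (cases "map_of (gsites (\<kappa> I J)) (p, q)")
      case None
      then show ?thesis by (simp add: fij F'_def gcl_def site_ok_def)
    next
      case (Some cl)
      then have "((p, q), cl) \<in> set (gsites (\<kappa> I J))" by (rule map_of_SomeD)
      then have "site_ok cl (F I J p q)" using G(1) by (auto simp: gadget_colouring_def list_all_iff)
      then show ?thesis using Some by (simp add: fij F'_def gcl_def)
    qed
    have S: "kind_picture m n \<kappa> i j = ksite (\<kappa> I J) (Suc I = m) (Suc J = n) p q"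
      by (simp add: kind_picture_def I_def J_def p_def q_def)
    have right: "f i j \<noteq> f i (Suc j)" if "sr (kind_picture m n \<kappa> i j)"
    proof -
      from that consider "(p, q) \<in> set (gright (\<kappa> I J))" | "p = 3" "q = 7" "Suc J \<noteq> n" unfolding S ksite_def by auto
      then show ?thesis
      proof cases
        case 1
        have q7: "Suc q < 8" using gright_bounds[OF 1] by simp
        have sj: "Suc j = 8 * J + Suc q" using ij by simp
        have "f i (Suc j) = F' I J p (Suc q)" unfolding f_def sj block_index[OF q7] by (simp add: I_def p_def)
        moreover have "F I J p q \<noteq> F I J p (q + 1)" using G(1) 1 by (auto simp: gadget_colouring_def list_all_iff)
        ultimately show ?thesis
          unfolding fij F'[OF conjunct1[OF rsite[OF 1]]] using F'[OF conjunct2[OF rsite[OF 1]]] by simp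
      next
        case 2
        have J1: "Suc J < n" using J 2 by simp
        have sj: "Suc j = 8 * Suc J + 0" using ij 2 by simp
        have "f i (Suc j) = F' I (Suc J) p 0" unfolding f_def sj by (simp add: I_def p_def)
        then have "f i (Suc j) = F I (Suc J) 3 0" "f i j = F I J 3 7"
          using 2 F'[OF ports(1)] F'[OF ports(3)] fij by simp_all
        moreover have "F I (Suc J) 3 0 = (if h I (Suc J) then 1 else 2)" "F I J 3 7 = (if h I (Suc J) then 2 else 1)"
          using G(2) F(2)[OF I J1] unfolding port_colouring_def by blast+
        ultimately show ?thesis by simp
      qed
    qed
    have down: "f i j \<noteq> f (Suc i) j" if "sd (kind_picture m n \<kappa> i j)"
    proof -
      from that consider "(p, q) \<in> set (gdown (\<kappa> I J))" | "p = 7" "q = 3" "Suc I \<noteq> m" unfolding S ksite_def by auto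
      then show ?thesis
      proof cases
        case 1
        have p7: "Suc p < 8" using gdown_bounds[OF 1] by simp
        have si: "Suc i = 8 * I + Suc p" using ij by simp
        have "f (Suc i) j = F' I J (Suc p) q" unfolding f_def si block_index[OF p7] by (simp add: J_def q_def)
        moreover have "F I J p q \<noteq> F I J (p + 1) q" using G(1) 1 by (auto simp: gadget_colouring_def list_all_iff)
        ultimately show ?thesis
          unfolding fij F'[OF conjunct1[OF dsite[OF 1]]] using F'[OF conjunct2[OF dsite[OF 1]]] by simp
      next
        case 2
        have I1: "Suc I < m" using I 2 by simp
        have si: "Suc i = 8 * Suc I + 0" using ij 2 by simp
        have "f (Suc i) j = F' (Suc I) J 0 q" unfolding f_def si by (simp add: J_def q_def)
        then have "f (Suc i) j = F (Suc I) J 0 3" "f i j = F I J 7 3"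
          using 2 F'[OF ports(2)] F'[OF ports(4)] fij by simp_all
        moreover have "F (Suc I) J 0 3 = (if v (Suc I) J then 1 else 2)" "F I J 7 3 = (if v (Suc I) J then 2 else 1)"
          using G(2) F(2)[OF I1 J] unfolding port_colouring_def by blast+
        ultimately show ?thesis by simp
      qed
    qed
    show "f i j \<in> {1, 2, 3} \<and>
        (slv (kind_picture m n \<kappa> i j) = 0 \<longrightarrow> f i j = scol (kind_picture m n \<kappa> i j)) \<and>
        (slv (kind_picture m n \<kappa> i j) = 2 \<longrightarrow> f i j \<noteq> scol (kind_picture m n \<kappa> i j)) \<and>
        (sr (kind_picture m n \<kappa> i j) \<longrightarrow> f i j \<noteq> f i (Suc j)) \<and>
        (sd (kind_picture m n \<kappa> i j) \<longrightarrow> f i j \<noteq> f (Suc i) j)"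
      using site right down unfolding site_ok_def by (simp add: S ksite_def)
  qed
  then show ?thesis by blast
qed

theorem list_colouring_iff_labelling:
  "(\<exists>f. list_colouring (8 * m) (8 * n) (kind_picture m n \<kappa>) f) \<longleftrightarrow> (\<exists>h v. tile_labelling m n \<kappa> h v)"
  using list_colouring_imp_labelling labelling_imp_list_colouring by blast

section \<open>From label tilings to boolean tilings\<close>

text \<open>A cell with label set \<open>{..<m}\<close> becomes a block of \<open>3 m + 2\<close> by \<open>2 m + 2\<close> tiles; a wire that carries
  a label \<open>x\<close> consists of \<open>m\<close> boolean wires of which number \<open>x\<close> is true. In the first \<open>m\<close> rows after row 0
  the label of the upper neighbour (vertical wires) meets the label of the cell (horizontal wires),
  in the next group of rows the label of the left neighbour (horizontal) meets the label of the cell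
  (vertical). The last column collects the disjunction of the admissible labels.\<close>

definition cell_kind :: "nat \<Rightarrow> (nat \<Rightarrow> nat \<Rightarrow> bool) \<Rightarrow> (nat \<Rightarrow> nat \<Rightarrow> bool) \<Rightarrow> nat set \<Rightarrow> nat \<Rightarrow> nat \<Rightarrow> kind" where
  "cell_kind m H V L a b =
     (if a = 0 then (if b < m then KCross else if b = 2 * m + 1 then KCap else KFree)
      else if a \<le> m then
        (if b < m then (if V b (a - 1) then KCross else KNand)
         else if b = m then KCross
         else if b \<le> 2 * m then (if b = m + a then KJunc else KCross)
         else if a - 1 \<in> L then KOr else KVpass)
      else if a = m + 1 then (if b \<le> m then KFree else if b \<le> 2 * m then KCross else KCap)
      else if a \<le> 2 * m + 1 then
        (if b < m then (if H (a - (m + 2)) b then KCross else KNand)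
         else if b = m then KFree
         else if b \<le> 2 * m then (if b + 1 = a then KJunc else KCross)
         else KCross)
      else
        (if b < m then (if 2 * m + 2 + b = a then KJunc else KCross)
         else if b = m then KCross
         else if b \<le> 2 * m then (if m + 1 + b = a then KJunc else KCross)
         else KFree))"

lemma const_between:
  fixes f :: "nat \<Rightarrow> bool"
  assumes "\<And>b. lo \<le> b \<Longrightarrow> b < hi \<Longrightarrow> f (Suc b) = f b" "lo \<le> b" "b \<le> hi"
  shows "f b = f lo"
  using assms(2,3)
proof (induction b rule: dec_induct)
  case (step n)
  then show ?case using assms(1)[of n] by simp
qed simp

text \<open>\<open>X x\<close> is guessed on row \<open>x + 1\<close>, whose left end is free since
  the last tile column of a block ignores its right side there. A junction copies it to column
  \<open>m + 1 + x\<close>, another one from there to the right output in row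
  \<open>m + 2 + x\<close>, and two more via row \<open>2 * m + 2 + x\<close> to the bottom output
  in column \<open>x\<close>. Free tiles cut off the upper neighbour's label in row
  \<open>m + 1\<close> and the left neighbour's label in column \<open>m\<close>, so that these
  wires can be reused. Where two labels cross, \<open>KNand\<close> excludes the forbidden
  pairs.\<close>

lemma cell_sound:
  fixes h v :: "nat \<Rightarrow> nat \<Rightarrow> bool"
  assumes K: "\<And>a b. a < 3 * m + 2 \<Longrightarrow> b < 2 * m + 2 \<Longrightarrow>
      krel (cell_kind m H V L a b) (h a b) (v a b) (h a (Suc b)) (v (Suc a) b)"
  defines "X \<equiv> \<lambda>x. h (x + 1) 0"
  shows "\<exists>x<m. x \<in> L \<and> X x"
    and "x < m \<Longrightarrow> h (m + 2 + x) (2 * m + 2) = X x"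
    and "x < m \<Longrightarrow> v (3 * m + 2) x = X x"
    and "x < m \<Longrightarrow> y < m \<Longrightarrow> h (m + 2 + y) 0 \<Longrightarrow> X x \<Longrightarrow> H y x"
    and "x < m \<Longrightarrow> y < m \<Longrightarrow> v 0 y \<Longrightarrow> X x \<Longrightarrow> V y x"
proof -
  have C: "h (x + 1) b = X x" if "x < m" "b \<le> 2 * m + 1" for x b
    unfolding X_def
  proof (rule const_between[where hi = "2 * m + 1"])
    fix b assume "b < 2 * m + 1"
    then show "h (x + 1) (Suc b) = h (x + 1) b"
      using K[of "x + 1" b] that(1) by (auto simp: cell_kind_def split: if_splits)
  qed (use that in simp_all)
  have A': "v a (m + 1 + x) = X x" if x: "x < m" and a: "1 \<le> a" "a \<le> 3 * m + 2" for x a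
  proof -
    have c: "v a (m + 1 + x) = v 1 (m + 1 + x)" if "1 \<le> a" "a \<le> 3 * m + 2" for a
    proof (rule const_between[where hi = "3 * m + 2"])
      fix a assume "1 \<le> a" "a < 3 * m + 2"
      then show "v (Suc a) (m + 1 + x) = v a (m + 1 + x)"
        using K[of a "m + 1 + x"] x by (auto simp: cell_kind_def split: if_splits)
    qed (use that in simp_all)
    have k: "cell_kind m H V L (x + 1) (m + 1 + x) = KJunc" using x by (simp add: cell_kind_def)
    have "x + 1 < 3 * m + 2" "m + 1 + x < 2 * m + 2" using x by simp_all
    from K[OF this, unfolded k krel.simps] have "h (x + 1) (m + 1 + x) = v (x + 1) (m + 1 + x)" by blast
    then show ?thesis using c[OF a] c[of "x + 1"] C[OF x, of "m + 1 + x"] x by simp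
  qed
  have Aright: "h (m + 2 + x) b = X x" if x: "x < m" and b: "m + 1 \<le> b" "b \<le> 2 * m + 2" for x b
  proof -
    have c: "h (m + 2 + x) b = h (m + 2 + x) (m + 1)" if "m + 1 \<le> b" "b \<le> 2 * m + 2" for b
    proof (rule const_between[where hi = "2 * m + 2"])
      fix b assume "m + 1 \<le> b" "b < 2 * m + 2"
      then show "h (m + 2 + x) (Suc b) = h (m + 2 + x) b"
        using K[of "m + 2 + x" b] x by (auto simp: cell_kind_def split: if_splits)
    qed (use that in simp_all)
    have k: "cell_kind m H V L (m + 2 + x) (m + 1 + x) = KJunc" using x by (simp add: cell_kind_def)
    have "m + 2 + x < 3 * m + 2" "m + 1 + x < 2 * m + 2" using x by simp_all
    from K[OF this, unfolded k krel.simps] have "h (m + 2 + x) (m + 1 + x) = v (m + 2 + x) (m + 1 + x)" by blast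
    then show ?thesis using c[OF b] c[of "m + 1 + x"] A'[OF x, of "m + 2 + x"] x by simp
  qed
  show "x < m \<Longrightarrow> h (m + 2 + x) (2 * m + 2) = X x" using Aright by simp
  have Bh: "h (2 * m + 2 + x) b = X x" if x: "x < m" and b: "b \<le> 2 * m + 1" for x b
  proof -
    have c: "h (2 * m + 2 + x) b = h (2 * m + 2 + x) 0" if "b \<le> 2 * m + 1" for b
    proof (rule const_between[where hi = "2 * m + 1"])
      fix b assume "b < 2 * m + 1"
      then show "h (2 * m + 2 + x) (Suc b) = h (2 * m + 2 + x) b"
        using K[of "2 * m + 2 + x" b] x by (auto simp: cell_kind_def split: if_splits)
    qed (use that in simp_all)
    have k: "cell_kind m H V L (2 * m + 2 + x) (m + 1 + x) = KJunc" using x by (simp add: cell_kind_def)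
    have "2 * m + 2 + x < 3 * m + 2" "m + 1 + x < 2 * m + 2" using x by simp_all
    from K[OF this, unfolded k krel.simps] have "h (2 * m + 2 + x) (m + 1 + x) = v (2 * m + 2 + x) (m + 1 + x)" by blast
    then show ?thesis using c[OF b] c[of "m + 1 + x"] A'[OF x, of "2 * m + 2 + x"] x by simp
  qed
  have low: "v a x = X x" if x: "x < m" and a: "m + 2 \<le> a" "a \<le> 3 * m + 2" for x a
  proof -
    have c: "v a x = v (m + 2) x" if "m + 2 \<le> a" "a \<le> 3 * m + 2" for a
    proof (rule const_between[where hi = "3 * m + 2"])
      fix a assume "m + 2 \<le> a" "a < 3 * m + 2"
      then show "v (Suc a) x = v a x"
        using K[of a x] x by (auto simp: cell_kind_def split: if_splits)
    qed (use that in simp_all)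
    have k: "cell_kind m H V L (2 * m + 2 + x) x = KJunc" using x by (simp add: cell_kind_def)
    have "2 * m + 2 + x < 3 * m + 2" "x < 2 * m + 2" using x by simp_all
    from K[OF this, unfolded k krel.simps] have "h (2 * m + 2 + x) x = v (2 * m + 2 + x) x" by blast
    then show ?thesis using c[OF a] c[of "2 * m + 2 + x"] Bh[OF x, of x] x by simp
  qed
  show "x < m \<Longrightarrow> v (3 * m + 2) x = X x" using low by simp
  have Aleft: "h (m + 2 + y) b = h (m + 2 + y) 0" if y: "y < m" and b: "b \<le> m" for y b
  proof (rule const_between[where hi = m])
    fix b assume "b < m"
    then show "h (m + 2 + y) (Suc b) = h (m + 2 + y) b"
      using K[of "m + 2 + y" b] y by (auto simp: cell_kind_def split: if_splits)
  qed (use b in simp_all)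
  show "H y x" if x: "x < m" and y: "y < m" and hx: "h (m + 2 + y) 0" "X x"
  proof (rule ccontr)
    assume "\<not> H y x"
    then have k: "cell_kind m H V L (m + 2 + y) x = KNand" using x y by (simp add: cell_kind_def)
    have "m + 2 + y < 3 * m + 2" "x < 2 * m + 2" using x y by simp_all
    from K[OF this, unfolded k krel.simps] have "\<not> (h (m + 2 + y) x \<and> v (m + 2 + y) x)" by blast
    then show False using Aleft[OF y, of x] low[OF x, of "m + 2 + y"] hx x y by simp
  qed
  have up: "v a y = v 0 y" if y: "y < m" and a: "a \<le> m + 1" for y a
  proof (rule const_between[where hi = "m + 1"])
    fix a assume "a < m + 1"
    then show "v (Suc a) y = v a y"
      using K[of a y] y by (auto simp: cell_kind_def split: if_splits)
  qed (use a in simp_all)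
  show "V y x" if x: "x < m" and y: "y < m" and vx: "v 0 y" "X x"
  proof (rule ccontr)
    assume "\<not> V y x"
    then have k: "cell_kind m H V L (x + 1) y = KNand" using x y by (simp add: cell_kind_def)
    have "x + 1 < 3 * m + 2" "y < 2 * m + 2" using x y by simp_all
    from K[OF this, unfolded k krel.simps] have "\<not> (h (x + 1) y \<and> v (x + 1) y)" by blast
    then show False using C[OF x, of y] up[OF y, of "x + 1"] vx x y by simp
  qed
  show "\<exists>x<m. x \<in> L \<and> X x"
  proof (rule ccontr)
    \<comment> \<open>Without a true admissible label, false runs down from the upper cap to the
      lower cap, which demands true.\<close>
    assume no: "\<not> (\<exists>x<m. x \<in> L \<and> X x)"
    have "\<not> v (a + 1) (2 * m + 1)" if "a \<le> m" for a
      using that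
    proof (induction a)
      case 0
      have "cell_kind m H V L 0 (2 * m + 1) = KCap" by (simp add: cell_kind_def)
      then show ?case using K[of 0 "2 * m + 1"] by simp
    next
      case (Suc a)
      show ?case
      proof (cases "a \<in> L")
        case True
        then have "cell_kind m H V L (a + 1) (2 * m + 1) = KOr" using Suc.prems by (simp add: cell_kind_def)
        moreover have "\<not> X a" using no True Suc.prems by simp
        ultimately show ?thesis using K[of "a + 1" "2 * m + 1"] Suc C[of a "2 * m + 1"] by simp
      next
        case False
        then have "cell_kind m H V L (a + 1) (2 * m + 1) = KVpass" using Suc.prems by (simp add: cell_kind_def)
        then show ?thesis using K[of "a + 1" "2 * m + 1"] Suc by simp
      qed
    qed
    from this[of m] have "\<not> v (m + 1) (2 * m + 1)" by simp
    moreover have "cell_kind m H V L (m + 1) (2 * m + 1) = KCap" by (simp add: cell_kind_def)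
    ultimately show False using K[of "m + 1" "2 * m + 1"] by simp
  qed
qed

section \<open>Filling a block from a label that fits its neighbours\<close>

definition cell_h :: "nat \<Rightarrow> (nat \<Rightarrow> bool) \<Rightarrow> (nat \<Rightarrow> bool) \<Rightarrow> nat \<Rightarrow> nat \<Rightarrow> bool" where
  "cell_h m left x a b =
     (if 1 \<le> a \<and> a \<le> m then x (a - 1)
      else if m + 2 \<le> a \<and> a \<le> 2 * m + 1 then (if b \<le> m then left (a - (m + 2)) else x (a - (m + 2)))
      else if 2 * m + 2 \<le> a then x (a - (2 * m + 2)) else False)"

text \<open>In the last column, true above row 0 serves the upper cap. Further down stands the
  disjunction of all labels met so far; it agrees with that of the admissible ones when only the
  chosen label is true.\<close>

definition cell_v :: "nat \<Rightarrow> (nat \<Rightarrow> bool) \<Rightarrow> (nat \<Rightarrow> bool) \<Rightarrow> nat \<Rightarrow> nat \<Rightarrow> bool" where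
  "cell_v m up x a b =
     (if b < m then (if a \<le> m + 1 then up b else x b)
      else if b = m then False
      else if b \<le> 2 * m then (if a = 0 then up (b - (m + 1)) else x (b - (m + 1)))
      else a = 0 \<or> (a \<le> m + 1 \<and> (\<exists>y<a - 1. x y)))"

text \<open>At the right and lower border the wires are those of the next block, which receives
  \<open>X\<close> as its left or upper label, whatever its own label \<open>X'\<close> or
  \<open>X''\<close> is; this is how the blocks fit together.\<close>

lemma cell_complete:
  assumes x: "s < m" "s \<in> L" and H: "\<And>y. y < m \<Longrightarrow> left y \<Longrightarrow> H y s" and V: "\<And>y. y < m \<Longrightarrow> up y \<Longrightarrow> V y s"
    and ab: "a < 3 * m + 2" "b < 2 * m + 2"
  defines "X \<equiv> \<lambda>y. y = s"
  shows "krel (cell_kind m H V L a b) (cell_h m left X a b) (cell_v m up X a b)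
    (if Suc b < 2 * m + 2 then cell_h m left X a (Suc b) else cell_h m X X' a 0)
    (if Suc a < 3 * m + 2 then cell_v m up X (Suc a) b else cell_v m X X'' 0 b)"
proof -
  have m: "0 < m" using x by simp
  consider (0) "a = 0" | (C) y where "y < m" "a = y + 1" | (S) "a = m + 1"
    | (A) y where "y < m" "a = m + 2 + y" | (B) y where "y < m" "a = 2 * m + 2 + y"
  proof -
    have "a = 0 \<or> (\<exists>y<m. a = y + 1) \<or> a = m + 1 \<or> (\<exists>y<m. a = m + 2 + y) \<or> (\<exists>y<m. a = 2 * m + 2 + y)"
    proof -
      consider "a = 0" | "1 \<le> a" "a \<le> m" | "a = m + 1" | "m + 2 \<le> a" "a < 2 * m + 2" | "2 * m + 2 \<le> a" by linarith
      then show ?thesis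
      proof cases
        case 2
        then have "a - 1 < m \<and> a = a - 1 + 1" by linarith
        then show ?thesis by blast
      next
        case 4
        then have "a - (m + 2) < m \<and> a = m + 2 + (a - (m + 2))" by linarith
        then show ?thesis by blast
      next
        case 5
        then have "a - (2 * m + 2) < m \<and> a = 2 * m + 2 + (a - (2 * m + 2))" using ab by linarith
        then show ?thesis by blast
      qed simp_all
    qed
    then show thesis using 0 C S A B by blast
  qed
  note rows = this
  consider (a) "b < m" | (s) "b = m" | (a') z where "z < m" "b = m + 1 + z" | (t) "b = 2 * m + 1"
  proof -
    have "b < m \<or> b = m \<or> (\<exists>z<m. b = m + 1 + z) \<or> b = 2 * m + 1"
    proof -
      consider "b < m" | "b = m" | "m + 1 \<le> b" "b \<le> 2 * m" | "b = 2 * m + 1" using ab by linarith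
      then show ?thesis
      proof cases
        case 3
        then have "b - (m + 1) < m \<and> b = m + 1 + (b - (m + 1))" by linarith
        then show ?thesis by blast
      qed simp_all
    qed
    then show thesis using a s a' t by blast
  qed
  note cols = this
  note defs = cell_kind_def cell_h_def cell_v_def X_def
  show ?thesis
  proof (cases rule: rows)
    case 0
    show ?thesis
    proof (cases rule: cols)
      case t
      then show ?thesis using 0 m by (simp add: defs)
    qed (use 0 m in \<open>simp_all add: defs\<close>)
  next
    case (C y)
    show ?thesis
    proof (cases rule: cols)
      case a
      then show ?thesis using C V m by (auto simp: defs)
    next
      case s
      then show ?thesis using C m by (auto simp: defs)
    next
      case (a' z)
      then show ?thesis using C m by (auto simp: defs)
    next
      case t
      have 1: "(\<exists>z<Suc y. z = s) \<longleftrightarrow> (\<exists>z<y. z = s) \<or> y = s" by (auto simp: less_Suc_eq)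
      show ?thesis using t C m x 1 by (auto simp: defs)
    qed
  next
    case S
    show ?thesis
    proof (cases rule: cols)
      case t
      then show ?thesis using S m x by (auto simp: defs)
    qed (use S m in \<open>auto simp: defs\<close>)
  next
    case (A y)
    show ?thesis
    proof (cases rule: cols)
      case a
      then show ?thesis using A H m by (auto simp: defs)
    next
      case s
      then show ?thesis using A m by (auto simp: defs)
    next
      case (a' z)
      then show ?thesis using A m by (auto simp: defs)
    next
      case t
      then show ?thesis using A m by (auto simp: defs)
    qed
  next
    case (B y)
    show ?thesis
    proof (cases rule: cols)
      case a
      then show ?thesis using B m by (auto simp: defs)
    next
      case s
      then show ?thesis using B m by (auto simp: defs)
    next
      case (a' z)
      then show ?thesis using B m by (auto simp: defs)
    next
      case t
      then show ?thesis using B m by (auto simp: defs)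
    qed
  qed
qed

definition label_tiling :: "nat \<Rightarrow> (nat \<Rightarrow> nat \<Rightarrow> bool) \<Rightarrow> (nat \<Rightarrow> nat \<Rightarrow> bool) \<Rightarrow> nat \<Rightarrow> nat \<Rightarrow>
    (nat \<Rightarrow> nat \<Rightarrow> nat set) \<Rightarrow> (nat \<Rightarrow> nat \<Rightarrow> nat) \<Rightarrow> bool" where
  "label_tiling m H V R W L s \<longleftrightarrow>
     (\<forall>i<R. \<forall>j<W. s i j < m \<and> s i j \<in> L i j \<and> (Suc j < W \<longrightarrow> H (s i j) (s i (Suc j))) \<and>
        (Suc i < R \<longrightarrow> V (s i j) (s (Suc i) j)))"

definition tile_kind :: "nat \<Rightarrow> (nat \<Rightarrow> nat \<Rightarrow> bool) \<Rightarrow> (nat \<Rightarrow> nat \<Rightarrow> bool) \<Rightarrow> (nat \<Rightarrow> nat \<Rightarrow> nat set) \<Rightarrow> nat \<Rightarrow> nat \<Rightarrow> kind" where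
  "tile_kind m H V L I J = cell_kind m H V (L (I div (3 * m + 2)) (J div (2 * m + 2)))
     (I mod (3 * m + 2)) (J mod (2 * m + 2))"

lemma block_div_mod: "a < P \<Longrightarrow> (i * P + a) div P = (i :: nat)" "a < P \<Longrightarrow> (i * P + a) mod P = a"
  by simp_all

lemma labelling_imp_tiling:
  assumes "tile_labelling (R * (3 * m + 2)) (W * (2 * m + 2)) (tile_kind m H V L) h v"
  shows "\<exists>s. label_tiling m H V R W L s"
proof -
  let ?P = "3 * m + 2" and ?Q = "2 * m + 2"
  have K: "krel (cell_kind m H V (L i j) a b) (h (i * ?P + a) (j * ?Q + b)) (v (i * ?P + a) (j * ?Q + b))
     (h (i * ?P + a) (j * ?Q + Suc b)) (v (i * ?P + Suc a) (j * ?Q + b))"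
    if "i < R" "j < W" "a < ?P" "b < ?Q" for i j a b
  proof -
    have "i * ?P + a < Suc i * ?P" using that by simp
    also have "\<dots> \<le> R * ?P" using that by (intro mult_le_mono1) simp
    finally have 1: "i * ?P + a < R * ?P" .
    have "j * ?Q + b < Suc j * ?Q" using that by simp
    also have "\<dots> \<le> W * ?Q" using that by (intro mult_le_mono1) simp
    finally have 2: "j * ?Q + b < W * ?Q" .
    have "tile_kind m H V L (i * ?P + a) (j * ?Q + b) = cell_kind m H V (L i j) a b"
      unfolding tile_kind_def block_div_mod[OF that(3)] block_div_mod[OF that(4)] ..
    then show ?thesis using assms[unfolded tile_labelling_def, rule_format, OF 1 2] by simp
  qed
  define X where "X = (\<lambda>i j x. h (i * ?P + (x + 1)) (j * ?Q + 0))"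
  have ex: "\<exists>x<m. x \<in> L i j \<and> X i j x"
    and C: "\<And>x. x < m \<Longrightarrow> h (i * ?P + (m + 2 + x)) (j * ?Q + (2 * m + 2)) = X i j x"
      "\<And>x. x < m \<Longrightarrow> v (i * ?P + (3 * m + 2)) (j * ?Q + x) = X i j x"
      "\<And>x y. x < m \<Longrightarrow> y < m \<Longrightarrow> h (i * ?P + (m + 2 + y)) (j * ?Q + 0) \<Longrightarrow> X i j x \<Longrightarrow> H y x"
      "\<And>x y. x < m \<Longrightarrow> y < m \<Longrightarrow> v (i * ?P + 0) (j * ?Q + y) \<Longrightarrow> X i j x \<Longrightarrow> V y x"
    if "i < R" "j < W" for i j
    using cell_sound[of m H V "L i j" "\<lambda>a b. h (i * ?P + a) (j * ?Q + b)" "\<lambda>a b. v (i * ?P + a) (j * ?Q + b)",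
      OF K[OF that]] unfolding X_def by blast+
  \<comment> \<open>The wires need not select a unique label. All true wires of neighbouring blocks
    are compatible, so an arbitrary true admissible label works.\<close>
  define s where "s = (\<lambda>i j. SOME x. x < m \<and> x \<in> L i j \<and> X i j x)"
  have s: "s i j < m" "s i j \<in> L i j" "X i j (s i j)" if "i < R" "j < W" for i j
    using someI_ex[OF ex[OF that]] unfolding s_def by blast+
  have "label_tiling m H V R W L s"
    unfolding label_tiling_def
  proof (intro allI impI conjI)
    fix i j assume i: "i < R" and j: "j < W"
    show "s i j < m" "s i j \<in> L i j" using s[OF i j] by auto
    show "H (s i j) (s i (Suc j))" if sj: "Suc j < W"
    proof (rule C(3)[OF i sj s(1)[OF i sj] s(1)[OF i j]])
      have "h (i * ?P + (m + 2 + s i j)) (j * ?Q + (2 * m + 2)) = X i j (s i j)"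
        by (rule C(1)[OF i j s(1)[OF i j]])
      moreover have "j * ?Q + (2 * m + 2) = Suc j * ?Q + 0" by simp
      ultimately show "h (i * ?P + (m + 2 + s i j)) (Suc j * ?Q + 0)" using s(3)[OF i j] by metis
    qed (rule s(3)[OF i sj])
    show "V (s i j) (s (Suc i) j)" if si: "Suc i < R"
    proof (rule C(4)[OF si j s(1)[OF si j] s(1)[OF i j]])
      have "v (i * ?P + (3 * m + 2)) (j * ?Q + s i j) = X i j (s i j)"
        by (rule C(2)[OF i j s(1)[OF i j]])
      moreover have "i * ?P + (3 * m + 2) = Suc i * ?P + 0" by simp
      ultimately show "v (Suc i * ?P + 0) (j * ?Q + s i j)" using s(3)[OF i j] by metis
    qed (rule s(3)[OF si j])
  qed
  then show ?thesis by blast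
qed

lemma tiling_imp_labelling:
  assumes s: "label_tiling m H V R W L s"
  shows "\<exists>h v. tile_labelling (R * (3 * m + 2)) (W * (2 * m + 2)) (tile_kind m H V L) h v"
proof -
  let ?P = "3 * m + 2" and ?Q = "2 * m + 2"
  define left where "left = (\<lambda>i j y. 0 < j \<and> y = s i (j - 1))"
  define up where "up = (\<lambda>i j y. 0 < i \<and> y = s (i - 1) j)"
  define X where "X = (\<lambda>i j y. y = s i j)"
  define h where "h = (\<lambda>I J. cell_h m (left (I div ?P) (J div ?Q)) (X (I div ?P) (J div ?Q)) (I mod ?P) (J mod ?Q))"
  define v where "v = (\<lambda>I J. cell_v m (up (I div ?P) (J div ?Q)) (X (I div ?P) (J div ?Q)) (I mod ?P) (J mod ?Q))"
  have hh: "h (i * ?P + a) (j * ?Q + b) = cell_h m (left i j) (X i j) a b" if "a < ?P" "b < ?Q" for i j a b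
    unfolding h_def block_div_mod[OF that(1)] block_div_mod[OF that(2)] ..
  have vv: "v (i * ?P + a) (j * ?Q + b) = cell_v m (up i j) (X i j) a b" if "a < ?P" "b < ?Q" for i j a b
    unfolding v_def block_div_mod[OF that(1)] block_div_mod[OF that(2)] ..
  have "tile_labelling (R * ?P) (W * ?Q) (tile_kind m H V L) h v"
    unfolding tile_labelling_def
  proof (intro allI impI)
    fix I J assume I: "I < R * ?P" and J: "J < W * ?Q"
    define i j a b where "i = I div ?P" and "j = J div ?Q" and "a = I mod ?P" and "b = J mod ?Q"
    have i: "i < R" and j: "j < W" using I J by (simp_all only: i_def j_def less_mult_imp_div_less)
    have a: "a < ?P" and b: "b < ?Q" by (simp_all add: a_def b_def)
    have IJ: "I = i * ?P + a" "J = j * ?Q + b" by (simp_all only: i_def j_def a_def b_def div_mult_mod_eq)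
    have t: "s i j < m" "s i j \<in> L i j" using s i j unfolding label_tiling_def by auto
    have Hs: "H y (s i j)" if "left i j y" for y
    proof -
      have j0: "0 < j" and y: "y = s i (j - 1)" using that by (simp_all add: left_def)
      have "j - 1 < W" using j by simp
      then have "Suc (j - 1) < W \<longrightarrow> H (s i (j - 1)) (s i (Suc (j - 1)))" using s i unfolding label_tiling_def by blast
      then show ?thesis using j0 j y by simp
    qed
    have Vs: "V y (s i j)" if "up i j y" for y
    proof -
      have i0: "0 < i" and y: "y = s (i - 1) j" using that by (simp_all add: up_def)
      have "i - 1 < R" using i by simp
      then have "Suc (i - 1) < R \<longrightarrow> V (s (i - 1) j) (s (Suc (i - 1)) j)" using s j unfolding label_tiling_def by blast
      then show ?thesis using i0 i y by simp
    qed
    have hr: "h I (Suc J) = (if Suc b < ?Q then cell_h m (left i j) (X i j) a (Suc b)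
        else cell_h m (X i j) (X i (Suc j)) a 0)"
    proof (cases "Suc b < ?Q")
      case True
      then show ?thesis using hh[OF a True, of i j] IJ by simp
    next
      case False
      then have "b = 2 * m + 1" using b by simp
      then have sJ: "Suc J = Suc j * ?Q + 0" using IJ by simp
      have "left i (Suc j) = X i j" by (simp add: left_def X_def)
      then show ?thesis using hh[OF a, of 0 i "Suc j"] False unfolding sJ IJ(1) by simp
    qed
    have vb: "v (Suc I) J = (if Suc a < ?P then cell_v m (up i j) (X i j) (Suc a) b
        else cell_v m (X i j) (X (Suc i) j) 0 b)"
    proof (cases "Suc a < ?P")
      case True
      then show ?thesis using vv[OF True b, of i j] IJ by simp
    next
      case False
      then have "a = 3 * m + 1" using a by simp
      then have sI: "Suc I = Suc i * ?P + 0" using IJ by simp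
      have "up (Suc i) j = X i j" by (simp add: up_def X_def)
      then show ?thesis using vv[OF _ b, of 0 "Suc i" j] False unfolding sI IJ(2) by simp
    qed
    have hl: "h I J = cell_h m (left i j) (X i j) a b" "v I J = cell_v m (up i j) (X i j) a b"
      unfolding IJ using hh[OF a b] vv[OF a b] by simp_all
    have k: "tile_kind m H V L I J = cell_kind m H V (L i j) a b"
      by (simp only: tile_kind_def i_def j_def a_def b_def)
    show "krel (tile_kind m H V L I J) (h I J) (v I J) (h I (Suc J)) (v (Suc I) J)"
      unfolding k hl hr vb
      using cell_complete[OF t, of "left i j" H "up i j" V a b "X i (Suc j)" "X (Suc i) j"] Hs Vs a b
      unfolding X_def by blast
  qed
  then show ?thesis by blast
qed

theorem labelling_iff_tiling:
  "(\<exists>h v. tile_labelling (R * (3 * m + 2)) (W * (2 * m + 2)) (tile_kind m H V L) h v) \<longleftrightarrow>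
   (\<exists>s. label_tiling m H V R W L s)"
  using labelling_imp_tiling tiling_imp_labelling by blast

section \<open>The tableau of a verifier\<close>

lemma valid_tm_delta:
  assumes "valid_tm M" "q < tm_states M" "length ss = tm_tapes M" "set ss \<subseteq> {..<tm_symbols M}"
    "tm_delta M q ss = (q', as)"
  shows "q' < tm_states M" "length as = tm_tapes M"
    "\<And>j. j < tm_tapes M \<Longrightarrow> fst (as ! j) < tm_symbols M \<and> snd (as ! j) \<in> {-1, 0, 1}"
proof -
  have *: "q' < tm_states M \<and> length as = tm_tapes M \<and> (\<forall>(a, d)\<in>set as. a < tm_symbols M \<and> d \<in> {-1, 0, 1})"
    using assms unfolding valid_tm_def by fastforce
  then show "q' < tm_states M" "length as = tm_tapes M" by auto
  fix j assume "j < tm_tapes M"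
  then have "as ! j \<in> set as" using * by simp
  moreover have "\<forall>(a, d)\<in>set as. a < tm_symbols M \<and> d \<in> {-1, 0, 1}" using * by (elim conjE)
  ultimately have "case as ! j of (a, d) \<Rightarrow> a < tm_symbols M \<and> d \<in> {-1, 0, 1}" by (rule bspec[rotated])
  then show "fst (as ! j) < tm_symbols M \<and> snd (as ! j) \<in> {-1, 0, 1}" by (simp add: case_prod_beta)
qed

text \<open>The halting state acts as a step that changes nothing, so a tableau with a fixed number
  of rows covers runs of every shorter length.\<close>

definition next_act :: "tm \<Rightarrow> nat \<Rightarrow> nat list \<Rightarrow> nat \<times> (nat \<times> int) list" where
  "next_act M q ss = (if q = 1 then (1, map (\<lambda>a. (a, 0)) ss) else tm_delta M q ss)"

definition wf_config :: "tm \<Rightarrow> tm_config \<Rightarrow> bool" where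
  "wf_config M c \<longleftrightarrow> fst c < tm_states M \<and> length (snd c) = tm_tapes M \<and>
     (\<forall>j<tm_tapes M. \<forall>z. fst (snd c ! j) z < tm_symbols M)"

definition reads :: "tm_config \<Rightarrow> nat list" where
  "reads c = map tape_read (snd c)"

lemma tape_read_fst_snd: "tape_read t = fst t (snd t)"
  by (cases t) simp

lemma tape_act_fst_snd: "fst (tape_act t a) = (fst t)(snd t := fst a)" "snd (tape_act t a) = snd t + snd a"
  by (cases t; cases a; simp)+

lemma reads_wf:
  assumes "wf_config M c"
  shows "length (reads c) = tm_tapes M" "set (reads c) \<subseteq> {..<tm_symbols M}"
    "\<And>j. j < tm_tapes M \<Longrightarrow> reads c ! j = fst (snd c ! j) (snd (snd c ! j))"
proof -
  have l: "length (snd c) = tm_tapes M" and g: "\<And>j z. j < tm_tapes M \<Longrightarrow> fst (snd c ! j) z < tm_symbols M"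
    using assms unfolding wf_config_def by auto
  show len: "length (reads c) = tm_tapes M" using l by (simp add: reads_def)
  show nth: "reads c ! j = fst (snd c ! j) (snd (snd c ! j))" if "j < tm_tapes M" for j
    using that l by (simp add: reads_def tape_read_fst_snd)
  show "set (reads c) \<subseteq> {..<tm_symbols M}"
  proof
    fix a assume "a \<in> set (reads c)"
    then obtain j where "j < tm_tapes M" "a = reads c ! j" using len by (metis in_set_conv_nth)
    then show "a \<in> {..<tm_symbols M}" using nth g by simp
  qed
qed

lemma tm_step_next:
  assumes M: "valid_tm M" and c: "wf_config M c" and nx: "next_act M (fst c) (reads c) = (q', as)"
  shows "fst (tm_step M c) = q'" "length (snd (tm_step M c)) = tm_tapes M"
    "\<And>j z. j < tm_tapes M \<Longrightarrow> fst (snd (tm_step M c) ! j) z =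
      (if z = snd (snd c ! j) then fst (as ! j) else fst (snd c ! j) z)"
    "\<And>j. j < tm_tapes M \<Longrightarrow> snd (snd (tm_step M c) ! j) = snd (snd c ! j) + snd (as ! j)"
    "wf_config M (tm_step M c)" "\<And>j. j < tm_tapes M \<Longrightarrow> snd (as ! j) \<in> {-1, 0, 1}"
proof -
  note r = reads_wf[OF c]
  have q: "fst c < tm_states M" and l: "length (snd c) = tm_tapes M"
    and g: "\<And>j z. j < tm_tapes M \<Longrightarrow> fst (snd c ! j) z < tm_symbols M" using c unfolding wf_config_def by auto
  have as: "q' < tm_states M \<and> length as = tm_tapes M \<and>
     (\<forall>j<tm_tapes M. fst (as ! j) < tm_symbols M \<and> snd (as ! j) \<in> {-1, 0, 1})"
  proof (cases "fst c = 1")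
    case True
    then have e: "q' = 1" "as = map (\<lambda>a. (a, 0)) (reads c)" using nx by (auto simp: next_act_def)
    show ?thesis unfolding e using q True r g by simp
  next
    case False
    then have "tm_delta M (fst c) (reads c) = (q', as)" using nx by (simp add: next_act_def)
    from valid_tm_delta[OF M q r(1,2) this] show ?thesis by blast
  qed
  have st: "fst (tm_step M c) = q' \<and> length (snd (tm_step M c)) = tm_tapes M \<and>
    (\<forall>j<tm_tapes M. (\<forall>z. fst (snd (tm_step M c) ! j) z = (if z = snd (snd c ! j) then fst (as ! j) else fst (snd c ! j) z)) \<and>
       snd (snd (tm_step M c) ! j) = snd (snd c ! j) + snd (as ! j))"
  proof (cases "fst c = 1")
    case True
    then have e: "q' = 1" "as = map (\<lambda>a. (a, 0)) (reads c)" using nx by (auto simp: next_act_def)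
    have "tm_step M c = c" using True by (cases c) simp
    then show ?thesis using e True l r by simp
  next
    case False
    then have d: "tm_delta M (fst c) (reads c) = (q', as)" using nx by (simp add: next_act_def)
    have "tm_step M c = (q', map2 tape_act (snd c) as)" using False d by (cases c) (simp add: reads_def)
    then show ?thesis using as l by (simp add: tape_act_fst_snd)
  qed
  show "fst (tm_step M c) = q'" "length (snd (tm_step M c)) = tm_tapes M"
    "\<And>j z. j < tm_tapes M \<Longrightarrow> fst (snd (tm_step M c) ! j) z =
      (if z = snd (snd c ! j) then fst (as ! j) else fst (snd c ! j) z)"
    "\<And>j. j < tm_tapes M \<Longrightarrow> snd (snd (tm_step M c) ! j) = snd (snd c ! j) + snd (as ! j)"
    "\<And>j. j < tm_tapes M \<Longrightarrow> snd (as ! j) \<in> {-1, 0, 1}"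
    using st as by blast+
  show "wf_config M (tm_step M c)"
    unfolding wf_config_def using st as g by auto
qed

definition run :: "tm \<Rightarrow> bool list \<Rightarrow> nat \<Rightarrow> tm_config" where
  "run M y t = (tm_step M ^^ t) (tm_init M y)"

lemma run_simps: "run M y 0 = tm_init M y" "run M y (Suc t) = tm_step M (run M y t)"
  by (simp_all add: run_def)

lemma tm_init_nth:
  assumes "valid_tm M" "j < tm_tapes M"
  shows "snd (tm_init M y) ! j = word_tape (if j = 0 then y else [])"
  using assms by (cases j) (auto simp: tm_init_def)

lemma wf_run:
  assumes "valid_tm M"
  shows "wf_config M (run M y t)"
proof (induction t)
  case 0
  have "word_tape z = (fst (word_tape z), 0)" "fst (word_tape z) i < 3" for z i
    by (auto simp: word_tape_def bit_symbol_def)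
  moreover have "3 \<le> tm_symbols M" "2 \<le> tm_states M" "2 \<le> tm_tapes M" using assms by (auto simp: valid_tm_def)
  ultimately show ?case unfolding run_simps wf_config_def
    using tm_init_nth[OF assms] by (auto simp: tm_init_def intro: less_le_trans)
next
  case (Suc t)
  then show ?case unfolding run_simps using tm_step_next(5)[OF assms Suc] by (metis surj_pair)
qed

section \<open>Head positions and tape contents along a run\<close>

definition head :: "tm \<Rightarrow> bool list \<Rightarrow> nat \<Rightarrow> nat \<Rightarrow> int" where
  "head M y t j = snd (snd (run M y t) ! j)"

definition cont :: "tm \<Rightarrow> bool list \<Rightarrow> nat \<Rightarrow> nat \<Rightarrow> int \<Rightarrow> nat" where
  "cont M y t j = fst (snd (run M y t) ! j)"

lemma run_step:
  assumes M: "valid_tm M" and nx: "next_act M (fst (run M y t)) (reads (run M y t)) = (q', as)"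
  shows "fst (run M y (Suc t)) = q'"
    "\<And>j z. j < tm_tapes M \<Longrightarrow> cont M y (Suc t) j z = (if z = head M y t j then fst (as ! j) else cont M y t j z)"
    "\<And>j. j < tm_tapes M \<Longrightarrow> head M y (Suc t) j = head M y t j + snd (as ! j)"
    "\<And>j. j < tm_tapes M \<Longrightarrow> snd (as ! j) \<in> {-1, 0, 1}"
  using tm_step_next[OF M wf_run[OF M] nx] unfolding run_simps head_def cont_def by auto

lemma head_bound:
  assumes M: "valid_tm M" "j < tm_tapes M"
  shows "\<bar>head M y t j\<bar> \<le> int t"
proof (induction t)
  case 0
  then show ?case using tm_init_nth[OF assms, of y] by (simp add: head_def run_simps word_tape_def)
next
  case (Suc t)
  obtain q' as where nx: "next_act M (fst (run M y t)) (reads (run M y t)) = (q', as)" by force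
  then show ?case using run_step(3,4)[OF M(1) nx M(2)] Suc by auto
qed

lemma reads_run:
  assumes M: "valid_tm M" "j < tm_tapes M"
  shows "reads (run M y t) ! j = cont M y t j (head M y t j)"
  using reads_wf(3)[OF wf_run[OF M(1)] M(2)] by (simp add: cont_def head_def)

lemma run_halted:
  assumes "fst (run M y t) = 1" "t \<le> t'"
  shows "run M y t' = run M y t"
  using assms(2)
proof (induction t' rule: dec_induct)
  case (step n)
  then have "fst (run M y n) = 1" using assms(1) by simp
  then have "tm_step M (run M y n) = run M y n" by (cases "run M y n") simp
  then show ?case using step by (simp add: run_simps)
qed simp

text \<open>
  A label \<open>(cs, hs, ls, rs, q, ss, wz)\<close> records the contents of the cell on every tape, whether the heads
  are on the cell, on its left neighbour and on its right neighbour, and the state together with the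
  symbols under all heads. The flag \<open>wz\<close> marks the cells of the certificate, in which no bit may
  follow a blank.
\<close>

type_synonym label = "nat list \<times> bool list \<times> bool list \<times> bool list \<times> nat \<times> nat list \<times> bool"

definition labels :: "tm \<Rightarrow> label set" where
  "labels M = {(cs, hs, ls, rs, q, ss, wz). length cs = tm_tapes M \<and> length hs = tm_tapes M \<and>
     length ls = tm_tapes M \<and> length rs = tm_tapes M \<and> length ss = tm_tapes M \<and>
     set cs \<subseteq> {..<tm_symbols M} \<and> set ss \<subseteq> {..<tm_symbols M} \<and> q < tm_states M \<and>
     (\<forall>j<tm_tapes M. hs ! j \<longrightarrow> ss ! j = cs ! j)}"

lemma finite_labels: "finite (labels M)"
proof (rule finite_subset)
  let ?N = "{xs. set xs \<subseteq> {..<tm_symbols M} \<and> length xs = tm_tapes M}"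
  let ?B = "{xs :: bool list. set xs \<subseteq> UNIV \<and> length xs = tm_tapes M}"
  show "labels M \<subseteq> ?N \<times> ?B \<times> ?B \<times> ?B \<times> {..<tm_states M} \<times> ?N \<times> UNIV"
    by (auto simp: labels_def)
  show "finite (?N \<times> ?B \<times> ?B \<times> ?B \<times> {..<tm_states M} \<times> ?N \<times> (UNIV :: bool set))"
    by (intro finite_cartesian_product finite_lists_length_eq) simp_all
qed

text \<open>A step depends on the symbols under all heads, which may be far apart. Keeping
  \<open>q\<close> and \<open>ss\<close> constant along a row, with \<open>ss\<close> tied by
  \<open>labels\<close> to the cell under each head, turns the step into a condition on vertically
  adjacent cells.\<close>

fun hrel :: "label \<Rightarrow> label \<Rightarrow> bool" where
  "hrel (cs, hs, ls, rs, q, ss, wz) (cs', hs', ls', rs', q', ss', wz') \<longleftrightarrow>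
     q = q' \<and> ss = ss' \<and> rs = hs' \<and> ls' = hs \<and> (wz \<and> wz' \<and> cs ! 0 = 0 \<longrightarrow> cs' ! 0 = 0)"

text \<open>A head arrives from the left neighbour with move 1 and from the right neighbour with
  move -1; the flags \<open>ls'\<close> and \<open>rs'\<close> of the new row come from
  \<open>hrel\<close>.\<close>

fun vrel :: "tm \<Rightarrow> label \<Rightarrow> label \<Rightarrow> bool" where
  "vrel M (cs, hs, ls, rs, q, ss, wz) (cs', hs', ls', rs', q', ss', wz') \<longleftrightarrow>
     (case next_act M q ss of (q1, as) \<Rightarrow> q' = q1 \<and> (\<forall>j<tm_tapes M.
        cs' ! j = (if hs ! j then fst (as ! j) else cs ! j) \<and>
        hs' ! j = ((snd (as ! j) = 0 \<and> hs ! j) \<or> (snd (as ! j) = 1 \<and> ls ! j) \<or> (snd (as ! j) = -1 \<and> rs ! j))))"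

definition input_kind :: "ck \<Rightarrow> bool" where
  "input_kind k \<longleftrightarrow> k \<in> {Blank, Zero, One, Wild, Pre}"

text \<open>The start of the heads is marked through \<open>rs\<close> on the cell before position
  0, because the kind of the cell at position 0 already names its bit.\<close>

fun admissible :: "tm \<Rightarrow> sym \<Rightarrow> label \<Rightarrow> bool" where
  "admissible M (Bit _) _ = False"
| "admissible M (Cell k fc lc) (cs, hs, ls, rs, q, ss, wz) \<longleftrightarrow>
     (fc \<longrightarrow> (\<forall>j<tm_tapes M. \<not> hs ! j \<and> \<not> ls ! j)) \<and> (lc \<longrightarrow> (\<forall>j<tm_tapes M. \<not> rs ! j)) \<and>
     (wz \<longleftrightarrow> k = Wild) \<and>
     (input_kind k \<longrightarrow> q = 0 \<and> (\<forall>j<tm_tapes M. rs ! j = (k = Pre)) \<and> (\<forall>j. 0 < j \<longrightarrow> j < tm_tapes M \<longrightarrow> cs ! j = 0) \<and>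
        (k \<noteq> Wild \<longrightarrow> cs ! 0 = (if k = Zero then 1 else if k = One then 2 else 0)) \<and> (k = Wild \<longrightarrow> cs ! 0 < 3)) \<and>
     (k = Acc2 \<longrightarrow> q = 1 \<and> cs ! 1 = 2) \<and> (k = Acc0 \<longrightarrow> cs ! 1 = 0)"

definition bit_cell :: "bool \<Rightarrow> ck" where
  "bit_cell b = (if b then One else Zero)"

text \<open>Column \<open>U + 2\<close> is position 0 of the tapes. Within \<open>U + 1\<close>
  steps a head moves at most \<open>U + 1\<close> cells, so it reaches neither the first column nor,
  for nonempty \<open>e\<close>, the cell to the right of the last column.\<close>

definition tableau_width :: "bool list \<Rightarrow> nat \<Rightarrow> nat \<Rightarrow> nat" where
  "tableau_width e n U = U + 2 + length e + n + U + 1"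

definition tableau_kind :: "bool list \<Rightarrow> nat \<Rightarrow> nat \<Rightarrow> nat \<Rightarrow> nat \<Rightarrow> ck" where
  "tableau_kind e n U i j =
     (if i = 0 then
        if j < U + 1 then Blank else if j = U + 1 then Pre
        else if j < U + 2 + length e then bit_cell (e ! (j - (U + 2)))
        else if j < U + 2 + length e + n then Wild else Blank
      else if i = U + 1 then (if j = U + 2 then Acc2 else if j = U + 3 then Acc0 else Mid)
      else Mid)"

definition tableau_cell :: "bool list \<Rightarrow> nat \<Rightarrow> nat \<Rightarrow> nat \<Rightarrow> nat \<Rightarrow> sym" where
  "tableau_cell e n U i j = Cell (tableau_kind e n U i j) (j = 0) (Suc j = tableau_width e n U)"

definition tableau :: "tm \<Rightarrow> bool list \<Rightarrow> nat \<Rightarrow> nat \<Rightarrow> (nat \<Rightarrow> nat \<Rightarrow> label) \<Rightarrow> bool" where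
  "tableau M e n U f \<longleftrightarrow> (\<forall>i<U + 2. \<forall>j<tableau_width e n U. f i j \<in> labels M \<and>
     admissible M (tableau_cell e n U i j) (f i j) \<and>
     (Suc j < tableau_width e n U \<longrightarrow> hrel (f i j) (f i (Suc j))) \<and>
     (Suc i < U + 2 \<longrightarrow> vrel M (f i j) (f (Suc i) j)))"

lemma cont_0:
  assumes "valid_tm M" "j < tm_tapes M"
  shows "cont M y 0 j z = (if j = 0 \<and> 0 \<le> z \<and> z < int (length y) then bit_symbol (y ! nat z) else 0)"
  using tm_init_nth[OF assms, of y] by (simp add: cont_def run_simps word_tape_def)

lemma head_0: "valid_tm M \<Longrightarrow> j < tm_tapes M \<Longrightarrow> head M y 0 j = 0"
  using head_bound[of M j y 0] by simp

lemma cont_less: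
  assumes "valid_tm M" "j < tm_tapes M"
  shows "cont M y t j z < tm_symbols M"
  using wf_run[OF assms(1), of y t] assms(2) unfolding wf_config_def cont_def by blast

lemma tableau_complete:
  assumes M: "valid_tm M" and e: "2 \<le> length e" and w: "length w \<le> n"
    and acc: "fst (run M (e @ w) (U + 1)) = 1" "cont M (e @ w) (U + 1) 1 0 = 2" "cont M (e @ w) (U + 1) 1 1 = 0"
  shows "\<exists>f. tableau M e n U f"
proof -
  let ?y = "e @ w" and ?K = "tm_tapes M" and ?W = "tableau_width e n U"
  define pos where "pos = (\<lambda>j. int j - int (U + 2))"
  define cs where "cs = (\<lambda>i j. map (\<lambda>k. cont M ?y i k (pos j)) [0..<?K])"
  define hs where "hs = (\<lambda>i j. map (\<lambda>k. head M ?y i k = pos j) [0..<?K])"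
  define ls where "ls = (\<lambda>i j. map (\<lambda>k. head M ?y i k = pos j - 1) [0..<?K])"
  define rs where "rs = (\<lambda>i j. map (\<lambda>k. head M ?y i k = pos j + 1) [0..<?K])"
  define q where "q = (\<lambda>i. fst (run M ?y i))"
  define ss where "ss = (\<lambda>i. reads (run M ?y i))"
  define wz where "wz = (\<lambda>i j. tableau_kind e n U i j = Wild)"
  define f where "f = (\<lambda>i j. (cs i j, hs i j, ls i j, rs i j, q i, ss i, wz i j))"
  have K2: "2 \<le> ?K" using M by (simp add: valid_tm_def)
  note rw = reads_wf[OF wf_run[OF M, of ?y]]
  have pS: "pos (Suc j) = pos j + 1" for j by (simp add: pos_def)
  have lab: "f i j \<in> labels M" for i j
  proof -
    have "q i < tm_states M" using wf_run[OF M, of ?y i] by (simp add: wf_config_def q_def)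
    moreover have "set (cs i j) \<subseteq> {..<tm_symbols M}" using cont_less[OF M] by (auto simp: cs_def)
    moreover have "\<forall>k<?K. hs i j ! k \<longrightarrow> ss i ! k = cs i j ! k"
      using reads_run[OF M] by (simp add: hs_def ss_def cs_def)
    ultimately show ?thesis using rw[of i]
      by (simp add: f_def labels_def ss_def, simp add: cs_def hs_def ls_def rs_def)
  qed
  have wild: "cs 0 j ! 0 = (let k = j - (U + 2) in if U + 2 \<le> j \<and> k < length ?y then bit_symbol (?y ! k) else 0)" for j
  proof -
    have "cs 0 j ! 0 = cont M ?y 0 0 (pos j)" using K2 by (simp add: cs_def)
    also have "\<dots> = (if 0 \<le> pos j \<and> pos j < int (length ?y) then bit_symbol (?y ! nat (pos j)) else 0)"
      using cont_0[OF M, of 0 ?y "pos j"] K2 by simp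
    also have "(0 \<le> pos j \<and> pos j < int (length ?y)) = (U + 2 \<le> j \<and> j - (U + 2) < length ?y)"
      unfolding pos_def by linarith
    also have "nat (pos j) = j - (U + 2)" unfolding pos_def by linarith
    finally show ?thesis by (simp add: Let_def)
  qed
  have hr: "hrel (f i j) (f i (Suc j))" for i j
  proof -
    have "cs i (Suc j) ! 0 = 0" if z: "wz i j" "wz i (Suc j)" "cs i j ! 0 = 0"
    proof -
      have i: "i = 0" using z(1) by (auto simp: wz_def tableau_kind_def split: if_splits)
      have j: "U + 2 + length e \<le> j" using z(1) i by (auto simp: wz_def tableau_kind_def bit_cell_def split: if_splits)
      have "\<not> j - (U + 2) < length ?y" using z(3) j unfolding i wild
        by (auto simp: Let_def bit_symbol_def split: if_splits)
      then show ?thesis unfolding i wild by (auto simp: Let_def)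
    qed
    then show ?thesis by (simp add: f_def) (simp add: rs_def hs_def ls_def pS)
  qed
  have vr: "vrel M (f i j) (f (Suc i) j)" for i j
  proof -
    obtain q' as where nx: "next_act M (q i) (ss i) = (q', as)" by force
    note R = run_step[OF M nx[unfolded q_def ss_def]]
    have "cs (Suc i) j ! k = (if hs i j ! k then fst (as ! k) else cs i j ! k) \<and>
        hs (Suc i) j ! k = ((snd (as ! k) = 0 \<and> hs i j ! k) \<or> (snd (as ! k) = 1 \<and> ls i j ! k) \<or>
          (snd (as ! k) = -1 \<and> rs i j ! k))" if k: "k < ?K" for k
    proof -
      have "snd (as ! k) = -1 \<or> snd (as ! k) = 0 \<or> snd (as ! k) = 1" using R(4)[OF k] by auto
      then show ?thesis using k R(2,3)[OF k] by (auto simp: cs_def hs_def ls_def rs_def)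
    qed
    then show ?thesis using nx R(1) by (simp add: f_def q_def)
  qed
  have adm: "admissible M (tableau_cell e n U i j) (f i j)" if i: "i < U + 2" and j: "j < ?W" for i j
  proof -
    let ?k = "tableau_kind e n U i j"
    have hb: "\<bar>head M ?y i k\<bar> \<le> int (U + 1)" if "k < ?K" for k using head_bound[OF M that, of ?y i] i by linarith
    have first: "\<not> hs i j ! k \<and> \<not> ls i j ! k" if "j = 0" "k < ?K" for k
      using hb[OF that(2)] that by (auto simp: hs_def ls_def pos_def)
    have last: "\<not> rs i j ! k" if "Suc j = ?W" "k < ?K" for k
    proof -
      have "pos j + 1 = int (Suc j) - int (U + 2)" by (simp add: pos_def)
      then have "pos j + 1 = int ?W - int (U + 2)" using that(1) by simp
      then have "pos j + 1 > int (U + 1)" using e by (simp add: tableau_width_def)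
      then show ?thesis using hb[OF that(2)] that(2) by (auto simp: rs_def)
    qed
    have inp: "q i = 0 \<and> (\<forall>k<?K. rs i j ! k = (?k = Pre)) \<and> (\<forall>k. 0 < k \<longrightarrow> k < ?K \<longrightarrow> cs i j ! k = 0) \<and>
        (?k \<noteq> Wild \<longrightarrow> cs i j ! 0 = (if ?k = Zero then 1 else if ?k = One then 2 else 0)) \<and> (?k = Wild \<longrightarrow> cs i j ! 0 < 3)"
      if ik: "input_kind ?k"
    proof -
      have i0: "i = 0" using ik by (auto simp: tableau_kind_def input_kind_def split: if_splits)
      have pre: "(?k = Pre) = (j = U + 1)" unfolding i0 by (auto simp: tableau_kind_def bit_cell_def)
      have "q i = 0" unfolding i0 q_def by (simp add: run_simps tm_init_def)
      moreover have "rs i j ! k = (?k = Pre)" if "k < ?K" for k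
      proof -
        have "rs i j ! k = (j = U + 1)" using head_0[OF M that, of ?y] that by (auto simp: rs_def pos_def i0)
        then show ?thesis unfolding pre .
      qed
      moreover have "cs i j ! k = 0" if "0 < k" "k < ?K" for k
        using cont_0[OF M that(2), of ?y "pos j"] that unfolding i0 by (simp add: cs_def)
      moreover have "cs i j ! 0 = (if ?k = Zero then 1 else if ?k = One then 2 else 0)" if "?k \<noteq> Wild"
      proof -
        consider "j < U + 1" | "j = U + 1" | "U + 2 \<le> j" "j < U + 2 + length e" | "U + 2 + length e + n \<le> j"
          | "U + 2 + length e \<le> j" "j < U + 2 + length e + n" by linarith
        then show ?thesis
        proof cases
          case 3
          have l: "j - (U + 2) < length e" using 3 by linarith
          have k: "?k = bit_cell (e ! (j - (U + 2)))" unfolding i0 using 3 by (simp add: tableau_kind_def)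
          show ?thesis unfolding k unfolding i0 wild using 3 l by (simp add: Let_def nth_append bit_cell_def bit_symbol_def)
        next
          case 4
          have "\<not> j - (U + 2) < length ?y" using 4 w by simp
          moreover have "?k = Blank" unfolding i0 using 4 by (simp add: tableau_kind_def)
          ultimately show ?thesis unfolding i0 wild by (auto simp: Let_def)
        next
          case 5
          then show ?thesis using that unfolding i0 by (simp add: tableau_kind_def)
        qed (simp_all add: i0 wild tableau_kind_def)
      qed
      moreover have "cs i j ! 0 < 3" unfolding i0 wild by (simp add: Let_def bit_symbol_def)
      ultimately show ?thesis by blast
    qed
    have a2: "q i = 1 \<and> cs i j ! 1 = 2" if "?k = Acc2"
    proof -
      have "i = U + 1" "j = U + 2" using that by (auto simp: tableau_kind_def bit_cell_def split: if_splits)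
      then show ?thesis using acc K2 by (simp add: q_def cs_def pos_def)
    qed
    have a0: "cs i j ! 1 = 0" if "?k = Acc0"
    proof -
      have "i = U + 1" "j = U + 3" using that by (auto simp: tableau_kind_def bit_cell_def split: if_splits)
      then show ?thesis using acc K2 by (simp add: cs_def pos_def)
    qed
    show ?thesis unfolding tableau_cell_def f_def admissible.simps wz_def
      using first last inp a2 a0 by blast
  qed
  have "tableau M e n U f" unfolding tableau_def using lab hr vr adm by blast
  then show ?thesis by blast
qed

text \<open>Row by row the labels reproduce the run on the word spelled by the first row. Tracking
  \<open>cs\<close> and \<open>hs\<close> suffices: \<open>ls\<close> and \<open>rs\<close> follow
  from the horizontal neighbours and, at the borders, from the fact that the heads stay
  inside.\<close>

lemma tableau_sound:
  assumes M: "valid_tm M" and e: "2 \<le> length e" and f: "tableau M e n U f"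
  shows "\<exists>w. length w \<le> n \<and> fst (run M (e @ w) (U + 1)) = 1 \<and>
    cont M (e @ w) (U + 1) 1 0 = 2 \<and> cont M (e @ w) (U + 1) 1 1 = 0"
proof -
  let ?K = "tm_tapes M" and ?W = "tableau_width e n U"
  have K2: "2 \<le> ?K" using M by (simp add: valid_tm_def)
  define cs where "cs = (\<lambda>i j. fst (f i j))"
  define hs where "hs = (\<lambda>i j. fst (snd (f i j)))"
  define ls where "ls = (\<lambda>i j. fst (snd (snd (f i j))))"
  define rs where "rs = (\<lambda>i j. fst (snd (snd (snd (f i j)))))"
  define q where "q = (\<lambda>i j. fst (snd (snd (snd (snd (f i j))))))"
  define ss where "ss = (\<lambda>i j. fst (snd (snd (snd (snd (snd (f i j)))))))"
  define wz where "wz = (\<lambda>i j. snd (snd (snd (snd (snd (snd (f i j)))))))"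
  have fe: "f i j = (cs i j, hs i j, ls i j, rs i j, q i j, ss i j, wz i j)" for i j
    by (simp add: cs_def hs_def ls_def rs_def q_def ss_def wz_def)
  note F = f[unfolded tableau_def, rule_format]
  have lab: "length (ss i j) = ?K \<and> (\<forall>k<?K. hs i j ! k \<longrightarrow> ss i j ! k = cs i j ! k)"
    if "i < U + 2" "j < ?W" for i j
  proof -
    have "f i j \<in> labels M" using F[OF that] by blast
    then show ?thesis unfolding fe labels_def by simp
  qed
  have adm: "admissible M (Cell (tableau_kind e n U i j) (j = 0) (Suc j = ?W))
      (cs i j, hs i j, ls i j, rs i j, q i j, ss i j, wz i j)" if "i < U + 2" "j < ?W" for i j
    using F[OF that] unfolding fe tableau_cell_def by blast
  have H: "q i j = q i (Suc j)" "ss i j = ss i (Suc j)" "rs i j = hs i (Suc j)" "ls i (Suc j) = hs i j"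
    "wz i j \<and> wz i (Suc j) \<and> cs i j ! 0 = 0 \<longrightarrow> cs i (Suc j) ! 0 = 0" if "i < U + 2" "j < ?W" "Suc j < ?W" for i j
    using F[OF that(1,2)] that(3) unfolding fe by (auto simp: hrel.simps)
  have V: "vrel M (cs i j, hs i j, ls i j, rs i j, q i j, ss i j, wz i j)
      (cs (Suc i) j, hs (Suc i) j, ls (Suc i) j, rs (Suc i) j, q (Suc i) j, ss (Suc i) j, wz (Suc i) j)"
    if "i < U + 2" "j < ?W" "Suc i < U + 2" for i j
    using F[OF that(1,2)] that(3) unfolding fe by blast
  have bc: "q i j = q i 0 \<and> ss i j = ss i 0" if "i < U + 2" "j < ?W" for i j
    using that(2)
  proof (induction j)
    case (Suc j)
    then show ?case using H(1,2)[OF that(1), of j] by simp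
  qed simp
  have W0: "0 < ?W" by (simp add: tableau_width_def)
  let ?u = "\<lambda>k. cs 0 (U + 2 + length e + k) ! 0"
  \<comment> \<open>The certificate ends at the first blank wild cell; the flag \<open>wz\<close>
    makes all later wild cells blank too.\<close>
  define m where "m = (LEAST k. k = n \<or> ?u k = 0)"
  have mP: "m = n \<or> ?u m = 0" unfolding m_def by (rule LeastI[of _ n]) simp
  have mn: "m \<le> n" unfolding m_def by (rule Least_le) simp
  have below: "?u k \<noteq> 0" if "k < m" for k using not_less_Least[of k "\<lambda>k. k = n \<or> ?u k = 0"] that unfolding m_def by blast
  have wildk: "tableau_kind e n U 0 (U + 2 + length e + k) = Wild" if "k < n" for k
    using that by (simp add: tableau_kind_def)
  have colW: "U + 2 + length e + k < ?W" if "k < n" for k using that by (simp add: tableau_width_def)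
  have zero: "0 < U + 2" by simp
  have wzk: "wz 0 (U + 2 + length e + k)" "?u k < 3" if "k < n" for k
    using adm[OF zero colW[OF that]] unfolding wildk[OF that] by (simp_all add: input_kind_def)
  have above: "?u k = 0" if "m \<le> k" "k < n" for k
    using that
  proof (induction k rule: dec_induct)
    case base
    then show ?case using mP by auto
  next
    case (step k)
    have k: "k < n" "Suc k < n" using step by auto
    have c: "Suc (U + 2 + length e + k) < ?W" using colW[OF k(2)] by simp
    show ?case using H(5)[OF zero colW[OF k(1)] c] wzk(1)[OF k(1)] wzk(1)[OF k(2)] step k by simp
  qed
  define w where "w = map (\<lambda>k. ?u k = 2) [0..<m]"
  have lw: "length w = m" by (simp add: w_def)
  let ?y = "e @ w"
  define pos where "pos = (\<lambda>j. int j - int (U + 2))"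
  have c0: "cs 0 j ! k = cont M ?y 0 k (pos j)" if j: "j < ?W" and k: "k < ?K" for j k
  proof (cases "k = 0")
    case False
    have ik: "input_kind (tableau_kind e n U 0 j)" by (simp add: tableau_kind_def input_kind_def bit_cell_def)
    have "cs 0 j ! k = 0" using adm[OF zero j] ik False k by simp
    then show ?thesis using cont_0[OF M k] False by simp
  next
    case True
    have ik: "input_kind (tableau_kind e n U 0 j)" by (simp add: tableau_kind_def input_kind_def bit_cell_def)
    let ?k = "tableau_kind e n U 0 j"
    have nw: "cs 0 j ! 0 = (if ?k = Zero then 1 else if ?k = One then 2 else 0)" if "?k \<noteq> Wild"
      using adm[OF zero j] ik that by simp
    have "(0 \<le> pos j \<and> pos j < int (length ?y)) = (U + 2 \<le> j \<and> j - (U + 2) < length ?y)"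
      unfolding pos_def by linarith
    moreover have "nat (pos j) = j - (U + 2)" unfolding pos_def by linarith
    ultimately have ct: "cont M ?y 0 0 (pos j) =
        (if U + 2 \<le> j \<and> j - (U + 2) < length ?y then bit_symbol (?y ! (j - (U + 2))) else 0)"
      using cont_0[OF M, of 0 ?y "pos j"] K2 by simp
    consider (a) "j < U + 2" | (b) "U + 2 \<le> j" "j < U + 2 + length e" | (c) "U + 2 + length e + n \<le> j"
      | (d) i where "i < m" "j = U + 2 + length e + i" | (e) i where "m \<le> i" "i < n" "j = U + 2 + length e + i"
    proof -
      have "j < U + 2 \<or> (U + 2 \<le> j \<and> j < U + 2 + length e) \<or> U + 2 + length e + n \<le> j \<or>
        (U + 2 + length e \<le> j \<and> j < U + 2 + length e + n)" by linarith
      moreover have "\<exists>i. i < n \<and> j = U + 2 + length e + i" if "U + 2 + length e \<le> j" "j < U + 2 + length e + n"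
        using that by (intro exI[of _ "j - (U + 2 + length e)"]) linarith
      ultimately show thesis using a b c d e by (meson not_le)
    qed
    then have "cs 0 j ! 0 = cont M ?y 0 0 (pos j)"
    proof cases
      case a
      then have "?k = Blank \<or> ?k = Pre" by (auto simp: tableau_kind_def)
      then show ?thesis using nw ct a by auto
    next
      case b
      then have "?k = bit_cell (e ! (j - (U + 2)))" by (simp add: tableau_kind_def)
      moreover have "j - (U + 2) < length e" using b by linarith
      ultimately show ?thesis using nw ct b by (simp add: bit_cell_def bit_symbol_def nth_append)
    next
      case c
      then have "?k = Blank" by (simp add: tableau_kind_def)
      moreover have "\<not> j - (U + 2) < length ?y" using c mn lw by simp
      ultimately show ?thesis using nw ct by auto
    next
      case d
      have n: "i < n" using d mn by simp
      have "?u i \<noteq> 0" "?u i < 3" using below[OF d(1)] wzk(2)[OF n] by auto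
      then have "?u i = bit_symbol (?u i = 2)" by (auto simp: bit_symbol_def)
      moreover have "?y ! (j - (U + 2)) = (?u i = 2)" using d by (simp add: nth_append w_def)
      moreover have "U + 2 \<le> j \<and> j - (U + 2) < length ?y" using d lw by simp
      ultimately show ?thesis using ct d(2) by simp
    next
      case e
      have "\<not> j - (U + 2) < length ?y" using e lw by simp
      then show ?thesis using above[OF e(1,2)] ct e(3) by simp
    qed
    then show ?thesis using True by simp
  qed
  have rs0: "rs 0 j ! k = (j = U + 1)" if j: "j < ?W" and k: "k < ?K" for j k
  proof -
    have ik: "input_kind (tableau_kind e n U 0 j)" by (simp add: tableau_kind_def input_kind_def bit_cell_def)
    have "(tableau_kind e n U 0 j = Pre) = (j = U + 1)" by (auto simp: tableau_kind_def bit_cell_def)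
    then show ?thesis using adm[OF zero j] ik k by simp
  qed
  have h0: "hs 0 j ! k = (head M ?y 0 k = pos j)" if j: "j < ?W" and k: "k < ?K" for j k
  proof (cases j)
    case 0
    have "\<not> hs 0 0 ! k" using adm[OF zero W0] k by simp
    then show ?thesis using 0 head_0[OF M k] by (simp add: pos_def)
  next
    case (Suc i)
    then have "hs 0 j ! k = (i = U + 1)" using H(3)[OF zero, of i] rs0[of i k] j k by simp
    then show ?thesis using Suc head_0[OF M k] by (auto simp: pos_def)
  qed
  have main: "q i 0 = fst (run M ?y i) \<and>
     (\<forall>j<?W. \<forall>k<?K. cs i j ! k = cont M ?y i k (pos j) \<and> hs i j ! k = (head M ?y i k = pos j))"
    if "i < U + 2" for i
    using that
  proof (induction i)
    case 0
    have ik: "input_kind (tableau_kind e n U 0 0)" by (simp add: tableau_kind_def input_kind_def bit_cell_def)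
    have "q 0 0 = 0" using adm[OF zero W0] ik by simp
    then show ?case using c0 h0 by (simp add: run_simps tm_init_def)
  next
    case (Suc i)
    have i: "i < U + 2" using Suc.prems by simp
    note IH = Suc.IH[OF i]
    have hb: "\<bar>head M ?y i k\<bar> \<le> int U" if "k < ?K" for k
      using head_bound[OF M that, of ?y i] Suc.prems by linarith
    have ss: "ss i 0 = reads (run M ?y i)"
    proof (rule nth_equalityI)
      show "length (ss i 0) = length (reads (run M ?y i))" using lab[OF i W0] reads_wf(1)[OF wf_run[OF M]] by simp
      fix k assume "k < length (ss i 0)"
      then have k: "k < ?K" using lab[OF i W0] by simp
      \<comment> \<open>The column under the head of tape \<open>k\<close>. It lies inside the
        rectangle, so that the broadcast symbol is compared there with the symbol actually
        read.\<close>
      define j where "j = nat (head M ?y i k + int (U + 2))"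
      have pj: "pos j = head M ?y i k" using hb[OF k] by (simp add: j_def pos_def)
      have jW: "j < ?W" using hb[OF k] e unfolding j_def tableau_width_def by linarith
      have "hs i j ! k" using IH jW k pj by simp
      then have "ss i j ! k = cs i j ! k" using lab[OF i jW] k by simp
      then show "ss i 0 ! k = reads (run M ?y i) ! k"
        using bc[OF i jW] IH jW k pj reads_run[OF M k] by simp
    qed
    obtain q1 as where nx: "next_act M (fst (run M ?y i)) (reads (run M ?y i)) = (q1, as)" by force
    note R = run_step[OF M nx]
    have v: "q (Suc i) j = q1 \<and> (\<forall>k<?K. cs (Suc i) j ! k = (if hs i j ! k then fst (as ! k) else cs i j ! k) \<and>
        hs (Suc i) j ! k = ((snd (as ! k) = 0 \<and> hs i j ! k) \<or> (snd (as ! k) = 1 \<and> ls i j ! k) \<or> (snd (as ! k) = -1 \<and> rs i j ! k)))"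
      if j: "j < ?W" for j
    proof -
      have "next_act M (q i j) (ss i j) = (q1, as)" using bc[OF i j] IH ss nx by simp
      then show ?thesis using V[OF i j Suc.prems] by simp
    qed
    have ls: "ls i j ! k = (head M ?y i k = pos j - 1)" if j: "j < ?W" and k: "k < ?K" for j k
    proof (cases j)
      case 0
      have "\<not> ls i 0 ! k" using adm[OF i W0] k by simp
      then show ?thesis using 0 hb[OF k] by (auto simp: pos_def)
    next
      case (Suc j')
      then have "ls i j = hs i j'" using H(4)[OF i, of j'] j by simp
      moreover have "hs i j' ! k = (head M ?y i k = pos j')" using IH Suc j k by simp
      moreover have "pos j - 1 = pos j'" using Suc by (simp add: pos_def)
      ultimately show ?thesis by simp
    qed
    have rs: "rs i j ! k = (head M ?y i k = pos j + 1)" if j: "j < ?W" and k: "k < ?K" for j k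
    proof (cases "Suc j = ?W")
      case True
      have 1: "\<not> rs i j ! k" using adm[OF i j] k True by simp
      have "pos j + 1 = int (Suc j) - int (U + 2)" by (simp add: pos_def)
      then have "pos j + 1 = int ?W - int (U + 2)" using True by simp
      then have "pos j + 1 > int U" using e by (simp add: tableau_width_def)
      then show ?thesis using 1 hb[OF k] by auto
    next
      case False
      then have sj: "Suc j < ?W" using j by simp
      have "rs i j = hs i (Suc j)" using H(3)[OF i j sj] .
      then show ?thesis using IH sj k by (simp add: pos_def)
    qed
    have "cs (Suc i) j ! k = cont M ?y (Suc i) k (pos j) \<and> hs (Suc i) j ! k = (head M ?y (Suc i) k = pos j)"
      if j: "j < ?W" and k: "k < ?K" for j k
    proof -
      have d: "snd (as ! k) = -1 \<or> snd (as ! k) = 0 \<or> snd (as ! k) = 1" using R(4)[OF k] by auto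
      have ih: "cs i j ! k = cont M ?y i k (pos j)" "hs i j ! k = (head M ?y i k = pos j)" using IH j k by auto
      have vk: "cs (Suc i) j ! k = (if hs i j ! k then fst (as ! k) else cs i j ! k)"
        "hs (Suc i) j ! k = ((snd (as ! k) = 0 \<and> hs i j ! k) \<or> (snd (as ! k) = 1 \<and> ls i j ! k) \<or> (snd (as ! k) = -1 \<and> rs i j ! k))"
        using v[OF j] k by blast+
      have "cs (Suc i) j ! k = cont M ?y (Suc i) k (pos j)"
        unfolding vk(1) R(2)[OF k] ih by (simp only: eq_commute)
      moreover have "hs (Suc i) j ! k = (head M ?y (Suc i) k = pos j)"
        unfolding vk(2) R(3)[OF k] ih(2) ls[OF j k] rs[OF j k] using d by (elim disjE) auto
      ultimately show ?thesis by simp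
    qed
    then show ?case using v[OF W0] R(1) by simp
  qed
  have iU: "U + 1 < U + 2" by simp
  have j2: "U + 2 < ?W" "U + 3 < ?W" using e unfolding tableau_width_def by linarith+
  have k2: "tableau_kind e n U (U + 1) (U + 2) = Acc2" "tableau_kind e n U (U + 1) (U + 3) = Acc0"
    by (simp_all add: tableau_kind_def)
  have "q (U + 1) (U + 2) = 1" "cs (U + 1) (U + 2) ! 1 = 2" using adm[OF iU j2(1)] unfolding k2 by simp_all
  moreover have "cs (U + 1) (U + 3) ! 1 = 0" using adm[OF iU j2(2)] unfolding k2 by simp
  moreover have "pos (U + 2) = 0" "pos (U + 3) = 1" by (simp_all add: pos_def)
  moreover have "1 < ?K" using K2 by simp
  moreover have "q (U + 1) (U + 2) = fst (run M ?y (U + 1))" using main[OF iU] bc[OF iU j2(1)] by simp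
  ultimately have "fst (run M ?y (U + 1)) = 1 \<and> cont M ?y (U + 1) 1 0 = 2 \<and> cont M ?y (U + 1) 1 1 = 0"
    using main[OF iU] j2 by metis
  then show ?thesis using lw mn by blast
qed

lemma poly_nat_mono: "x \<le> y \<Longrightarrow> poly (p :: nat poly) x \<le> poly p y"
  by (induction p) (auto intro: add_mono mult_mono)

lemma encode_pair_append: "encode_pair x w = encode_pair x [] @ w"
  by (simp add: encode_pair_def)

lemma length_encode_pair: "length (encode_pair x []) = 2 * length x + 2"
  by (induction x) (auto simp: encode_pair_def)

text \<open>Configurations freeze after halting, so the test can be made at any later time
  \<open>T\<close>. Bits are nonblank symbols, hence a blank in cell 1 limits the output to one bit,
  and the 2 in cell 0 makes this bit true.\<close>

lemma accepts_iff:
  assumes out: "tm_outputs_within M y t z" and t: "t \<le> T"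
  shows "z = [True] \<longleftrightarrow> fst (run M y T) = 1 \<and> cont M y T 1 0 = 2 \<and> cont M y T 1 1 = 0"
proof -
  have h: "fst (run M y t) = 1" and c: "\<And>i. i < length z \<Longrightarrow> cont M y t 1 (int i) = bit_symbol (z ! i)"
    and l: "cont M y t 1 (int (length z)) = 0"
    using out unfolding tm_outputs_within_def run_def cont_def by (auto simp: case_prod_beta)
  have r: "run M y T = run M y t" by (rule run_halted[OF h t])
  have e: "cont M y T = cont M y t" by (simp add: cont_def r fun_eq_iff)
  show ?thesis
  proof
    assume z: "z = [True]"
    then show "fst (run M y T) = 1 \<and> cont M y T 1 0 = 2 \<and> cont M y T 1 1 = 0"
      using h c[of 0] l unfolding r e by (simp add: bit_symbol_def)
  next
    assume a: "fst (run M y T) = 1 \<and> cont M y T 1 0 = 2 \<and> cont M y T 1 1 = 0"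
    have "length z \<noteq> 0" using a l unfolding e by auto
    moreover have "\<not> 1 < length z"
    proof
      assume "1 < length z"
      then have "cont M y t 1 1 = bit_symbol (z ! 1)" using c[of 1] by simp
      moreover have "bit_symbol (z ! 1) \<noteq> 0" by (simp add: bit_symbol_def)
      ultimately show False using a unfolding e by simp
    qed
    ultimately have "length z = 1" by linarith
    then obtain b where b: "z = [b]" by (cases z) auto
    then show "z = [True]" using c[of 0] a unfolding e by (cases b) (auto simp: bit_symbol_def)
  qed
qed

text \<open>\<open>m\<close>, \<open>H\<close>, \<open>V\<close> and \<open>A\<close> are chosen
  before \<open>x\<close>: they depend only on the verifier, and the word enters through the size of
  the rectangle and its cells.\<close>

theorem NP_label_tiling:
  assumes "L \<in> NP"
  obtains m H V A and p U :: "nat poly" where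
    "\<And>x. x \<in> L \<longleftrightarrow> (\<exists>s. label_tiling m H V (poly U (length x) + 2)
       (tableau_width (encode_pair x []) (poly p (length x)) (poly U (length x)))
       (\<lambda>i j. A (tableau_cell (encode_pair x []) (poly p (length x)) (poly U (length x)) i j)) s)"
proof -
  from assms obtain F and p :: "nat poly" where F: "polytime_computable F"
    and L: "\<And>x. x \<in> L \<longleftrightarrow> (\<exists>w. length w \<le> poly p (length x) \<and> F (encode_pair x w) = [True])"
    unfolding NP_def by blast
  from F obtain M and q :: "nat poly" where M: "valid_tm M"
    and out: "\<And>y. tm_outputs_within M y (poly q (length y)) (F y)"
    unfolding polytime_computable_def by blast
  define U where "U = pcompose q ([:2, 2:] + p)"
  have tab: "x \<in> L \<longleftrightarrow> (\<exists>f. tableau M (encode_pair x []) (poly p (length x)) (poly U (length x)) f)" for x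
  proof -
    let ?e = "encode_pair x []" and ?n = "poly p (length x)" and ?U = "poly U (length x)"
    have e2: "2 \<le> length ?e" by (simp add: length_encode_pair)
    have acc: "F (?e @ w) = [True] \<longleftrightarrow> fst (run M (?e @ w) (?U + 1)) = 1 \<and>
        cont M (?e @ w) (?U + 1) 1 0 = 2 \<and> cont M (?e @ w) (?U + 1) 1 1 = 0" if "length w \<le> ?n" for w
    proof (rule accepts_iff[OF out])
      have "length (?e @ w) \<le> 2 + 2 * length x + ?n" using that by (simp add: length_encode_pair)
      then have "poly q (length (?e @ w)) \<le> poly q (2 + 2 * length x + ?n)" by (rule poly_nat_mono)
      also have "\<dots> = ?U" by (simp add: U_def poly_pcompose mult.commute)
      finally show "poly q (length (?e @ w)) \<le> ?U + 1" by simp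
    qed
    have "F (encode_pair x w) = F (?e @ w)" for w using encode_pair_append[of x w] by (rule arg_cong)
    then have "x \<in> L \<longleftrightarrow> (\<exists>w. length w \<le> ?n \<and> F (?e @ w) = [True])" by (simp only: L)
    also have "\<dots> \<longleftrightarrow> (\<exists>f. tableau M ?e ?n ?U f)"
    proof
      assume "\<exists>w. length w \<le> ?n \<and> F (?e @ w) = [True]"
      then show "\<exists>f. tableau M ?e ?n ?U f" using acc tableau_complete[OF M e2] by blast
    next
      assume "\<exists>f. tableau M ?e ?n ?U f"
      then show "\<exists>w. length w \<le> ?n \<and> F (?e @ w) = [True]" using acc tableau_sound[OF M e2] by blast
    qed
    finally show ?thesis .
  qed
  define m where "m = card (labels M)"
  obtain lab where lab: "bij_betw lab {..<m} (labels M)"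
    using ex_bij_betw_nat_finite[OF finite_labels[of M]] unfolding m_def atLeast0LessThan by blast
  define unlab where "unlab = inv_into {..<m} lab"
  have ul: "unlab l < m" "lab (unlab l) = l" if "l \<in> labels M" for l
    using that bij_betw_inv_into_right[OF lab that] bij_betwE[OF bij_betw_inv_into[OF lab]] unfolding unlab_def by auto
  have lm: "lab s \<in> labels M" if "s < m" for s using bij_betwE[OF lab] that by blast
  define H where "H = (\<lambda>s t. hrel (lab s) (lab t))"
  define V where "V = (\<lambda>s t. vrel M (lab s) (lab t))"
  define A where "A = (\<lambda>c. {s. s < m \<and> admissible M c (lab s)})"
  have "(\<exists>f. tableau M e n u f) \<longleftrightarrow>
      (\<exists>s. label_tiling m H V (u + 2) (tableau_width e n u) (\<lambda>i j. A (tableau_cell e n u i j)) s)" for e n u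
  proof
    assume "\<exists>f. tableau M e n u f"
    then obtain f where f: "tableau M e n u f" by blast
    note F = f[unfolded tableau_def, rule_format]
    have "label_tiling m H V (u + 2) (tableau_width e n u) (\<lambda>i j. A (tableau_cell e n u i j)) (\<lambda>i j. unlab (f i j))"
      unfolding label_tiling_def
    proof (intro allI impI)
      fix i j assume i: "i < u + 2" and j: "j < tableau_width e n u"
      have l: "f i j \<in> labels M" using F[OF i j] by blast
      have "H (unlab (f i j)) (unlab (f i (Suc j)))" if "Suc j < tableau_width e n u"
        using F[OF i j] F[OF i that] ul that unfolding H_def by auto
      moreover have "V (unlab (f i j)) (unlab (f (Suc i) j))" if "Suc i < u + 2"
        using F[OF i j] F[OF that j] ul that unfolding V_def by auto
      moreover have "unlab (f i j) < m" "unlab (f i j) \<in> A (tableau_cell e n u i j)"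
        using ul[OF l] F[OF i j] unfolding A_def by auto
      ultimately show "unlab (f i j) < m \<and> unlab (f i j) \<in> A (tableau_cell e n u i j) \<and>
          (Suc j < tableau_width e n u \<longrightarrow> H (unlab (f i j)) (unlab (f i (Suc j)))) \<and>
          (Suc i < u + 2 \<longrightarrow> V (unlab (f i j)) (unlab (f (Suc i) j)))" by blast
    qed
    then show "\<exists>s. label_tiling m H V (u + 2) (tableau_width e n u) (\<lambda>i j. A (tableau_cell e n u i j)) s" by blast
  next
    assume "\<exists>s. label_tiling m H V (u + 2) (tableau_width e n u) (\<lambda>i j. A (tableau_cell e n u i j)) s"
    then obtain s where s: "label_tiling m H V (u + 2) (tableau_width e n u) (\<lambda>i j. A (tableau_cell e n u i j)) s" by blast
    note S = s[unfolded label_tiling_def, rule_format]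
    have "tableau M e n u (\<lambda>i j. lab (s i j))"
      unfolding tableau_def
    proof (intro allI impI)
      fix i j assume i: "i < u + 2" and j: "j < tableau_width e n u"
      show "lab (s i j) \<in> labels M \<and> admissible M (tableau_cell e n u i j) (lab (s i j)) \<and>
        (Suc j < tableau_width e n u \<longrightarrow> hrel (lab (s i j)) (lab (s i (Suc j)))) \<and>
        (Suc i < u + 2 \<longrightarrow> vrel M (lab (s i j)) (lab (s (Suc i) j)))"
        using S[OF i j] lm unfolding H_def V_def A_def by blast
    qed
    then show "\<exists>f. tableau M e n u f" by blast
  qed
  with tab show thesis using that[of m H V U p A] by blast
qed

section \<open>Serialising the graph\<close>

lemma concat_grid:
  "concat (map (\<lambda>i. map (f i) [0..<n]) [0..<m]) = map (\<lambda>k. f (k div n) (k mod n)) [0..<m * n]"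
proof (induction m)
  case (Suc m)
  have "[0..<Suc m * n] = [0..<m * n] @ [m * n..<m * n + n]"
    using upt_add_eq_append[of 0 "m * n" n] by (simp add: add.commute)
  moreover have "[m * n..<m * n + n] = map (\<lambda>j. m * n + j) [0..<n]"
    by (rule nth_equalityI) simp_all
  ultimately show ?case using Suc by (auto simp: comp_def)
qed simp

lemma concat_group:
  "concat (map f [0..<m * n]) = concat (map (\<lambda>i. concat (map (\<lambda>j. f (i * n + j)) [0..<n])) [0..<m])"
proof (induction m)
  case (Suc m)
  have "[0..<Suc m * n] = [0..<m * n] @ [m * n..<m * n + n]"
    using upt_add_eq_append[of 0 "m * n" n] by (simp add: add.commute)
  moreover have "[m * n..<m * n + n] = map (\<lambda>j. m * n + j) [0..<n]"
    by (rule nth_equalityI) simp_all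
  ultimately show ?case using Suc by (simp add: comp_def)
qed simp

lemma map_upt_const: "(\<And>k. a \<le> k \<Longrightarrow> k < b \<Longrightarrow> f k = c) \<Longrightarrow> map f [a..<b] = replicate (b - a) c"
  by (intro nth_equalityI) auto

text \<open>The 19 entries of a matrix row at column offsets -9 to 9: at both ends the horizontal
  links, which join slots 0 only, and between them the offsets -8 to 8, where \<open>e\<close>
  stands for offset \<open>e - 9\<close>.\<close>

definition site_mid :: "nat \<Rightarrow> bool \<Rightarrow> bool \<Rightarrow> nat \<Rightarrow> bool list" where
  "site_mid l left right s = (s = 0 \<and> left) #
     map (\<lambda>e. 9 \<le> s + e \<and> s + e < 18 \<and> slot_adj l s (s + e - 9)) [1..<18] @ [s = 0 \<and> right]"

lemma upt_split: "a \<le> b \<Longrightarrow> b \<le> c \<Longrightarrow> [a..<c] = [a..<b] @ [b..<c]"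
  using upt_add_eq_append[of a b "c - b"] by simp

lemma div_mod_eqI: "k = u * N + e \<Longrightarrow> e < N \<Longrightarrow> k div N = (u :: nat) \<and> k mod N = e"
  by simp

text \<open>
  Reading the adjacency matrix in rows of length one more than the number of vertices aligns its
  diagonals, so that the entries of a banded matrix sit at fixed positions of each row.
\<close>

definition band :: "nat \<Rightarrow> nat \<Rightarrow> (nat \<Rightarrow> nat \<Rightarrow> bool) \<Rightarrow> nat \<Rightarrow> nat \<Rightarrow> bool" where
  "band N d P u e \<longleftrightarrow> d \<le> u + e \<and> u + e - d < N \<and> P u (u + e - d)"

definition chunk :: "nat \<Rightarrow> nat \<Rightarrow> (nat \<Rightarrow> nat \<Rightarrow> bool) \<Rightarrow> nat \<Rightarrow> bool list" where
  "chunk N d P u = map (band N d P u) [0..<Suc N]"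

definition cut_chunk :: "nat \<Rightarrow> nat \<Rightarrow> (nat \<Rightarrow> nat \<Rightarrow> bool) \<Rightarrow> nat \<Rightarrow> bool list" where
  "cut_chunk N d P u =
     (if u = 0 then drop d (chunk N d P u) else if Suc u = N then take (Suc d) (chunk N d P u) else chunk N d P u)"

text \<open>With \<open>k = a * N + b\<close> one has
  \<open>k + d = a * Suc N + (b + d - a)\<close>. If \<open>b + d - a\<close> leaves the range from
  0 to \<open>N\<close>, the quotient spills over to a neighbouring row, but then \<open>a\<close>
  and \<open>b\<close> differ by more than \<open>d\<close>, and both sides are false.\<close>

lemma matrix_band:
  assumes nD: "2 * d \<le> N" and d1: "1 \<le> d" and dist: "\<And>a b. P a b \<Longrightarrow> b \<le> a + d \<and> a \<le> b + d"
    and k: "k < N * N"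
  shows "P (k div N) (k mod N) = band N d P ((k + d) div Suc N) ((k + d) mod Suc N)"
proof -
  define a b where "a = k div N" and "b = k mod N"
  have kab: "k = a * N + b" unfolding a_def b_def by (simp only: div_mult_mod_eq)
  have N0: "0 < N" using nD d1 by linarith
  have b: "b < N" using N0 unfolding b_def by simp
  have a: "a < N" using k unfolding a_def by (simp add: less_mult_imp_div_less)
  note dist = dist[of a b]
  consider "a \<le> b + d" "b + d - a \<le> N" | "b + d < a" | "a \<le> b + d" "N < b + d - a" by linarith
  then have "P a b = band N d P ((k + d) div Suc N) ((k + d) mod Suc N)"
  proof cases
    case 1
    have "k + d = a * Suc N + (b + d - a)" using 1 kab by simp
    then have "(k + d) div Suc N = a \<and> (k + d) mod Suc N = b + d - a" by (rule div_mod_eqI) (use 1 in simp)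
    then show ?thesis using 1 b by (simp add: band_def)
  next
    case 2
    obtain a' where a': "a = Suc a'" using 2 by (cases a) auto
    have "k + d = a' * Suc N + (Suc N + b + d - a)" using 2 kab a a' by simp
    then have *: "(k + d) div Suc N = a' \<and> (k + d) mod Suc N = Suc N + b + d - a" by (rule div_mod_eqI) (use 2 in simp)
    have "a' + (Suc N + b + d - a) - d = N + b" using a' a by simp
    then have "\<not> band N d P a' (Suc N + b + d - a)" unfolding band_def by simp
    moreover have "\<not> P a b" using dist 2 by linarith
    ultimately show ?thesis using * by simp
  next
    case 3
    have "k + d = Suc a * Suc N + (b + d - a - Suc N)" using 3 kab by simp
    then have *: "(k + d) div Suc N = Suc a \<and> (k + d) mod Suc N = b + d - a - Suc N"
      by (rule div_mod_eqI) (use 3 b nD in linarith)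
    have "Suc a + (b + d - a - Suc N) < d" using 3 b by linarith
    then have "\<not> band N d P (Suc a) (b + d - a - Suc N)" unfolding band_def by linarith
    moreover have "\<not> P a b" using dist 3 nD by linarith
    ultimately show ?thesis using * by simp
  qed
  then show ?thesis by (simp add: a_def b_def)
qed

text \<open>The alignment shifts the matrix by \<open>d\<close>, so the first \<open>d\<close> and
  the last \<open>N - d\<close> entries of the aligned stream do not belong to it; they lie in the
  first and in the last chunk.\<close>

lemma matrix_chunks:
  assumes nD: "2 * d \<le> N" and d1: "2 \<le> d" and dist: "\<And>a b. P a b \<Longrightarrow> b \<le> a + d \<and> a \<le> b + d"
  shows "concat (map (\<lambda>u. map (P u) [0..<N]) [0..<N]) = concat (map (cut_chunk N d P) [0..<N])"
proof -
  let ?B = "\<lambda>k. band N d P (k div Suc N) (k mod Suc N)"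
  have "concat (map (\<lambda>u. map (P u) [0..<N]) [0..<N]) = map (\<lambda>k. P (k div N) (k mod N)) [0..<N * N]" by (rule concat_grid)
  also have "\<dots> = map (\<lambda>k. ?B (d + k)) [0..<N * N]"
  proof (rule map_cong[OF refl])
    fix k assume "k \<in> set [0..<N * N]"
    then have k: "k < N * N" by simp
    show "P (k div N) (k mod N) = ?B (d + k)"
      using matrix_band[OF nD _ dist k] le_trans[OF one_le_numeral d1] by (simp only: add.commute[of d k])
  qed
  also have "\<dots> = take (N * N) (drop d (map ?B [0..<N * Suc N]))"
  proof -
    have le: "d + N * N \<le> N * Suc N" using nD by simp
    have "drop d [0..<N * Suc N] = [d..<N * Suc N]" by simp
    moreover have "take (N * N) [d..<N * Suc N] = [d..<d + N * N]" using le by (rule take_upt)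
    moreover have "[d..<d + N * N] = map (\<lambda>k. d + k) [0..<N * N]" by (rule nth_equalityI) simp_all
    ultimately show ?thesis by (simp only: drop_map take_map map_map comp_def)
  qed
  also have "map ?B [0..<N * Suc N] = concat (map (chunk N d P) [0..<N])"
    unfolding chunk_def by (rule concat_grid[symmetric])
  also have "take (N * N) (drop d (concat (map (chunk N d P) [0..<N]))) = concat (map (cut_chunk N d P) [0..<N])"
  proof -
    obtain r where n2: "N = Suc (Suc r)"
    proof -
      have "2 \<le> N" using nD d1 by linarith
      then show thesis using that[of "N - 2"] by simp
    qed
    let ?m = "map Suc [0..<r]"
    have spl: "[0..<N] = 0 # ?m @ [Suc r]" unfolding n2 by (simp add: upt_conv_Cons map_Suc_upt)
    have lc: "length (chunk N d P u) = Suc N" for u by (simp add: chunk_def)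
    define mid where "mid = concat (map (chunk N d P) ?m)"
    have lm: "length mid = r * Suc N"
      unfolding mid_def by (simp only: length_concat map_map comp_def lc sum_list_triv length_map length_upt) simp
    have 1: "concat (map (chunk N d P) [0..<N]) = chunk N d P 0 @ mid @ chunk N d P (Suc r)" unfolding spl mid_def by simp
    have Dn: "d \<le> Suc N" using nD by linarith
    have 2: "drop d (concat (map (chunk N d P) [0..<N])) = (drop d (chunk N d P 0) @ mid) @ chunk N d P (Suc r)"
      unfolding 1 using Dn by (simp only: drop_append lc append_assoc) simp
    have "length (drop d (chunk N d P 0) @ mid) = Suc N - d + r * Suc N" by (simp only: length_append length_drop lc lm)
    also have "\<dots> + Suc d = N * N"
    proof -
      have "N * N = (r + 2) * N" using n2 by simp
      also have "\<dots> = r * Suc N + (N + 2)" using n2 by (simp add: algebra_simps)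
      finally show ?thesis using nD by simp
    qed
    finally have l3: "length (drop d (chunk N d P 0) @ mid) + Suc d = N * N" .
    have 3: "take (N * N) (drop d (concat (map (chunk N d P) [0..<N]))) =
        (drop d (chunk N d P 0) @ mid) @ take (Suc d) (chunk N d P (Suc r))"
      unfolding 2 l3[symmetric] by (simp only: take_append) simp
    have "map (cut_chunk N d P) ?m = map (chunk N d P) ?m"
      by (rule map_cong[OF refl]) (auto simp: cut_chunk_def n2)
    moreover have "cut_chunk N d P 0 = drop d (chunk N d P 0)" "cut_chunk N d P (Suc r) = take (Suc d) (chunk N d P (Suc r))"
      unfolding cut_chunk_def using n2 by simp_all
    ultimately have "concat (map (cut_chunk N d P) [0..<N]) = (drop d (chunk N d P 0) @ mid) @ take (Suc d) (chunk N d P (Suc r))"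
      unfolding spl mid_def by (simp only: list.map map_append concat.simps concat_append append_assoc) simp
    then show ?thesis using 3 by simp
  qed
  finally show ?thesis .
qed

text \<open>The pieces are the upward link, a gap of length \<open>z1\<close>, the offsets -9 to 9,
  a second such gap, the downward link and \<open>z2\<close> entries beyond. The cuts at 9 and 10
  keep the first row from its diagonal entry on and the last row up to its diagonal entry.\<close>

definition chunk_pieces :: "bool \<Rightarrow> bool \<Rightarrow> nat \<Rightarrow> bool \<Rightarrow> bool \<Rightarrow> bool \<Rightarrow> bool \<Rightarrow> nat \<Rightarrow> nat \<Rightarrow> nat \<Rightarrow> bool list" where
  "chunk_pieces bef aft l up left right down z1 z2 s =
     (if bef \<and> s = 0 then drop 9 (site_mid l left right s)
      else [s = 0 \<and> up] @ replicate z1 False @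
        (if aft \<and> s = 8 then take 10 (site_mid l left right s) else site_mid l left right s)) @
     (if aft \<and> s = 8 then [] else replicate z1 False @ [s = 0 \<and> down] @ replicate z2 False)"

section \<open>Rows of the adjacency matrix of a picture\<close>

context picture
begin

lemma adj_dist: "adj u v \<Longrightarrow> v = u + 9 * B \<or> u = v + 9 * B \<or> (v \<le> u + 9 \<and> u \<le> v + 9)"
proof (erule adj_cases)
  assume "u div 9 = v div 9"
  then show ?thesis by linarith
next
  assume "u mod 9 = 0" "v mod 9 = 0" "link (u div 9) (v div 9)"
  then have "u = 9 * (u div 9)" "v = 9 * (v div 9)" "v div 9 = u div 9 + 1 \<or> v div 9 = u div 9 + B"
    unfolding link_def by auto
  then show ?thesis by (metis distrib_left le_add1 mult.right_neutral order_refl trans_le_add1)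
next
  assume "u mod 9 = 0" "v mod 9 = 0" "link (v div 9) (u div 9)"
  then have "u = 9 * (u div 9)" "v = 9 * (v div 9)" "u div 9 = v div 9 + 1 \<or> u div 9 = v div 9 + B"
    unfolding link_def by auto
  then show ?thesis by (metis distrib_left le_add1 mult.right_neutral order_refl trans_le_add1)
qed

lemma adj_slots:
  assumes "s < 9" "t < 9"
  shows "adj (g * 9 + s) (h * 9 + t) \<longleftrightarrow> g = h \<and> slot_adj (slv (st g)) s t \<or> s = 0 \<and> t = 0 \<and> (link g h \<or> link h g)"
  using assms by (simp add: adj_def)

text \<open>By \<open>adj_dist\<close>, adjacent vertices have offset -D, D or one between -9 and 9.
  The condition \<open>2 \<le> B\<close> keeps these three ranges apart, and
  \<open>2 \<le> A\<close> makes a row long enough to contain them.\<close>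

lemma chunk_site:
  assumes D: "D = 9 * B" and N: "N = 9 * (A * B)" and B2: "2 \<le> B" and A2: "2 \<le> A" and g: "g < A * B" and s: "s < 9"
  shows "chunk N D adj (g * 9 + s) = [s = 0 \<and> B \<le> g \<and> sd (st (g - B))] @ replicate (D - 10) False @
     site_mid (slv (st g)) (1 \<le> g \<and> sr (st (g - 1))) (sr (st g)) s @ replicate (D - 10) False @
     [s = 0 \<and> sd (st g)] @ replicate (N - 2 * D) False"
proof -
  let ?u = "g * 9 + s"
  have "2 * B \<le> A * B" using A2 by (rule mult_le_mono1)
  then have nD: "2 * D \<le> N" unfolding D N by linarith
  have D18: "18 \<le> D" using B2 D by linarith
  have spl: "[0..<Suc N] = [0] @ [1..<D - 9] @ [D - 9..<D + 10] @ [D + 10..<2 * D] @ [2 * D] @ [Suc (2 * D)..<Suc N]"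
  proof -
    have "[0..<Suc N] = [0] @ [1..<Suc N]" by (simp add: upt_conv_Cons)
    also have "[1..<Suc N] = [1..<D - 9] @ [D - 9..<Suc N]" using upt_split[of 1 "D - 9" "Suc N"] D18 nD by simp
    also have "[D - 9..<Suc N] = [D - 9..<D + 10] @ [D + 10..<Suc N]" using upt_split[of "D - 9" "D + 10" "Suc N"] D18 nD by simp
    also have "[D + 10..<Suc N] = [D + 10..<2 * D] @ [2 * D..<Suc N]" using upt_split[of "D + 10" "2 * D" "Suc N"] D18 nD by simp
    also have "[2 * D..<Suc N] = [2 * D] @ [Suc (2 * D)..<Suc N]" using nD by (simp add: upt_conv_Cons)
    finally show ?thesis by simp
  qed
  have far: "\<not> band N D adj ?u e" if "e \<noteq> 0" "e \<noteq> 2 * D" "e < D - 9 \<or> D + 9 < e" for e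
  proof
    assume b: "band N D adj ?u e"
    then have "D \<le> ?u + e" and a: "adj ?u (?u + e - D)" by (simp_all add: band_def)
    then show False using adj_dist[OF a] that D18 unfolding D[symmetric] by linarith
  qed
  have nolink: "\<not> link g g" "link h g \<longleftrightarrow> h + 1 = g \<and> sr (st h) \<or> h + B = g \<and> sd (st h)" for h
    using B2 by (auto simp: link_def)
  have b0: "band N D adj ?u 0 = (s = 0 \<and> B \<le> g \<and> sd (st (g - B)))"
  proof (cases "B \<le> g")
    case True
    define h where "h = g - B"
    have gh: "g = h + B" using True by (simp add: h_def)
    have v: "?u - D = h * 9 + s" "D \<le> ?u" "h * 9 + s < N" using gh g s D N by linarith+
    have "adj ?u (h * 9 + s) \<longleftrightarrow> s = 0 \<and> sd (st h)"
      using adj_slots[OF s s, of g h] gh B2 by (auto simp: link_def)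
    then show ?thesis using v gh by (simp add: band_def)
  next
    case False
    then have "\<not> D \<le> ?u" using s D by linarith
    then show ?thesis using False by (simp add: band_def)
  qed
  have b2: "band N D adj ?u (2 * D) = (s = 0 \<and> sd (st g))"
  proof -
    have v: "?u + 2 * D - D = (g + B) * 9 + s" "D \<le> ?u + 2 * D" unfolding add_mult_distrib using D by linarith+
    have "adj ?u ((g + B) * 9 + s) \<longleftrightarrow> s = 0 \<and> sd (st g)"
      using adj_slots[OF s s, of g "g + B"] B2 by (auto simp: link_def)
    moreover have "(g + B) * 9 + s < N" if "s = 0" "sd (st g)"
      proof -
        have "link g (g + B)" using that by (simp add: link_def)
        then have "g + B < A * B" using st_link_cases[OF g] by blast
        then show ?thesis using that unfolding N add_mult_distrib by linarith
      qed
    ultimately show ?thesis unfolding band_def v(1) using v(2) by auto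
  qed
  have mid: "map (band N D adj ?u) [D - 9..<D + 10] = site_mid (slv (st g)) (1 \<le> g \<and> sr (st (g - 1))) (sr (st g)) s"
  proof -
    have "[D - 9..<D + 10] = map (\<lambda>e. D - 9 + e) [0..<19]" by (rule nth_equalityI) (use D18 in simp_all)
    also have "[0..<19] = 0 # [1..<18] @ [18]" by (simp add: upt_rec)
    finally have l: "map (band N D adj ?u) [D - 9..<D + 10] =
        band N D adj ?u (D - 9) # map (\<lambda>e. band N D adj ?u (D - 9 + e)) [1..<18] @ [band N D adj ?u (D - 9 + 18)]" by simp
    have e0: "band N D adj ?u (D - 9) = (s = 0 \<and> 1 \<le> g \<and> sr (st (g - 1)))"
    proof (cases "1 \<le> g")
      case True
      define h where "h = g - 1"
      have gh: "g = h + 1" using True by (simp add: h_def)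
      have v: "?u + (D - 9) - D = h * 9 + s" "D \<le> ?u + (D - 9)" "h * 9 + s < N" using gh g s D18 D N by linarith+
      have "adj ?u (h * 9 + s) \<longleftrightarrow> s = 0 \<and> sr (st h)"
        using adj_slots[OF s s, of g h] gh B2 by (auto simp: link_def)
      then show ?thesis using v gh by (simp add: band_def)
    next
      case False
      then have "\<not> D \<le> ?u + (D - 9)" using s D18 by linarith
      then show ?thesis using False by (simp add: band_def)
    qed
    have e18: "band N D adj ?u (D - 9 + 18) = (s = 0 \<and> sr (st g))"
    proof -
      have v: "?u + (D - 9 + 18) - D = (g + 1) * 9 + s" "D \<le> ?u + (D - 9 + 18)" unfolding add_mult_distrib using D18 by linarith+
      have "adj ?u ((g + 1) * 9 + s) \<longleftrightarrow> s = 0 \<and> sr (st g)"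
        using adj_slots[OF s s, of g "g + 1"] B2 by (auto simp: link_def)
      moreover have "(g + 1) * 9 + s < N" if "s = 0" "sr (st g)"
        proof -
        have "link g (g + 1)" using that by (simp add: link_def)
        then have "g + 1 < A * B" using st_link_cases[OF g] by blast
        then show ?thesis using that unfolding N add_mult_distrib by linarith
      qed
      ultimately show ?thesis unfolding band_def v(1) using v(2) by auto
    qed
    have em: "band N D adj ?u (D - 9 + e) = (9 \<le> s + e \<and> s + e < 18 \<and> slot_adj (slv (st g)) s (s + e - 9))"
      if e: "1 \<le> e" "e < 18" for e
    proof -
      consider "9 \<le> s + e" "s + e < 18" | "s + e < 9" | "18 \<le> s + e" by linarith
      then show ?thesis
      proof cases
        case 1
        have v: "?u + (D - 9 + e) - D = g * 9 + (s + e - 9)" "D \<le> ?u + (D - 9 + e)" using 1 D18 by linarith+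
        have t: "s + e - 9 < 9" using 1 by linarith
        have "g * 9 + (s + e - 9) < N" using g t N by linarith
        then show ?thesis unfolding band_def v(1) using v(2) adj_slots[OF s t, of g g] nolink 1 by auto
      next
        case 2
        have "\<not> (D \<le> ?u + (D - 9 + e) \<and> adj ?u (?u + (D - 9 + e) - D))"
        proof (cases g)
          case 0
          then show ?thesis using 2 D18 e by linarith
        next
          case (Suc h)
          have v: "?u + (D - 9 + e) - D = h * 9 + (s + e)" using Suc D18 by linarith
          have t: "s + e < 9" using 2 .
          show ?thesis unfolding v using adj_slots[OF s t, of g h] Suc e by auto
        qed
        then show ?thesis using 2 by (auto simp: band_def)
      next
        case 3
        have v: "?u + (D - 9 + e) - D = (g + 1) * 9 + (s + e - 18)" unfolding add_mult_distrib using 3 D18 by linarith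
        have t: "s + e - 18 < 9" using s e by linarith
        have "s \<noteq> 0" using 3 e by linarith
        then have "\<not> adj ?u ((g + 1) * 9 + (s + e - 18))" using adj_slots[OF s t, of g "g + 1"] by auto
        then show ?thesis unfolding band_def v using 3 by auto
      qed
    qed
    have "map (\<lambda>e. band N D adj ?u (D - 9 + e)) [1..<18] = map (\<lambda>e. 9 \<le> s + e \<and> s + e < 18 \<and> slot_adj (slv (st g)) s (s + e - 9)) [1..<18]"
      by (rule map_cong[OF refl]) (use em in auto)
    then show ?thesis unfolding l e0 e18 site_mid_def by simp
  qed
  have z1: "map (band N D adj ?u) [1..<D - 9] = replicate (D - 10) False"
  proof -
    have "map (band N D adj ?u) [1..<D - 9] = replicate (D - 9 - 1) False"
      by (rule map_upt_const) (use far D18 in auto)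
    then show ?thesis by simp
  qed
  have z2: "map (band N D adj ?u) [D + 10..<2 * D] = replicate (D - 10) False"
  proof -
    have "map (band N D adj ?u) [D + 10..<2 * D] = replicate (2 * D - (D + 10)) False"
      by (rule map_upt_const) (use far D18 in auto)
    then show ?thesis by simp
  qed
  have z3: "map (band N D adj ?u) [Suc (2 * D)..<Suc N] = replicate (N - 2 * D) False"
  proof -
    have "map (band N D adj ?u) [Suc (2 * D)..<Suc N] = replicate (Suc N - Suc (2 * D)) False"
      by (rule map_upt_const) (use far D18 in auto)
    then show ?thesis by simp
  qed
  show ?thesis unfolding chunk_def spl map_append z1 z2 z3 mid by (simp add: b0 b2)
qed

lemma cut_chunk_site:
  assumes D: "D = 9 * B" and N: "N = 9 * (A * B)" and B2: "2 \<le> B" and A2: "2 \<le> A" and g: "g < A * B" and s: "s < 9"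
  shows "cut_chunk N D adj (g * 9 + s) = chunk_pieces (g = 0) (Suc g = A * B) (slv (st g)) (B \<le> g \<and> sd (st (g - B)))
    (1 \<le> g \<and> sr (st (g - 1))) (sr (st g)) (sd (st g)) (D - 10) (N - 2 * D) s"
proof -
  have D18: "18 \<le> D" using B2 D by linarith
  have lm: "length (site_mid l a b s) = 19" for l a b by (simp add: site_mid_def)
  have u0: "(g * 9 + s = 0) = (g = 0 \<and> s = 0)" by simp
  have "A * B \<ge> 4" using mult_le_mono[OF A2 B2] by simp
  have un: "(Suc (g * 9 + s) = N) = (Suc g = A * B \<and> s = 8)" using g s unfolding N by linarith
  consider "g = 0" "s = 0" | "Suc g = A * B" "s = 8" | "\<not> (g = 0 \<and> s = 0)" "\<not> (Suc g = A * B \<and> s = 8)" by blast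
  then show ?thesis
  proof cases
    case 1
    have "drop D ([x] @ replicate (D - 10) False @ m @ r) = drop 9 m @ r" if "length m = 19" for x m and r :: "bool list"
    proof -
      have "drop D ([x] @ replicate (D - 10) False @ m @ r) = drop (D - length ([x] @ replicate (D - 10) False)) (m @ r)"
        using D18 by (subst append_assoc[symmetric], subst drop_append) simp
      also have "D - length ([x] @ replicate (D - 10) False) = 9" using D18 by simp
      finally show ?thesis using that by simp
    qed
    then show ?thesis unfolding cut_chunk_def u0 un chunk_site[OF D N B2 A2 g s] chunk_pieces_def using 1 lm by simp
  next
    case 2
    have "take (Suc D) ([x] @ replicate (D - 10) False @ m @ r) = [x] @ replicate (D - 10) False @ take 10 m" if "length m = 19" for x m and r :: "bool list"
    proof -
      have "take (Suc D) (([x] @ replicate (D - 10) False) @ (m @ r)) =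
        [x] @ replicate (D - 10) False @ take (Suc D - length ([x] @ replicate (D - 10) False)) (m @ r)"
        using D18 by (subst take_append) simp
      also have "Suc D - length ([x] @ replicate (D - 10) False) = 10" using D18 by simp
      finally show ?thesis using that by simp
    qed
    then show ?thesis unfolding cut_chunk_def u0 un chunk_site[OF D N B2 A2 g s] chunk_pieces_def using 2 lm by simp
  next
    case 3
    then show ?thesis unfolding cut_chunk_def u0 un chunk_site[OF D N B2 A2 g s] chunk_pieces_def by auto
  qed
qed

text \<open>Everything is expressed site by site in reading order, from data at the site and at its
  left and upper neighbours and from two common gap lengths; this is the form that append-only loops
  can produce.\<close>

theorem encode_graph:
  assumes B2: "2 \<le> B" and A2: "2 \<le> A"
  shows "encode_instance graph col budget =
    concat (map (\<lambda>g. replicate 9 True) [0..<A * B]) @ [False] @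
    concat (map (\<lambda>g. concat (map (chunk_pieces (g = 0) (Suc g = A * B) (slv (st g)) (B \<le> g \<and> sd (st (g - B)))
      (1 \<le> g \<and> sr (st (g - 1))) (sr (st g)) (sd (st g)) (9 * B - 10) (9 * (A * B) - 2 * (9 * B))) [0..<9])) [0..<A * B]) @
    concat (map (\<lambda>g. concat (map (\<lambda>s. replicate (slot_col (st g) s) True @ [False]) [0..<9])) [0..<A * B]) @
    binary_word budget"
proof -
  define N D where "N = 9 * (A * B)" and "D = 9 * B"
  have c: "card (pverts graph) = N" by (simp add: N_def)
  have N9: "A * B * 9 = N" by (simp add: N_def)
  have le: "2 * D \<le> N" "2 \<le> D" using mult_le_mono1[OF A2, of B] B2 unfolding N_def D_def by linarith+
  have 1: "replicate N True = concat (map (\<lambda>g. replicate 9 True) [0..<A * B])"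
  proof -
    have "concat (map (\<lambda>g. replicate 9 True) [0..<k]) = replicate (9 * k) True" for k
      by (induction k) (simp_all add: replicate_add[symmetric] add.commute )
    then show ?thesis unfolding N_def by (rule sym)
  qed
  have 2: "concat (map (\<lambda>u. map (\<lambda>v. (u, v) \<in> parcs graph) [0..<N]) [0..<N]) =
    concat (map (\<lambda>g. concat (map (chunk_pieces (g = 0) (Suc g = A * B) (slv (st g)) (B \<le> g \<and> sd (st (g - B)))
      (1 \<le> g \<and> sr (st (g - 1))) (sr (st g)) (sd (st g)) (D - 10) (N - 2 * D)) [0..<9])) [0..<A * B])"
  proof -
    have "concat (map (\<lambda>u. map (\<lambda>v. (u, v) \<in> parcs graph) [0..<N]) [0..<N]) = concat (map (\<lambda>u. map (adj u) [0..<N]) [0..<N])"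
      by (intro arg_cong[of _ _ concat] map_cong refl) (simp only: parcs_graph N_def[symmetric] set_upt atLeastLessThan_iff simp_thms)
    also have "\<dots> = concat (map (cut_chunk N D adj) [0..<N])"
    proof (rule matrix_chunks[OF le])
      show "b \<le> a + D \<and> a \<le> b + D" if "adj a b" for a b using adj_dist[OF that] B unfolding D_def by linarith
    qed
    also have "\<dots> = concat (map (\<lambda>g. concat (map (\<lambda>s. cut_chunk N D adj (g * 9 + s)) [0..<9])) [0..<A * B])"
      using concat_group[of "cut_chunk N D adj" "A * B" 9] unfolding N9 .
    also have "\<dots> = concat (map (\<lambda>g. concat (map (chunk_pieces (g = 0) (Suc g = A * B) (slv (st g)) (B \<le> g \<and> sd (st (g - B)))
      (1 \<le> g \<and> sr (st (g - 1))) (sr (st g)) (sd (st g)) (D - 10) (N - 2 * D)) [0..<9])) [0..<A * B])"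
      by (intro arg_cong[of _ _ concat] map_cong refl)
        (simp only: cut_chunk_site[OF D_def N_def B2 A2] set_upt atLeastLessThan_iff)
    finally show ?thesis .
  qed
  have 3: "concat (map (\<lambda>v. replicate (col v) True @ [False]) [0..<N]) =
    concat (map (\<lambda>g. concat (map (\<lambda>s. replicate (slot_col (st g) s) True @ [False]) [0..<9])) [0..<A * B])"
  proof -
    have "concat (map (\<lambda>v. replicate (col v) True @ [False]) [0..<N]) =
      concat (map (\<lambda>g. concat (map (\<lambda>s. replicate (col (g * 9 + s)) True @ [False]) [0..<9])) [0..<A * B])"
      using concat_group[of "\<lambda>v. replicate (col v) True @ [False]" "A * B" 9] unfolding N9 .
    also have "\<dots> = concat (map (\<lambda>g. concat (map (\<lambda>s. replicate (slot_col (st g) s) True @ [False]) [0..<9])) [0..<A * B])"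
      by (intro arg_cong[of _ _ concat] map_cong refl) (simp only: col_site set_upt atLeastLessThan_iff)
    finally show ?thesis .
  qed
  show ?thesis unfolding encode_instance_def Let_def c 1 2 3 by (simp only: D_def N_def append_assoc)
qed

end

section \<open>Composing polynomial-time programs\<close>

lemma finite_regs: "finite (regs c)"
  by (induction c) auto

lemma length_binary_inc: "length (binary_inc xs) \<le> Suc (length xs)"
  by (induction xs rule: binary_inc.induct) auto

lemma inc_time_le: "inc_time xs \<le> length xs + 1"
  by (induction xs rule: inc_time.induct) auto

text \<open>Each step lengthens a register by at most one symbol, so time bounds growth; this lets
  the time bounds of sequences compose.\<close>

lemma length_exec: "length (exec c \<sigma> i) \<le> length (\<sigma> i) + time c \<sigma>"
proof (induction c arbitrary: \<sigma>)
  case (Incr j)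
  then show ?case using length_binary_inc[of "\<sigma> j"] by (simp add: le_SucI)
next
  case (Seq c d)
  show ?case using Seq.IH(1)[of \<sigma>] Seq.IH(2)[of "exec c \<sigma>"] by simp
next
  case (For j b)
  have "length (fold (\<lambda>a. exec (b a)) xs s i) \<le>
      length (s i) + fold_time (\<lambda>a. exec (b a)) (\<lambda>a. time (b a)) xs s" for xs s
  proof (induction xs arbitrary: s)
    case (Cons a xs)
    have "length (exec (b a) s i) \<le> length (s i) + time (b a) s" using For.IH[of "b a"] by blast
    then show ?case using Cons.IH[of "exec (b a) s"] by simp
  qed simp
  from this[of "\<sigma> j" \<sigma>] show ?case by simp
qed auto

text \<open>The bound is in terms of the longest register rather than the input, as a later command
  runs on what earlier ones have produced.\<close>

definition polytime :: "cmd \<Rightarrow> bool" where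
  "polytime c \<longleftrightarrow> wf_cmd c \<and>
     (\<exists>K d. \<forall>\<sigma> Z. (\<forall>i. length (\<sigma> i) \<le> Z) \<longrightarrow> time c \<sigma> \<le> K * (Z + 1) ^ d)"

lemma polytime_computable_program:
  assumes "polytime c" and "\<And>x. exec c (init_regs x) 1 = map Bit (f x)"
  shows "polytime_computable f"
proof -
  from assms(1) obtain K d where wf: "wf_cmd c"
    and t: "\<And>\<sigma> Z. (\<And>i. length (\<sigma> i) \<le> Z) \<Longrightarrow> time c \<sigma> \<le> K * (Z + 1) ^ d" unfolding polytime_def by blast
  obtain R where R: "\<forall>i\<in>regs c. i < R" using finite_regs[of c] unfolding finite_nat_set_iff_bounded by blast
  have "time c (init_regs x) \<le> poly (smult K ([:1, 1:] ^ d)) (length x)" for x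
    using t[of "init_regs x" "length x"] by (simp add: init_regs_def poly_power add.commute)
  then show ?thesis using R
    by (intro polytime_computable_exec[OF wf _ _ assms(2), where R = "R + 2" and p = "smult K ([:1, 1:] ^ d)"]) fastforce+
qed

lemma power_bound_mono: "K \<le> K' \<Longrightarrow> d \<le> d' \<Longrightarrow> K * (Z + 1) ^ d \<le> K' * ((Z::nat) + 1) ^ d'"
  by (intro mult_le_mono power_increasing) auto

lemma polytime_Seq:
  assumes "polytime c" "polytime d"
  shows "polytime (Seq c d)"
proof -
  from assms obtain K k L l where wf: "wf_cmd c" "wf_cmd d"
    and c: "\<And>\<sigma> Z. (\<And>i. length (\<sigma> i) \<le> Z) \<Longrightarrow> time c \<sigma> \<le> K * (Z + 1) ^ k"
    and d: "\<And>\<sigma> Z. (\<And>i. length (\<sigma> i) \<le> Z) \<Longrightarrow> time d \<sigma> \<le> L * (Z + 1) ^ l" unfolding polytime_def by blast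
  \<comment> \<open>After \<open>c\<close>, one more than the length of a register is at most
    \<open>(K + 1) * (Z + 1) ^ (k + 1)\<close>; substituting this into the bound for
    \<open>d\<close> gives the exponent \<open>(k + 1) * l\<close>.\<close>
  have "time (Seq c d) \<sigma> \<le> (1 + K + L * (K + 1) ^ l) * (Z + 1) ^ (k + (k + 1) * l)" if Z: "\<And>i. length (\<sigma> i) \<le> Z" for \<sigma> Z
  proof -
    have tc: "time c \<sigma> \<le> K * (Z + 1) ^ k" using c Z by blast
    have 1: "length (exec c \<sigma> i) \<le> Z + K * (Z + 1) ^ k" for i using length_exec[of c \<sigma> i] Z[of i] tc by linarith
    have "Z + K * (Z + 1) ^ k + 1 \<le> (K + 1) * (Z + 1) ^ (k + 1)"
    proof -
      have "K * (Z + 1) ^ k \<le> K * (Z + 1) ^ (k + 1)" by (rule power_bound_mono) auto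
      moreover have "(Z + 1) ^ 1 \<le> (Z + 1) ^ (k + 1)" by (rule power_increasing) auto
      ultimately show ?thesis unfolding add_mult_distrib power_one_right by linarith
    qed
    then have "(Z + K * (Z + 1) ^ k + 1) ^ l \<le> ((K + 1) * (Z + 1) ^ (k + 1)) ^ l" by (rule power_mono) simp
    also have "\<dots> = (K + 1) ^ l * (Z + 1) ^ ((k + 1) * l)" by (simp only: power_mult_distrib power_mult)
    finally have "time d (exec c \<sigma>) \<le> L * ((K + 1) ^ l * (Z + 1) ^ ((k + 1) * l))"
      using d[OF 1] by (meson le_trans mult_le_mono2)
    also have "\<dots> = (L * (K + 1) ^ l) * (Z + 1) ^ ((k + 1) * l)" by (simp only: mult.assoc)
    also have "\<dots> \<le> (L * (K + 1) ^ l) * (Z + 1) ^ (k + (k + 1) * l)" by (rule power_bound_mono) auto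
    finally have td: "time d (exec c \<sigma>) \<le> (L * (K + 1) ^ l) * (Z + 1) ^ (k + (k + 1) * l)" .
    have "K * (Z + 1) ^ k \<le> K * (Z + 1) ^ (k + (k + 1) * l)" by (rule power_bound_mono) auto
    moreover have "1 \<le> (Z + 1) ^ (k + (k + 1) * l)" by simp
    ultimately have "1 + time c \<sigma> + time d (exec c \<sigma>) \<le> (1 + K + L * (K + 1) ^ l) * (Z + 1) ^ (k + (k + 1) * l)"
      using tc td unfolding add_mult_distrib by linarith
    then show ?thesis by simp
  qed
  then show ?thesis unfolding polytime_def using wf by (metis wf_cmd.simps(4))
qed

text \<open>
  The command only appends to register \<open>r\<close> and only reads the registers in \<open>I\<close>; this is what keeps
  nested loops polynomial.
\<close>

definition generates_within ::
    "cmd \<Rightarrow> nat \<Rightarrow> nat set \<Rightarrow> ((nat \<Rightarrow> sym list) \<Rightarrow> sym list) \<Rightarrow> nat \<Rightarrow> nat \<Rightarrow> bool" where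
  "generates_within c r I v K d \<longleftrightarrow> (\<forall>\<sigma> Z ys. (\<forall>i\<in>I. length (\<sigma> i) \<le> Z) \<longrightarrow>
     exec c (\<sigma>(r := ys)) = \<sigma>(r := ys @ v \<sigma>) \<and> time c (\<sigma>(r := ys)) \<le> K * (Z + 1) ^ d)"

definition generates :: "cmd \<Rightarrow> nat \<Rightarrow> nat set \<Rightarrow> ((nat \<Rightarrow> sym list) \<Rightarrow> sym list) \<Rightarrow> bool" where
  "generates c r I v \<longleftrightarrow> r \<notin> I \<and> wf_cmd c \<and> regs c \<subseteq> insert r I \<and> (\<exists>K d. generates_within c r I v K d)"

lemma generates_withinD:
  assumes "generates_within c r I v K d" "\<forall>i\<in>I. length (\<sigma> i) \<le> Z"
  shows "exec c (\<sigma>(r := ys)) = \<sigma>(r := ys @ v \<sigma>)" "time c (\<sigma>(r := ys)) \<le> K * (Z + 1) ^ d"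
  using assms unfolding generates_within_def by blast+

lemma generatesI:
  assumes "r \<notin> I" "wf_cmd c" "regs c \<subseteq> insert r I"
    and "\<And>\<sigma> Z ys. \<forall>i\<in>I. length (\<sigma> i) \<le> Z \<Longrightarrow>
      exec c (\<sigma>(r := ys)) = \<sigma>(r := ys @ v \<sigma>) \<and> time c (\<sigma>(r := ys)) \<le> K * (Z + 1) ^ d"
  shows "generates c r I v"
proof -
  have "generates_within c r I v K d" unfolding generates_within_def using assms(4) by blast
  then show ?thesis unfolding generates_def using assms(1-3) by blast
qed

lemma generates_mono:
  assumes "generates c r I v" "I \<subseteq> J" "r \<notin> J"
  shows "generates c r J v"
proof -
  from assms(1) obtain K d where c: "wf_cmd c" "regs c \<subseteq> insert r I" and w: "generates_within c r I v K d"
    unfolding generates_def by blast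
  show ?thesis
  proof (rule generatesI[OF assms(3) c(1)])
    show "regs c \<subseteq> insert r J" using c(2) assms(2) by blast
    fix \<sigma> :: "nat \<Rightarrow> sym list" and Z ys assume "\<forall>i\<in>J. length (\<sigma> i) \<le> Z"
    then have "\<forall>i\<in>I. length (\<sigma> i) \<le> Z" using assms(2) by blast
    from generates_withinD[OF w this] show "exec c (\<sigma>(r := ys)) = \<sigma>(r := ys @ v \<sigma>) \<and> time c (\<sigma>(r := ys)) \<le> K * (Z + 1) ^ d"
      by blast
  qed
qed

lemma generates_exec:
  assumes "generates c r I v" "finite I"
  shows "exec c \<sigma> = \<sigma>(r := \<sigma> r @ v \<sigma>)"
proof -
  from assms(1) obtain K d where w: "generates_within c r I v K d" unfolding generates_def by blast
  have "\<forall>i\<in>I. length (\<sigma> i) \<le> (\<Sum>i\<in>I. length (\<sigma> i))" using assms(2) by (intro ballI member_le_sum) auto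
  from generates_withinD(1)[OF w this, of "\<sigma> r"] show ?thesis by simp
qed

lemma generates_polytime:
  assumes "generates c r I v"
  shows "polytime c"
proof -
  from assms obtain K d where wf: "wf_cmd c" and w: "generates_within c r I v K d" unfolding generates_def by blast
  have "time c \<sigma> \<le> K * (Z + 1) ^ d" if "\<forall>i. length (\<sigma> i) \<le> Z" for \<sigma> Z
    using generates_withinD(2)[OF w, of \<sigma> Z "\<sigma> r"] that by simp
  then show ?thesis unfolding polytime_def using wf by blast
qed

lemma generates_Skip: "r \<notin> I \<Longrightarrow> generates Skip r I (\<lambda>_. [])"
  by (rule generatesI[where K = 1 and d = 0]) auto

lemma generates_App: "r \<notin> I \<Longrightarrow> generates (App r a) r I (\<lambda>_. [a])"
  by (rule generatesI[where K = 1 and d = 0]) auto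

lemma generates_Seq:
  assumes "generates c r I v" "generates d r I w"
  shows "generates (Seq c d) r I (\<lambda>\<sigma>. v \<sigma> @ w \<sigma>)"
proof -
  from assms obtain K k L l where c: "r \<notin> I" "wf_cmd c" "regs c \<subseteq> insert r I" and cw: "generates_within c r I v K k"
    and d: "wf_cmd d" "regs d \<subseteq> insert r I" and dw: "generates_within d r I w L l"
    unfolding generates_def by blast
  show ?thesis
  proof (rule generatesI[where K = "1 + K + L" and d = "k + l"])
    fix \<sigma> :: "nat \<Rightarrow> sym list" and Z ys assume Z: "\<forall>i\<in>I. length (\<sigma> i) \<le> Z"
    note 1 = generates_withinD[OF cw Z, of ys] and 2 = generates_withinD[OF dw Z, of "ys @ v \<sigma>"]
    have "K * (Z + 1) ^ k \<le> K * (Z + 1) ^ (k + l)" "L * (Z + 1) ^ l \<le> L * (Z + 1) ^ (k + l)" "1 \<le> (Z + 1) ^ (k + l)"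
      by (rule power_bound_mono; simp)+ simp
    then have "1 + time c (\<sigma>(r := ys)) + time d (\<sigma>(r := ys @ v \<sigma>)) \<le> (1 + K + L) * (Z + 1) ^ (k + l)"
      using 1(2) 2(2) unfolding add_mult_distrib by linarith
    then show "exec (Seq c d) (\<sigma>(r := ys)) = \<sigma>(r := ys @ v \<sigma> @ w \<sigma>) \<and>
      time (Seq c d) (\<sigma>(r := ys)) \<le> (1 + K + L) * (Z + 1) ^ (k + l)" using 1(1) 2(1) by simp
  qed (use c d in auto)
qed

text \<open>The body reads only registers in \<open>J\<close>, which it leaves unchanged, so every
  iteration obeys the same bound and the total is a product; the growing output register does not
  enter the bound.\<close>

lemma generates_For:
  assumes i: "i \<notin> J" "i \<noteq> r" and b: "\<And>a. generates (b a) r J (v a)"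
  shows "generates (For i b) r (insert i J) (\<lambda>\<sigma>. concat (map (\<lambda>a. v a \<sigma>) (\<sigma> i)))"
proof -
  have "\<forall>a. \<exists>K d. generates_within (b a) r J (v a) K d" using b unfolding generates_def by blast
  then obtain K d where w: "\<And>a. generates_within (b a) r J (v a) (K a) (d a)" by metis
  \<comment> \<open>Sums over the finite alphabet dominate the bounds of all bodies at once.\<close>
  define L l where "L = (\<Sum>a\<in>UNIV. K a)" and "l = (\<Sum>a\<in>UNIV. d a)"
  have Kl: "K a * (Z + 1) ^ d a \<le> L * (Z + 1) ^ l" for a Z
    by (rule power_bound_mono) (unfold L_def l_def, (rule member_le_sum; simp)+)
  have bJ: "r \<notin> J" "wf_cmd (b a)" "regs (b a) \<subseteq> insert r J" for a using b[of a] unfolding generates_def by blast+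
  show ?thesis
  proof (rule generatesI[where K = "L + 6" and d = "l + 1"])
    fix \<sigma> :: "nat \<Rightarrow> sym list" and Z ys assume "\<forall>j\<in>insert i J. length (\<sigma> j) \<le> Z"
    then have Z: "\<forall>j\<in>J. length (\<sigma> j) \<le> Z" and len: "length (\<sigma> i) \<le> Z" by auto
    have body: "exec (b a) (\<sigma>(r := zs)) = \<sigma>(r := zs @ v a \<sigma>)" "time (b a) (\<sigma>(r := zs)) \<le> L * (Z + 1) ^ l" for a zs
      using generates_withinD[OF w[of a] Z, of zs] Kl[of a Z] by (blast, linarith)
    have f: "fold (\<lambda>a. exec (b a)) xs (\<sigma>(r := zs)) = \<sigma>(r := zs @ concat (map (\<lambda>a. v a \<sigma>) xs))" for xs zs
      by (induction xs arbitrary: zs) (simp_all add: body(1))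
    have ft: "fold_time (\<lambda>a. exec (b a)) (\<lambda>a. time (b a)) xs (\<sigma>(r := zs)) \<le> length xs * (L * (Z + 1) ^ l + 2)" for xs zs
    proof (induction xs arbitrary: zs)
      case (Cons a xs)
      show ?case using body(2)[of a zs] Cons.IH[of "zs @ v a \<sigma>"]
        by (simp only: fold_time.simps body(1) list.size add_mult_distrib mult_1 plus_1_eq_Suc[symmetric])
    qed simp
    have "length (\<sigma> i) + 3 + fold_time (\<lambda>a. exec (b a)) (\<lambda>a. time (b a)) (\<sigma> i) (\<sigma>(r := ys)) \<le>
        Z + 3 + Z * (L * (Z + 1) ^ l + 2)"
      using len ft[of "\<sigma> i" ys] mult_le_mono1[OF len, of "L * (Z + 1) ^ l + 2"] by linarith
    also have "\<dots> \<le> (L + 6) * (Z + 1) ^ (l + 1)"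
    proof -
      have "Z * (L * (Z + 1) ^ l) \<le> L * (Z + 1) ^ (l + 1)" by simp
      moreover have "(Z + 1) ^ 1 \<le> (Z + 1) ^ (l + 1)" by (rule power_increasing) auto
      ultimately show ?thesis unfolding add_mult_distrib distrib_left power_one_right by linarith
    qed
    finally show "exec (For i b) (\<sigma>(r := ys)) = \<sigma>(r := ys @ concat (map (\<lambda>a. v a \<sigma>) (\<sigma> i))) \<and>
      time (For i b) (\<sigma>(r := ys)) \<le> (L + 6) * (Z + 1) ^ (l + 1)"
      using i(2) by (simp add: f)
  next
    show "r \<notin> insert i J" using i bJ by blast
    show "wf_cmd (For i b)" using bJ i by auto
    show "regs (For i b) \<subseteq> insert r (insert i J)" using bJ by auto
  qed
qed

definition seqs :: "cmd list \<Rightarrow> cmd" where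
  "seqs cs = foldr Seq cs Skip"

lemma generates_seqs:
  assumes "r \<notin> I" "\<And>k. k \<in> set ks \<Longrightarrow> generates (f k) r I (v k)"
  shows "generates (seqs (map f ks)) r I (\<lambda>\<sigma>. concat (map (\<lambda>k. v k \<sigma>) ks))"
  using assms(2)
proof (induction ks)
  case Nil
  show ?case using generates_Skip[OF assms(1)] by (simp add: seqs_def)
next
  case (Cons k ks)
  then have "generates (Seq (f k) (seqs (map f ks))) r I (\<lambda>\<sigma>. v k \<sigma> @ concat (map (\<lambda>k. v k \<sigma>) ks))"
    by (intro generates_Seq) auto
  then show ?case by (simp add: seqs_def)
qed

section \<open>Printing output templates built from fixed symbols and images of registers\<close>

datatype token = Lit sym | Each nat "sym \<Rightarrow> sym list"

primrec token_cmd :: "nat \<Rightarrow> token \<Rightarrow> cmd" where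
  "token_cmd r (Lit a) = App r a"
| "token_cmd r (Each i f) = For i (\<lambda>a. seqs (map (App r) (f a)))"

primrec token_word :: "(nat \<Rightarrow> sym list) \<Rightarrow> token \<Rightarrow> sym list" where
  "token_word \<sigma> (Lit a) = [a]"
| "token_word \<sigma> (Each i f) = concat (map f (\<sigma> i))"

primrec token_regs :: "token \<Rightarrow> nat set" where
  "token_regs (Lit a) = {}"
| "token_regs (Each i f) = {i}"

definition print :: "nat \<Rightarrow> token list \<Rightarrow> cmd" where
  "print r ts = seqs (map (token_cmd r) ts)"

definition words :: "token list \<Rightarrow> (nat \<Rightarrow> sym list) \<Rightarrow> sym list" where
  "words ts \<sigma> = concat (map (token_word \<sigma>) ts)"

lemma words_simps:
  "words [] \<sigma> = []" "words (t # ts) \<sigma> = token_word \<sigma> t @ words ts \<sigma>"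
  "words (ts @ us) \<sigma> = words ts \<sigma> @ words us \<sigma>" "words (map Lit xs) \<sigma> = xs"
  by (simp_all add: words_def comp_def)

lemma generates_print:
  assumes "r \<notin> I" "\<And>t. t \<in> set ts \<Longrightarrow> token_regs t \<subseteq> I"
  shows "generates (print r ts) r I (words ts)"
  unfolding print_def words_def
proof (rule generates_seqs[OF assms(1)])
  fix t assume "t \<in> set ts"
  then have t: "token_regs t \<subseteq> I" by (rule assms(2))
  show "generates (token_cmd r t) r I (\<lambda>\<sigma>. token_word \<sigma> t)"
  proof (cases t)
    case (Lit a)
    then show ?thesis using generates_App[OF assms(1)] by simp
  next
    case (Each i f)
    have "generates (seqs (map (App r) (f a))) r {} (\<lambda>\<sigma>. concat (map (\<lambda>k. [k]) (f a)))" for a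
      by (rule generates_seqs) (auto intro: generates_App)
    then have "generates (For i (\<lambda>a. seqs (map (App r) (f a)))) r {i} (\<lambda>\<sigma>. concat (map f (\<sigma> i)))"
      using t Each assms(1) generates_For[of i "{}" r "\<lambda>a. seqs (map (App r) (f a))" "\<lambda>a \<sigma>. f a"] by auto
    then show ?thesis using t Each by (auto intro: generates_mono[OF _ _ assms(1)])
  qed
qed

subsection \<open>Unary polynomials and binary counting\<close>

text \<open>Nested loops must run over distinct registers, so a monomial of degree \<open>k\<close>
  needs \<open>k\<close> copies of the input length; they are kept in the registers from 11
  on.\<close>

primrec copies :: "nat \<Rightarrow> cmd" where
  "copies 0 = Skip"
| "copies (Suc k) = Seq (copies k) (print (11 + k) [Each 0 (\<lambda>_. [Bit True])])"

lemma copies_print: "generates (print (11 + k) [Each 0 (\<lambda>_. [Bit True])]) (11 + k) {0} (\<lambda>\<sigma>. replicate (length (\<sigma> 0)) (Bit True))"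
proof -
  have "words [Each 0 (\<lambda>_. [Bit True])] = (\<lambda>\<sigma>. replicate (length (\<sigma> 0)) (Bit True))"
    by (rule HOL.ext) (simp add: words_simps map_replicate_const)
  moreover have "generates (print (11 + k) [Each 0 (\<lambda>_. [Bit True])]) (11 + k) {0} (words [Each 0 (\<lambda>_. [Bit True])])"
    by (rule generates_print) auto
  ultimately show ?thesis by simp
qed

lemma polytime_copies: "polytime (copies k)"
proof (induction k)
  case 0
  show ?case using generates_polytime[OF generates_Skip[of 0 "{}"]] by simp
next
  case (Suc k)
  then show ?case using generates_polytime[OF copies_print] by (simp add: polytime_Seq)
qed

lemma exec_copies:
  "exec (copies k) \<sigma> = (\<lambda>i. if 11 \<le> i \<and> i < 11 + k then \<sigma> i @ replicate (length (\<sigma> 0)) (Bit True) else \<sigma> i)"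
proof (induction k)
  case (Suc k)
  show ?case by (rule HOL.ext) (auto simp: Suc generates_exec[OF copies_print])
next
  case 0
  show ?case by (rule HOL.ext) auto
qed

primrec nest :: "nat \<Rightarrow> nat \<Rightarrow> cmd" where
  "nest r 0 = App r (Bit True)"
| "nest r (Suc k) = For (11 + k) (\<lambda>_. nest r k)"

lemma generates_nest:
  assumes "r < 11"
  shows "generates (nest r k) r {11..<11 + k} (\<lambda>\<sigma>. replicate (\<Prod>j<k. length (\<sigma> (11 + j))) (Bit True))"
proof (induction k)
  case 0
  show ?case using generates_App[of r "{}"] by simp
next
  case (Suc k)
  have "concat (map (\<lambda>a. replicate n (Bit True)) xs) = replicate (n * length xs) (Bit True)" for n and xs :: "sym list"
    by (induction xs) (auto simp: replicate_add)
  moreover have "insert (11 + k) {11..<11 + k} = {11..<11 + Suc k}" by auto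
  ultimately show ?case
    using generates_For[of "11 + k" "{11..<11 + k}" r "\<lambda>_. nest r k", OF _ _ Suc] assms by (simp add: mult.commute)
qed

definition unary_poly :: "nat \<Rightarrow> nat poly \<Rightarrow> cmd" where
  "unary_poly r p = seqs (map (\<lambda>i. seqs (map (\<lambda>_. nest r i) [0..<coeff p i])) [0..<Suc (degree p)])"

lemma generates_unary_poly:
  assumes "r < 11" "degree p \<le> k"
  shows "generates (unary_poly r p) r {11..<11 + k} (\<lambda>\<sigma>. replicate (\<Sum>i\<le>degree p. coeff p i * (\<Prod>j<i. length (\<sigma> (11 + j)))) (Bit True))"
proof -
  have rep: "concat (map (\<lambda>i. replicate (f i) (Bit True)) [0..<n]) = replicate (\<Sum>i<n. f i) (Bit True)" for f n
    by (induction n) (auto simp: replicate_add)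
  have r: "r \<notin> {11..<11 + k}" using assms(1) by auto
  have "generates (unary_poly r p) r {11..<11 + k}
     (\<lambda>\<sigma>. concat (map (\<lambda>i. concat (map (\<lambda>_. replicate (\<Prod>j<i. length (\<sigma> (11 + j))) (Bit True)) [0..<coeff p i])) [0..<Suc (degree p)]))"
    unfolding unary_poly_def
    by (intro generates_seqs[OF r] generates_mono[OF generates_nest[OF assms(1)] _ r]) (use assms(2) in auto)
  then show ?thesis unfolding rep sum_constant card_lessThan lessThan_Suc_atMost by simp
qed

lemma binary_inc_word: "binary_inc (map Bit (binary_word k)) = map Bit (binary_word (Suc k))"
proof (induction k rule: binary_word.induct)
  case (1 k)
  show ?case
  proof (cases "k = 0")
    case True
    then show ?thesis by (simp add: binary_word.simps)
  next
    case False
    have k: "binary_word k = odd k # binary_word (k div 2)" using False by (subst binary_word.simps) simp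
    have s: "binary_word (Suc k) = odd (Suc k) # binary_word (Suc k div 2)" by (subst binary_word.simps) simp
    show ?thesis
    proof (cases "odd k")
      case True
      then show ?thesis using 1[OF False] unfolding k s by simp
    next
      case even: False
      then show ?thesis unfolding k s by simp
    qed
  qed
qed

definition count :: "nat \<Rightarrow> nat \<Rightarrow> cmd" where
  "count i r = For i (\<lambda>_. Incr r)"

lemma exec_count:
  assumes "i \<noteq> r" "\<sigma> r = []"
  shows "exec (count i r) \<sigma> = \<sigma>(r := map Bit (binary_word (length (\<sigma> i))))"
proof -
  have "fold (\<lambda>_. exec (Incr r)) xs (\<sigma>(r := map Bit (binary_word k))) = \<sigma>(r := map Bit (binary_word (k + length xs)))"
    for xs :: "sym list" and k
    by (induction xs arbitrary: k) (simp_all only: fold_simps exec.simps fun_upd_same fun_upd_upd binary_inc_word list.size add_0_right add_Suc_right add_Suc)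
  moreover have "\<sigma>(r := map Bit (binary_word 0)) = \<sigma>"
    using assms(2) by (subst binary_word.simps) (simp add: fun_upd_idem)
  ultimately have "fold (\<lambda>_. exec (Incr r)) (\<sigma> i) \<sigma> = \<sigma>(r := map Bit (binary_word (0 + length (\<sigma> i))))"
    by metis
  then show ?thesis by (simp only: count_def exec.simps add_0)
qed

text \<open>\<open>Incr\<close> rewrites its register and thus is not covered by
  \<open>generates\<close>. The direct bound is quadratic, since each increment lengthens the
  counter by at most one digit.\<close>

lemma polytime_count:
  assumes "i \<noteq> r"
  shows "polytime (count i r)"
proof -
  have ft: "fold_time (\<lambda>_. exec (Incr r)) (\<lambda>_. time (Incr r)) xs s \<le> length xs * (2 * (length (s r) + length xs) + 5)"
    for xs :: "sym list" and s
  proof (induction xs arbitrary: s)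
    case (Cons a xs)
    let ?s = "exec (Incr r) s"
    have "length (?s r) \<le> Suc (length (s r))" using length_binary_inc by simp
    then have "length xs * (2 * (length (?s r) + length xs) + 5) \<le> length xs * (2 * (length (s r) + length (a # xs)) + 5)"
      by (intro mult_le_mono2) simp
    with Cons.IH[of ?s] have 1: "fold_time (\<lambda>_. exec (Incr r)) (\<lambda>_. time (Incr r)) xs ?s \<le>
        length xs * (2 * (length (s r) + length (a # xs)) + 5)" by (rule le_trans)
    have 2: "time (Incr r) s + 2 \<le> 2 * (length (s r) + length (a # xs)) + 5" using inc_time_le[of "s r"] by simp
    have "length (a # xs) = Suc (length xs)" by simp
    then show ?case unfolding fold_time.simps using add_mono[OF 2 1] by (simp only: mult_Suc)
  qed simp
  have "time (count i r) \<sigma> \<le> 14 * (Z + 1) ^ 2" if Z: "\<And>i. length (\<sigma> i) \<le> Z" for \<sigma> Z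
  proof -
    have "length (\<sigma> i) * (2 * (length (\<sigma> r) + length (\<sigma> i)) + 5) \<le> Z * (2 * (Z + Z) + 5)"
      using Z[of i] Z[of r] by (intro mult_le_mono add_le_mono mult_le_mono2 add_mono) auto
    then have "time (count i r) \<sigma> \<le> Z + 3 + Z * (2 * (Z + Z) + 5)"
      using ft[of "\<sigma> i" \<sigma>] Z[of i] by (simp add: count_def)
    also have "\<dots> \<le> 14 * (Z + 1) ^ 2" by (simp add: power2_eq_square algebra_simps)
    finally show ?thesis .
  qed
  moreover have "wf_cmd (count i r)" using assms by (simp add: count_def)
  ultimately show ?thesis unfolding polytime_def by blast
qed

section \<open>The reduction\<close>

lemma Suc_grid: "b < n \<Longrightarrow> Suc (a * n + b) = m * n \<longleftrightarrow> Suc a = m \<and> Suc b = (n :: nat)"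
proof
  assume b: "b < n" and e: "Suc (a * n + b) = m * n"
  have "Suc b = n"
  proof (rule ccontr)
    assume "Suc b \<noteq> n"
    then have "Suc b < n" using b by linarith
    then have "(a * n + Suc b) mod n = Suc b" by simp
    then show False using e by simp
  qed
  moreover have "Suc a * n = m * n" using e calculation by simp
  then have "Suc a = m" using b by (simp only: mult_cancel2) simp
  ultimately show "Suc a = m \<and> Suc b = n" by blast
qed auto

text \<open>The reading order of the sites matches the nesting of the program's loops: tableau row,
  grid row inside it, tableau column, grid column inside it.\<close>

lemma concat_grid4:
  "concat (map f [0..<(R * h) * (W * w)]) =
   concat (map (\<lambda>i. concat (map (\<lambda>a. concat (map (\<lambda>j. concat (map (\<lambda>b. f ((i * h + a) * (W * w) + (j * w + b)))
     [0..<w])) [0..<W])) [0..<h])) [0..<R])"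
  unfolding concat_group[of f "R * h" "W * w"] concat_group[of _ R h] concat_group[of _ W w] ..

lemma length_concat_card: "length (concat (map (\<lambda>g. if P g then [y] else []) [0..<n])) = card {g. g < n \<and> P g}"
proof (induction n)
  case (Suc n)
  have "{g. g < Suc n \<and> P g} = (if P n then insert n {g. g < n \<and> P g} else {g. g < n \<and> P g})"
    by (auto simp: less_Suc_eq)
  then show ?case using Suc by simp
qed simp

fun first_cell :: "sym \<Rightarrow> bool" where
  "first_cell (Cell k f l) = f"
| "first_cell (Bit b) = False"

fun last_cell :: "sym \<Rightarrow> bool" where
  "last_cell (Cell k f l) = l"
| "last_cell (Bit b) = False"

fun as_mid :: "sym \<Rightarrow> sym" where
  "as_mid (Cell k f l) = Cell Mid f l"
| "as_mid (Bit b) = Bit b"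

fun as_input :: "sym \<Rightarrow> sym" where
  "as_input (Bit b) = Cell (bit_cell b) False False"
| "as_input (Cell k f l) = Cell k f l"

definition chunk_tokens :: "bool \<Rightarrow> bool \<Rightarrow> nat \<Rightarrow> bool \<Rightarrow> bool \<Rightarrow> bool \<Rightarrow> bool \<Rightarrow> nat \<Rightarrow> token list" where
  "chunk_tokens bef aft l up left right down s =
     (if bef \<and> s = 0 then map Lit (map Bit (drop 9 (site_mid l left right s)))
      else [Lit (Bit (s = 0 \<and> up)), Each 7 (\<lambda>a. [a])] @
        map Lit (map Bit (if aft \<and> s = 8 then take 10 (site_mid l left right s) else site_mid l left right s))) @
     (if aft \<and> s = 8 then [] else [Each 7 (\<lambda>a. [a]), Lit (Bit (s = 0 \<and> down)), Each 8 (\<lambda>a. [a])])"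

lemma words_chunk_tokens:
  assumes "\<sigma> 7 = replicate z1 (Bit False)" "\<sigma> 8 = replicate z2 (Bit False)"
  shows "words (chunk_tokens bef aft l up left right down s) \<sigma> =
    map Bit (chunk_pieces bef aft l up left right down z1 z2 s)"
  unfolding chunk_tokens_def chunk_pieces_def
  by (cases bef; cases aft; cases "s = 0"; cases "s = 8") (simp_all add: assms words_simps del: map_map)

lemma chunk_tokens_regs: "t \<in> set (chunk_tokens bef aft l up left right down s) \<Longrightarrow> token_regs t \<subseteq> {7, 8}"
  unfolding chunk_tokens_def by (auto split: if_splits)

lemma words_concat: "words (concat tss) \<sigma> = concat (map (\<lambda>ts. words ts \<sigma>) tss)"
  by (induction tss) (simp_all add: words_simps)

locale reduction =
  fixes m :: nat and H V :: "nat \<Rightarrow> nat \<Rightarrow> bool" and A :: "sym \<Rightarrow> nat set" and p U :: "nat poly"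
begin

definition hgt :: nat where "hgt = (3 * m + 2) * 8"
definition wid :: nat where "wid = (2 * m + 2) * 8"

definition cell_site :: "sym \<Rightarrow> bool \<Rightarrow> nat \<Rightarrow> nat \<Rightarrow> site" where
  "cell_site c lr a b = ksite (cell_kind m H V (A c) (a div 8) (b div 8)) (lr \<and> Suc (a div 8) = 3 * m + 2)
     (last_cell c \<and> Suc (b div 8) = 2 * m + 2) (a mod 8) (b mod 8)"

text \<open>Only one tableau cell is visible at a time. An edge that enters from another cell can
  only sit at a port, hence at position 3 modulo 8 whatever that cell contains, so no neighbour has
  to be inspected.\<close>

definition up_edge :: "bool \<Rightarrow> bool \<Rightarrow> sym \<Rightarrow> nat \<Rightarrow> nat \<Rightarrow> bool" where
  "up_edge fr lr c a b = (if a = 0 then \<not> fr \<and> b mod 8 = 3 else sd (cell_site c lr (a - 1) b))"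

definition left_edge :: "bool \<Rightarrow> sym \<Rightarrow> nat \<Rightarrow> nat \<Rightarrow> bool" where
  "left_edge lr c a b = (if b = 0 then \<not> first_cell c \<and> a mod 8 = 3 else sr (cell_site c lr a (b - 1)))"

definition unary_tokens :: "bool \<Rightarrow> bool \<Rightarrow> sym \<Rightarrow> nat \<Rightarrow> nat \<Rightarrow> token list" where
  "unary_tokens fr lr c a b = map Lit (map Bit (replicate 9 True))"

definition matrix_tokens :: "bool \<Rightarrow> bool \<Rightarrow> sym \<Rightarrow> nat \<Rightarrow> nat \<Rightarrow> token list" where
  "matrix_tokens fr lr c a b = concat (map (chunk_tokens (fr \<and> a = 0 \<and> first_cell c \<and> b = 0)
     (lr \<and> Suc a = hgt \<and> last_cell c \<and> Suc b = wid) (slv (cell_site c lr a b)) (up_edge fr lr c a b)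
     (left_edge lr c a b) (sr (cell_site c lr a b)) (sd (cell_site c lr a b))) [0..<9])"

definition colour_tokens :: "bool \<Rightarrow> bool \<Rightarrow> sym \<Rightarrow> nat \<Rightarrow> nat \<Rightarrow> token list" where
  "colour_tokens fr lr c a b = map Lit (map Bit (concat (map (\<lambda>s.
     replicate (picture.slot_col (cell_site c lr a b) s) True @ [False]) [0..<9])))"

definition budget_tokens :: "bool \<Rightarrow> bool \<Rightarrow> sym \<Rightarrow> nat \<Rightarrow> nat \<Rightarrow> token list" where
  "budget_tokens fr lr c a b = (if 1 \<le> slv (cell_site c lr a b) then [Lit (Bit True)] else [])"

definition row_cmd :: "nat \<Rightarrow> (bool \<Rightarrow> bool \<Rightarrow> sym \<Rightarrow> nat \<Rightarrow> nat \<Rightarrow> token list) \<Rightarrow> nat \<Rightarrow> bool \<Rightarrow> bool \<Rightarrow> cmd" where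
  "row_cmd r tok i fr lr =
     seqs (map (\<lambda>a. For i (\<lambda>c. print r (concat (map (tok fr lr c a) [0..<wid])))) [0..<hgt])"

text \<open>All tableau rows strictly between the first and the last carry the same cells, so
  register 5 is replayed once for each symbol of register 3.\<close>

definition site_loop :: "nat \<Rightarrow> (bool \<Rightarrow> bool \<Rightarrow> sym \<Rightarrow> nat \<Rightarrow> nat \<Rightarrow> token list) \<Rightarrow> cmd" where
  "site_loop r tok = Seq (row_cmd r tok 4 True False)
     (Seq (For 3 (\<lambda>_. row_cmd r tok 5 False False)) (row_cmd r tok 6 False True))"

definition row_word :: "(bool \<Rightarrow> bool \<Rightarrow> sym \<Rightarrow> nat \<Rightarrow> nat \<Rightarrow> token list) \<Rightarrow> nat \<Rightarrow> bool \<Rightarrow> bool \<Rightarrow> (nat \<Rightarrow> sym list) \<Rightarrow> sym list" where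
  "row_word tok i fr lr \<sigma> =
     concat (map (\<lambda>a. concat (map (\<lambda>c. words (concat (map (tok fr lr c a) [0..<wid])) \<sigma>) (\<sigma> i))) [0..<hgt])"

definition loop_word :: "(bool \<Rightarrow> bool \<Rightarrow> sym \<Rightarrow> nat \<Rightarrow> nat \<Rightarrow> token list) \<Rightarrow> (nat \<Rightarrow> sym list) \<Rightarrow> sym list" where
  "loop_word tok \<sigma> = row_word tok 4 True False \<sigma> @
     concat (map (\<lambda>_. row_word tok 5 False False \<sigma>) (\<sigma> 3)) @ row_word tok 6 False True \<sigma>"

lemma generates_row:
  assumes r: "r \<notin> {i, 7, 8}" "i \<notin> {7, 8}"
    and t: "\<And>fr lr c a b t. t \<in> set (tok fr lr c a b) \<Longrightarrow> token_regs t \<subseteq> {7, 8}"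
  shows "generates (row_cmd r tok i fr lr) r {i, 7, 8} (row_word tok i fr lr)"
proof -
  have "generates (For i (\<lambda>c. print r (concat (map (tok fr lr c a) [0..<wid])))) r {i, 7, 8}
     (\<lambda>\<sigma>. concat (map (\<lambda>c. words (concat (map (tok fr lr c a) [0..<wid])) \<sigma>) (\<sigma> i)))" for a
  proof (rule generates_For)
    show "generates (print r (concat (map (tok fr lr c a) [0..<wid]))) r {7, 8} (words (concat (map (tok fr lr c a) [0..<wid])))" for c
    proof (rule generates_print)
      fix z assume "z \<in> set (concat (map (tok fr lr c a) [0..<wid]))"
      then obtain b where "z \<in> set (tok fr lr c a b)" by auto
      then show "token_regs z \<subseteq> {7, 8}" by (rule t)
    qed (use r in blast)
  qed (use r in auto)
  then have "generates (row_cmd r tok i fr lr) r {i, 7, 8}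
      (\<lambda>\<sigma>. concat (map (\<lambda>a. concat (map (\<lambda>c. words (concat (map (tok fr lr c a) [0..<wid])) \<sigma>) (\<sigma> i))) [0..<hgt]))"
    unfolding row_cmd_def by (intro generates_seqs r(1))
  then show ?thesis unfolding row_word_def[abs_def] .
qed

lemma generates_site_loop:
  assumes r: "r \<notin> {3, 4, 5, 6, 7, 8}"
    and t: "\<And>fr lr c a b t. t \<in> set (tok fr lr c a b) \<Longrightarrow> token_regs t \<subseteq> {7, 8}"
  shows "generates (site_loop r tok) r {3, 4, 5, 6, 7, 8} (loop_word tok)"
proof -
  have 4: "generates (row_cmd r tok 4 True False) r {3, 4, 5, 6, 7, 8} (row_word tok 4 True False)"
    by (rule generates_mono[OF generates_row[OF _ _ t]]) (use r in auto)
  have 6: "generates (row_cmd r tok 6 False True) r {3, 4, 5, 6, 7, 8} (row_word tok 6 False True)"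
    by (rule generates_mono[OF generates_row[OF _ _ t]]) (use r in auto)
  have "generates (For 3 (\<lambda>_. row_cmd r tok 5 False False)) r {3, 5, 7, 8}
      (\<lambda>\<sigma>. concat (map (\<lambda>_. row_word tok 5 False False \<sigma>) (\<sigma> 3)))"
    by (rule generates_For[OF _ _ generates_row[OF _ _ t]]) (use r in auto)
  then have 5: "generates (For 3 (\<lambda>_. row_cmd r tok 5 False False)) r {3, 4, 5, 6, 7, 8}
      (\<lambda>\<sigma>. concat (map (\<lambda>_. row_word tok 5 False False \<sigma>) (\<sigma> 3)))"
    by (rule generates_mono) (use r in auto)
  show ?thesis unfolding site_loop_def loop_word_def[abs_def] by (intro generates_Seq 4 5 6)
qed

lemma unary_tokens_regs: "t \<in> set (unary_tokens fr lr c a b) \<Longrightarrow> token_regs t \<subseteq> {7, 8}"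
  unfolding unary_tokens_def by auto

lemma matrix_tokens_regs: "t \<in> set (matrix_tokens fr lr c a b) \<Longrightarrow> token_regs t \<subseteq> {7, 8}"
  unfolding matrix_tokens_def set_concat set_map using chunk_tokens_regs by blast

lemma colour_tokens_regs: "t \<in> set (colour_tokens fr lr c a b) \<Longrightarrow> token_regs t \<subseteq> {7, 8}"
  unfolding colour_tokens_def set_map by auto

lemma budget_tokens_regs: "t \<in> set (budget_tokens fr lr c a b) \<Longrightarrow> token_regs t \<subseteq> {7, 8}"
  unfolding budget_tokens_def by (auto split: if_splits)

subsection \<open>The picture of a word\<close>

definition slack :: "bool list \<Rightarrow> nat" where "slack x = poly U (length x)"
definition rows :: "bool list \<Rightarrow> nat" where "rows x = slack x + 2"
definition cols :: "bool list \<Rightarrow> nat" where "cols x = tableau_width (encode_pair x []) (poly p (length x)) (slack x)"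
definition cell :: "bool list \<Rightarrow> nat \<Rightarrow> nat \<Rightarrow> sym" where
  "cell x = tableau_cell (encode_pair x []) (poly p (length x)) (slack x)"
definition pic :: "bool list \<Rightarrow> nat \<Rightarrow> nat \<Rightarrow> site" where
  "pic x = kind_picture (rows x * (3 * m + 2)) (cols x * (2 * m + 2)) (tile_kind m H V (\<lambda>i j. A (cell x i j)))"

lemma cell_flags: "first_cell (cell x i j) \<longleftrightarrow> j = 0" "last_cell (cell x i j) \<longleftrightarrow> Suc j = cols x"
  by (simp_all add: cell_def tableau_cell_def cols_def)

lemma pos: "2 \<le> rows x" "1 \<le> cols x" "16 \<le> hgt" "16 \<le> wid"
  by (simp_all add: rows_def cols_def tableau_width_def hgt_def wid_def)

lemma dims: "8 * (rows x * (3 * m + 2)) = rows x * hgt" "8 * (cols x * (2 * m + 2)) = cols x * wid"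
  unfolding hgt_def wid_def by (simp_all only: ac_simps)

lemma picture_pic: "picture (rows x * hgt) (cols x * wid) (pic x)"
  unfolding dims[symmetric] pic_def
  by (rule picture_kind_picture) (use pos(1,2)[of x] in simp_all)

lemma pic_site:
  assumes "a < hgt" "b < wid"
  shows "pic x (i * hgt + a) (j * wid + b) = cell_site (cell x i j) (Suc i = rows x) a b"
proof -
  have a8: "a div 8 < 3 * m + 2" and b8: "b div 8 < 2 * m + 2"
    using assms unfolding hgt_def wid_def by (simp_all only: less_mult_imp_div_less)
  have d: "(k * (n * 8) + c) div 8 = k * n + c div 8 \<and> (k * (n * 8) + c) mod 8 = c mod 8" for k n c :: nat
  proof -
    have e: "k * (n * 8) + c = (k * n) * 8 + c" by (simp only: mult.assoc)
    show ?thesis unfolding e by (simp only: mod_mult_self3 div_mult_self3)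
  qed
  show ?thesis
    unfolding pic_def kind_picture_def tile_kind_def cell_site_def cell_flags hgt_def wid_def
    by (simp only: d block_div_mod[OF a8] block_div_mod[OF b8] Suc_grid[OF a8] Suc_grid[OF b8])
qed

lemma cell_site_bottom: "\<not> lr \<Longrightarrow> sd (cell_site c lr (hgt - 1) b) \<longleftrightarrow> b mod 8 = 3"
proof -
  assume "\<not> lr"
  have "(hgt - 1) mod 8 = 7"
  proof -
    have "hgt - 1 = (3 * m + 1) * 8 + 7" unfolding hgt_def by simp
    then show ?thesis by presburger
  qed
  then show ?thesis using \<open>\<not> lr\<close> gdown_bounds[of 7] unfolding cell_site_def ksite_def by auto
qed

lemma cell_site_right: "\<not> last_cell c \<Longrightarrow> sr (cell_site c lr a (wid - 1)) \<longleftrightarrow> a mod 8 = 3"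
proof -
  assume "\<not> last_cell c"
  have "(wid - 1) mod 8 = 7"
  proof -
    have "wid - 1 = (2 * m + 1) * 8 + 7" unfolding wid_def by simp
    then show ?thesis by presburger
  qed
  then show ?thesis using \<open>\<not> last_cell c\<close> gright_bounds[of _ 7] unfolding cell_site_def ksite_def by auto
qed

text \<open>Turns conditions on the global site number \<open>g\<close> into conditions on the
  current cell and the position inside its block, which is all that the program knows.\<close>

lemma grid_site:
  fixes x
  defines "B \<equiv> cols x * wid" and "N \<equiv> (rows x * hgt) * (cols x * wid)"
  defines "s \<equiv> \<lambda>g. picture.st B (pic x) g"
  assumes i: "i < rows x" and a: "a < hgt" and j: "j < cols x" and b: "b < wid"
  defines "g \<equiv> (i * hgt + a) * B + (j * wid + b)" and "c \<equiv> cell x i j" and "fr \<equiv> i = 0" and "lr \<equiv> Suc i = rows x"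
  shows "s g = cell_site c lr a b"
    and "g = 0 \<longleftrightarrow> fr \<and> a = 0 \<and> first_cell c \<and> b = 0"
    and "Suc g = N \<longleftrightarrow> lr \<and> Suc a = hgt \<and> last_cell c \<and> Suc b = wid"
    and "B \<le> g \<and> sd (s (g - B)) \<longleftrightarrow> up_edge fr lr c a b"
    and "1 \<le> g \<and> sr (s (g - 1)) \<longleftrightarrow> left_edge lr c a b"
proof -
  interpret picture "rows x * hgt" "cols x * wid" "pic x" by (rule picture_pic)
  have stg: "s (k * B + l) = pic x k l" if "l < B" for k l
    unfolding s_def B_def st_def using block_div_mod[OF that[unfolded B_def]] by simp
  have colb: "k * wid + l < B" if "k < cols x" "l < wid" for k l
  proof -
    have "k * wid + l < Suc k * wid" using that by simp
    also have "\<dots> \<le> cols x * wid" using that by (intro mult_le_mono1) simp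
    finally show ?thesis unfolding B_def .
  qed
  have jb: "j * wid + b < B" using colb[OF j b] .
  show "s g = cell_site c lr a b"
    unfolding g_def stg[OF jb] c_def lr_def by (rule pic_site[OF a b])
  have B0: "0 < B" using jb by linarith
  have h0: "0 < hgt" using a by linarith
  have w0: "0 < wid" using b by linarith
  show "g = 0 \<longleftrightarrow> fr \<and> a = 0 \<and> first_cell c \<and> b = 0"
    unfolding g_def fr_def c_def cell_flags using B0 h0 w0 by auto
  show "Suc g = N \<longleftrightarrow> lr \<and> Suc a = hgt \<and> last_cell c \<and> Suc b = wid"
    unfolding g_def N_def B_def[symmetric] Suc_grid[OF jb] Suc_grid[OF a] lr_def c_def cell_flags
    unfolding B_def Suc_grid[OF b] by blast
  show "B \<le> g \<and> sd (s (g - B)) \<longleftrightarrow> up_edge fr lr c a b"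
  proof (cases "i * hgt + a")
    case 0
    then have "i = 0" "a = 0" using h0 by auto
    then show ?thesis using jb unfolding g_def 0 up_edge_def fr_def by simp
  next
    case (Suc k)
    have gB: "B \<le> g" "g - B = k * B + (j * wid + b)" unfolding g_def Suc by simp_all
    have sg: "s (g - B) = pic x k (j * wid + b)" unfolding gB(2) by (rule stg[OF jb])
    show ?thesis
    proof (cases "a = 0")
      case True
      then obtain i' where i': "i = Suc i'" using Suc by (cases i) auto
      have k: "k = i' * hgt + (hgt - 1)" using Suc True i' h0 by simp
      have "sd (s (g - B)) \<longleftrightarrow> b mod 8 = 3"
        unfolding sg k pic_site[OF diff_less[OF zero_less_one h0] b]
        by (rule cell_site_bottom) (use i i' in simp)
      then show ?thesis using gB(1) True i' unfolding up_edge_def fr_def by simp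
    next
      case False
      have k: "k = i * hgt + (a - 1)" using Suc False by simp
      have a1: "a - 1 < hgt" using a by simp
      show ?thesis using gB(1) False unfolding sg k pic_site[OF a1 b] up_edge_def c_def lr_def by simp
    qed
  qed
  show "1 \<le> g \<and> sr (s (g - 1)) \<longleftrightarrow> left_edge lr c a b"
  proof (cases "j * wid + b")
    case 0
    then have jb0: "j = 0" "b = 0" using w0 by auto
    have "\<not> (1 \<le> g \<and> sr (s (g - 1)))"
    proof (cases "i * hgt + a")
      case 0
      then have "i = 0" "a = 0" using h0 by auto
      then show ?thesis using jb0 unfolding g_def by simp
    next
      case (Suc k)
      \<comment> \<open>Here \<open>g - 1\<close> is the last site of the previous grid row, which
        has no edge to the right.\<close>
      have B1: "B - 1 < B" using B0 by simp
      have "g - 1 = k * B + (B - 1)" unfolding g_def Suc 0 using B0 by simp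
      then have "s (g - 1) = pic x k (B - 1)" using stg[OF B1] by simp
      moreover have "\<not> sr (pic x k (B - 1))" using sr[of "B - 1" k] B0 unfolding B_def by auto
      ultimately show ?thesis by simp
    qed
    then show ?thesis using jb0 unfolding left_edge_def c_def cell_flags by simp
  next
    case (Suc l)
    have lB: "l < B" using jb Suc by linarith
    have gB: "1 \<le> g" "g - 1 = (i * hgt + a) * B + l" unfolding g_def Suc by simp_all
    have sg: "s (g - 1) = pic x (i * hgt + a) l" unfolding gB(2) by (rule stg[OF lB])
    show ?thesis
    proof (cases "b = 0")
      case True
      then obtain j' where j': "j = Suc j'" using Suc by (cases j) auto
      have l: "l = j' * wid + (wid - 1)" using Suc True j' w0 by simp
      have "sr (s (g - 1)) \<longleftrightarrow> a mod 8 = 3"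
        unfolding sg l pic_site[OF a diff_less[OF zero_less_one w0]]
        by (rule cell_site_right) (use j j' in \<open>simp add: cell_flags\<close>)
      then show ?thesis using gB(1) True j' unfolding left_edge_def c_def cell_flags by simp
    next
      case False
      have l: "l = j * wid + (b - 1)" using Suc False by simp
      have b1: "b - 1 < wid" using b by simp
      show ?thesis using gB(1) False unfolding sg l pic_site[OF a b1] left_edge_def c_def lr_def by simp
    qed
  qed
qed

definition prepared :: "bool list \<Rightarrow> (nat \<Rightarrow> sym list) \<Rightarrow> bool" where
  "prepared x \<sigma> \<longleftrightarrow> length (\<sigma> 3) = slack x \<and> \<sigma> 4 = map (cell x 0) [0..<cols x] \<and>
     \<sigma> 5 = map (\<lambda>j. as_mid (cell x 0 j)) [0..<cols x] \<and> \<sigma> 6 = map (cell x (Suc (slack x))) [0..<cols x] \<and>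
     \<sigma> 7 = replicate (9 * (cols x * wid) - 10) (Bit False) \<and>
     \<sigma> 8 = replicate (9 * ((rows x * hgt) * (cols x * wid)) - 2 * (9 * (cols x * wid))) (Bit False)"

lemma cell_mid: "0 < i \<Longrightarrow> i \<le> slack x \<Longrightarrow> cell x i j = as_mid (cell x 0 j)"
  by (simp add: cell_def tableau_cell_def tableau_kind_def)

lemma loop_word:
  assumes \<sigma>: "prepared x \<sigma>"
    and f: "\<And>i a j b. i < rows x \<Longrightarrow> a < hgt \<Longrightarrow> j < cols x \<Longrightarrow> b < wid \<Longrightarrow>
      words (tok (i = 0) (Suc i = rows x) (cell x i j) a b) \<sigma> = f ((i * hgt + a) * (cols x * wid) + (j * wid + b))"
  shows "loop_word tok \<sigma> = concat (map f [0..<(rows x * hgt) * (cols x * wid)])"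
proof -
  define rw where "rw = (\<lambda>i. concat (map (\<lambda>a. concat (map (\<lambda>j. concat (map (\<lambda>b.
      f ((i * hgt + a) * (cols x * wid) + (j * wid + b))) [0..<wid])) [0..<cols x])) [0..<hgt]))"
  have row: "row_word tok k (i = 0) (Suc i = rows x) \<sigma> = rw i"
    if k: "\<sigma> k = map (cell x i) [0..<cols x]" and i: "i < rows x" for k i
    unfolding row_word_def rw_def k map_map comp_def words_concat
    by (intro arg_cong[of _ _ concat] map_cong refl) (simp only: f[OF i] set_upt atLeastLessThan_iff)
  have 1: "row_word tok 4 True False \<sigma> = rw 0"
    using row[of 4 0] \<sigma> by (simp add: prepared_def rows_def)
  have 2: "row_word tok 6 False True \<sigma> = rw (Suc (slack x))"
    using row[of 6 "Suc (slack x)"] \<sigma> by (simp add: prepared_def rows_def)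
  have 3: "row_word tok 5 False False \<sigma> = rw i" if "0 < i" "i \<le> slack x" for i
    using row[of 5 i] \<sigma> that cell_mid[OF that] by (simp add: prepared_def rows_def)
  have "concat (map (\<lambda>_. row_word tok 5 False False \<sigma>) (\<sigma> 3)) = concat (map (\<lambda>_. row_word tok 5 False False \<sigma>) [1..<Suc (slack x)])"
    using \<sigma> by (simp add: map_replicate_const prepared_def)
  also have "\<dots> = concat (map rw [1..<Suc (slack x)])"
    by (intro arg_cong[of _ _ concat] map_cong refl) (use 3 in auto)
  finally have 4: "concat (map (\<lambda>_. row_word tok 5 False False \<sigma>) (\<sigma> 3)) = concat (map rw [1..<Suc (slack x)])" .
  have "[0..<rows x] = 0 # [1..<Suc (slack x)] @ [Suc (slack x)]"
    by (simp add: rows_def upt_conv_Cons)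
  then have "concat (map rw [0..<rows x]) = loop_word tok \<sigma>" unfolding loop_word_def 1 2 4 by simp
  then show ?thesis unfolding concat_grid4 rw_def by simp
qed

end

section \<open>The program of the reduction and its output\<close>

context reduction
begin

text \<open>
  Registers: 0 input, 1 output, 2 and 3 the values of \<open>p\<close> and \<open>U\<close> in unary, 4 to 6 the first, the inner
  and the last row of the tableau, 7 and 8 the two lengths of zero runs in a row of the adjacency
  matrix, 9 and 10 the budget in unary and binary, from 11 on copies of the input length.
\<close>

definition input_row :: "token list" where
  "input_row = [Lit (Cell Blank True False), Each 3 (\<lambda>_. [Cell Blank False False]), Lit (Cell Pre False False),
     Each 0 (\<lambda>a. [as_input a, as_input a]), Lit (Cell Zero False False), Lit (Cell One False False),
     Each 2 (\<lambda>_. [Cell Wild False False]), Each 3 (\<lambda>_. [Cell Blank False False]), Lit (Cell Blank False True)]"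

definition final_row :: "token list" where
  "final_row = [Lit (Cell Mid True False), Each 3 (\<lambda>_. [Cell Mid False False]),
     Lit (Cell Mid False False), Lit (Cell Acc2 False False), Lit (Cell Acc0 False False),
     Each 0 (\<lambda>_. [Cell Mid False False, Cell Mid False False]),
     Each 2 (\<lambda>_. [Cell Mid False False]), Each 3 (\<lambda>_. [Cell Mid False False]), Lit (Cell Mid False True)]"

definition zeros :: "nat \<Rightarrow> sym list" where
  "zeros k = replicate k (Bit False)"

text \<open>Appending cannot subtract, so the 10 missing from the gap is taken off the contribution
  of the first cell of the row.\<close>

definition near_gap :: "token list" where
  "near_gap = [Each 5 (\<lambda>c. zeros (if first_cell c then 9 * wid - 10 else 9 * wid))]"

text \<open>This gap counts nine entries for every site outside two grid rows. The first and the
  last tableau row together contribute \<open>2 * hgt - 2\<close> grid rows and each inner one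
  contributes \<open>hgt\<close>, so the subtraction affects only constants.\<close>

definition far_gap :: cmd where
  "far_gap = Seq (print 8 [Each 5 (\<lambda>_. zeros (9 * wid * (2 * hgt - 2)))])
     (For 3 (\<lambda>_. print 8 [Each 5 (\<lambda>_. zeros (9 * wid * hgt))]))"

definition prepare_cmd :: cmd where
  "prepare_cmd = Seq (copies (degree p + degree U)) (Seq (unary_poly 2 p) (Seq (unary_poly 3 U)
     (Seq (print 4 input_row) (Seq (print 5 [Each 4 (\<lambda>c. [as_mid c])]) (Seq (print 6 final_row)
     (Seq (print 7 near_gap) far_gap))))))"

definition output_cmd :: cmd where
  "output_cmd = Seq (site_loop 1 unary_tokens) (Seq (print 1 [Lit (Bit False)]) (Seq (site_loop 1 matrix_tokens)
     (Seq (site_loop 1 colour_tokens) (Seq (site_loop 9 budget_tokens)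
     (Seq (count 9 10) (print 1 [Each 10 (\<lambda>a. [a])]))))))"

lemma generates_poly_cmd:
  "generates (unary_poly 2 p) 2 {11..<11 + (degree p + degree U)}
     (\<lambda>\<sigma>. replicate (\<Sum>i\<le>degree p. coeff p i * (\<Prod>j<i. length (\<sigma> (11 + j)))) (Bit True))"
  "generates (unary_poly 3 U) 3 {11..<11 + (degree p + degree U)}
     (\<lambda>\<sigma>. replicate (\<Sum>i\<le>degree U. coeff U i * (\<Prod>j<i. length (\<sigma> (11 + j)))) (Bit True))"
  by (rule generates_unary_poly; simp)+

lemma generates_rows:
  "generates (print 4 input_row) 4 {0, 2, 3} (words input_row)"
  "generates (print 5 [Each 4 (\<lambda>c. [as_mid c])]) 5 {4} (words [Each 4 (\<lambda>c. [as_mid c])])"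
  "generates (print 6 final_row) 6 {0, 2, 3} (words final_row)"
  "generates (print 7 near_gap) 7 {5} (words near_gap)"
  by (rule generates_print; force simp: input_row_def final_row_def near_gap_def)+

lemma generates_far_gap:
  "generates far_gap 8 {3, 5} (\<lambda>\<sigma>. words [Each 5 (\<lambda>_. zeros (9 * wid * (2 * hgt - 2)))] \<sigma> @
     concat (map (\<lambda>_. words [Each 5 (\<lambda>_. zeros (9 * wid * hgt))] \<sigma>) (\<sigma> 3)))"
  unfolding far_gap_def
proof (rule generates_Seq)
  show "generates (print 8 [Each 5 (\<lambda>_. zeros (9 * wid * (2 * hgt - 2)))]) 8 {3, 5}
      (words [Each 5 (\<lambda>_. zeros (9 * wid * (2 * hgt - 2)))])"
    by (rule generates_print) simp_all
  show "generates (For 3 (\<lambda>_. print 8 [Each 5 (\<lambda>_. zeros (9 * wid * hgt))])) 8 {3, 5}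
      (\<lambda>\<sigma>. concat (map (\<lambda>_. words [Each 5 (\<lambda>_. zeros (9 * wid * hgt))] \<sigma>) (\<sigma> 3)))"
    by (rule generates_For) (simp, simp, rule generates_print, simp_all)
qed

lemma generates_loops:
  "generates (site_loop 1 unary_tokens) 1 {3, 4, 5, 6, 7, 8} (loop_word unary_tokens)"
  "generates (site_loop 1 matrix_tokens) 1 {3, 4, 5, 6, 7, 8} (loop_word matrix_tokens)"
  "generates (site_loop 1 colour_tokens) 1 {3, 4, 5, 6, 7, 8} (loop_word colour_tokens)"
  "generates (site_loop 9 budget_tokens) 9 {3, 4, 5, 6, 7, 8} (loop_word budget_tokens)"
  by (rule generates_site_loop, simp, erule unary_tokens_regs,
    rule generates_site_loop, simp, erule matrix_tokens_regs,
    rule generates_site_loop, simp, erule colour_tokens_regs,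
    rule generates_site_loop, simp, erule budget_tokens_regs)

lemma generates_prints:
  "generates (print 1 [Lit (Bit False)]) 1 {} (words [Lit (Bit False)])"
  "generates (print 1 [Each 10 (\<lambda>a. [a])]) 1 {10} (words [Each 10 (\<lambda>a. [a])])"
  by (rule generates_print; simp)+

lemma polytime_program: "polytime (Seq prepare_cmd output_cmd)"
  unfolding prepare_cmd_def output_cmd_def
  by (intro polytime_Seq polytime_copies polytime_count generates_polytime[OF generates_poly_cmd(1)]
      generates_polytime[OF generates_poly_cmd(2)] generates_polytime[OF generates_rows(1)]
      generates_polytime[OF generates_rows(2)] generates_polytime[OF generates_rows(3)]
      generates_polytime[OF generates_rows(4)] generates_polytime[OF generates_far_gap]
      generates_polytime[OF generates_loops(1)] generates_polytime[OF generates_loops(2)]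
      generates_polytime[OF generates_loops(3)] generates_polytime[OF generates_loops(4)]
      generates_polytime[OF generates_prints(1)] generates_polytime[OF generates_prints(2)]) simp

lemma map_upt_split: "map f [0..<a + b] = map f [0..<a] @ map (\<lambda>k. f (a + k)) [0..<b]"
proof -
  have "[a..<a + b] = map (\<lambda>k. a + k) [0..<b]" by (rule nth_equalityI) simp_all
  then show ?thesis using upt_add_eq_append[of 0 a b] by (simp add: comp_def)
qed

lemma encode_pair_input: "map (\<lambda>b. Cell (bit_cell b) False False) (encode_pair x []) =
  concat (map (\<lambda>a. [as_input a, as_input a]) (map Bit x)) @ [Cell Zero False False, Cell One False False]"
  unfolding encode_pair_def by (induction x) (simp_all add: bit_cell_def)

lemma words_rows:
  assumes "\<sigma> 0 = map Bit x" "length (\<sigma> 2) = poly p (length x)" "length (\<sigma> 3) = slack x"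
  shows "words input_row \<sigma> = map (cell x 0) [0..<cols x]"
    and "words final_row \<sigma> = map (cell x (Suc (slack x))) [0..<cols x]"
proof -
  define u n e where "u = slack x" and "n = poly p (length x)" and "e = encode_pair x []"
  have le: "length e = 2 + 2 * length x" by (simp add: e_def length_encode_pair)
  have w: "cols x = 1 + (u + (1 + (length e + (n + (u + 1)))))"
    by (simp add: cols_def u_def n_def e_def tableau_width_def)
  have c: "cell x i j = Cell (tableau_kind e n u i j) (j = 0) (Suc j = cols x)" for i j
    by (simp add: cell_def cols_def u_def n_def e_def tableau_cell_def)
  have rep: "concat (map (\<lambda>_. [y]) xs) = replicate (length xs) y" for xs :: "sym list" and y :: sym
    by (induction xs) simp_all
  have split: "map (cell x i) [0..<cols x] = [cell x i 0] @ map (\<lambda>k. cell x i (1 + k)) [0..<u] @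
      [cell x i (1 + u)] @ map (\<lambda>k. cell x i (2 + u + k)) [0..<length e] @
      map (\<lambda>k. cell x i (2 + u + length e + k)) [0..<n] @ map (\<lambda>k. cell x i (2 + u + length e + n + k)) [0..<u] @
      [cell x i (2 + u + length e + n + u)]" for i
    unfolding w map_upt_split by (simp add: ac_simps)
  have e0: "map (\<lambda>k. cell x 0 (2 + u + k)) [0..<length e] = map (\<lambda>b. Cell (bit_cell b) False False) e"
    by (rule nth_equalityI) (simp_all add: c w tableau_kind_def)
  have i0: "cell x 0 0 = Cell Blank True False" "cell x 0 (1 + u) = Cell Pre False False"
    "cell x 0 (2 + u + length e + n + u) = Cell Blank False True"
    unfolding c w by (simp_all add: tableau_kind_def)
  have i1: "map (\<lambda>k. cell x 0 (1 + k)) [0..<u] = replicate u (Cell Blank False False)"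
    "map (\<lambda>k. cell x 0 (2 + u + length e + k)) [0..<n] = replicate n (Cell Wild False False)"
    "map (\<lambda>k. cell x 0 (2 + u + length e + n + k)) [0..<u] = replicate u (Cell Blank False False)"
    by (rule nth_equalityI; simp add: c w tableau_kind_def)+
  show "words input_row \<sigma> = map (cell x 0) [0..<cols x]"
    unfolding split e0 i0 i1 unfolding e_def encode_pair_input input_row_def words_simps token_word.simps
    using assms by (simp only: rep u_def n_def append_assoc append_Cons append_Nil append_Nil2)
  have f0: "cell x (Suc u) 0 = Cell Mid True False" "cell x (Suc u) (1 + u) = Cell Mid False False"
    "cell x (Suc u) (2 + u + length e + n + u) = Cell Mid False True"
    unfolding c w using le by (simp_all add: tableau_kind_def)
  have f1: "map (\<lambda>k. cell x (Suc u) (1 + k)) [0..<u] = replicate u (Cell Mid False False)"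
    "map (\<lambda>k. cell x (Suc u) (2 + u + length e + k)) [0..<n] = replicate n (Cell Mid False False)"
    "map (\<lambda>k. cell x (Suc u) (2 + u + length e + n + k)) [0..<u] = replicate u (Cell Mid False False)"
    by (rule nth_equalityI; simp add: c w tableau_kind_def le)+
  have fe: "map (\<lambda>k. cell x (Suc u) (2 + u + k)) [0..<length e] =
      [Cell Acc2 False False, Cell Acc0 False False] @ replicate (2 * length x) (Cell Mid False False)"
  proof -
    have "map (\<lambda>k. cell x (Suc u) (2 + u + k)) [0..<2 + 2 * length x] = map (\<lambda>k. cell x (Suc u) (2 + u + k)) [0..<2] @
        map (\<lambda>k. cell x (Suc u) (2 + u + (2 + k))) [0..<2 * length x]" by (rule map_upt_split)
    moreover have "map (\<lambda>k. cell x (Suc u) (2 + u + (2 + k))) [0..<2 * length x] = replicate (2 * length x) (Cell Mid False False)"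
      by (rule nth_equalityI) (simp_all add: c w tableau_kind_def le)
    moreover have "map (\<lambda>k. cell x (Suc u) (2 + u + k)) [0..<2] = [Cell Acc2 False False, Cell Acc0 False False]"
      by (simp add: upt_rec c w tableau_kind_def le)
    ultimately show ?thesis unfolding le by simp
  qed
  have rep2: "concat (map (\<lambda>_. [y, y]) xs) = replicate (2 * length xs) y" for xs :: "sym list" and y :: sym
    by (induction xs) simp_all
  show "words final_row \<sigma> = map (cell x (Suc (slack x))) [0..<cols x]"
    unfolding u_def[symmetric] split f0 f1 fe final_row_def words_simps token_word.simps
    using assms by (simp only: rep rep2 u_def n_def append_assoc append_Cons append_Nil append_Nil2 length_map)
qed

lemma concat_zeros: "concat (map (\<lambda>_. zeros k) xs) = zeros (length xs * k)"
  by (induction xs) (simp_all add: zeros_def replicate_add)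

lemma words_gaps:
  assumes "\<sigma> 5 = map (\<lambda>j. as_mid (cell x 0 j)) [0..<cols x]"
  shows "words near_gap \<sigma> = replicate (9 * (cols x * wid) - 10) (Bit False)"
    and "words [Each 5 (\<lambda>_. zeros k)] \<sigma> = zeros (cols x * k)"
proof -
  have fc: "first_cell (as_mid c) = first_cell c" for c by (cases c) simp_all
  obtain W where W: "cols x = Suc W" using pos(2)[of x] by (cases "cols x") auto
  have "words near_gap \<sigma> = concat (map (\<lambda>j. zeros (if j = 0 then 9 * wid - 10 else 9 * wid)) [0..<cols x])"
    unfolding near_gap_def by (simp add: words_simps assms comp_def fc cell_flags)
  also have "\<dots> = zeros (9 * wid - 10) @ concat (map (\<lambda>j. zeros (9 * wid)) [0..<W])"
    unfolding W by (simp add: upt_conv_Cons map_Suc_upt[symmetric] comp_def del: upt_Suc)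
  also have "\<dots> = zeros (9 * wid - 10) @ zeros (W * (9 * wid))" by (simp only: concat_zeros length_upt diff_zero)
  also have "\<dots> = zeros (9 * (cols x * wid) - 10)"
  proof -
    have "9 * (cols x * wid) - 10 = 9 * wid - 10 + W * (9 * wid)"
      using pos(4) unfolding W by (simp add: algebra_simps)
    then show ?thesis by (simp add: zeros_def replicate_add)
  qed
  finally show "words near_gap \<sigma> = replicate (9 * (cols x * wid) - 10) (Bit False)" by (simp only: zeros_def)
  show "words [Each 5 (\<lambda>_. zeros k)] \<sigma> = zeros (cols x * k)"
    by (simp add: words_simps assms concat_zeros)
qed

lemma far_gap_length:
  "cols x * (9 * wid * (2 * hgt - 2)) + slack x * (cols x * (9 * wid * hgt)) =
   9 * ((rows x * hgt) * (cols x * wid)) - 2 * (9 * (cols x * wid))"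
proof -
  obtain h where h: "hgt = Suc h" using pos(3) by (cases hgt) auto
  have "9 * ((rows x * hgt) * (cols x * wid)) = cols x * (9 * wid * (2 * h)) + slack x * (cols x * (9 * wid * hgt)) + 2 * (9 * (cols x * wid))"
    unfolding rows_def h by (simp add: algebra_simps)
  moreover have "2 * hgt - 2 = 2 * h" unfolding h by simp
  ultimately show ?thesis by simp
qed

lemma exec_prepare:
  "prepared x (exec prepare_cmd (init_regs x))" "exec prepare_cmd (init_regs x) 1 = []"
  "exec prepare_cmd (init_regs x) 9 = []" "exec prepare_cmd (init_regs x) 10 = []"
proof -
  let ?\<sigma> = "exec prepare_cmd (init_regs x)"
  define k where "k = degree p + degree U"
  define s1 where "s1 = exec (copies k) (init_regs x)"
  have s1: "s1 0 = map Bit x" "\<And>i. 0 < i \<Longrightarrow> i < 11 \<Longrightarrow> s1 i = []"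
    "\<And>j. j < k \<Longrightarrow> length (s1 (11 + j)) = length x"
    unfolding s1_def exec_copies by (simp_all add: init_regs_def)
  have po: "(\<Sum>i\<le>degree q. coeff q i * (\<Prod>j<i. length (s (11 + j)))) = poly q (length x)"
    if "degree q \<le> k" "\<And>j. j < k \<Longrightarrow> length (s (11 + j)) = length x" for q and s :: "nat \<Rightarrow> sym list"
  proof -
    have "(\<Prod>j<i. length (s (11 + j))) = length x ^ i" if "i \<le> degree q" for i
      using that \<open>degree q \<le> k\<close> \<open>\<And>j. j < k \<Longrightarrow> length (s (11 + j)) = length x\<close> by simp
    then show ?thesis unfolding poly_altdef by (intro sum.cong) auto
  qed
  define s2 where "s2 = exec (unary_poly 2 p) s1"
  have s2: "s2 = s1(2 := replicate (poly p (length x)) (Bit True))"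
    unfolding s2_def generates_exec[OF generates_poly_cmd(1) finite_atLeastLessThan]
    using s1 by (subst po) (auto simp: k_def)
  define s3 where "s3 = exec (unary_poly 3 U) s2"
  have s3: "s3 = s2(3 := replicate (slack x) (Bit True))"
    unfolding s3_def generates_exec[OF generates_poly_cmd(2) finite_atLeastLessThan]
    using s1 by (subst po) (auto simp: k_def s2 slack_def)
  define s4 where "s4 = exec (print 4 input_row) s3"
  have s4: "s4 = s3(4 := map (cell x 0) [0..<cols x])"
    unfolding s4_def generates_exec[OF generates_rows(1) finite_insert[THEN iffD2, OF finite_insert[THEN iffD2, OF finite_insert[THEN iffD2, OF finite.emptyI]]]]
    using s1 by (subst words_rows(1)) (auto simp: s2 s3)
  define s5 where "s5 = exec (print 5 [Each 4 (\<lambda>c. [as_mid c])]) s4"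
  have s5: "s5 = s4(5 := map (\<lambda>j. as_mid (cell x 0 j)) [0..<cols x])"
    unfolding s5_def generates_exec[OF generates_rows(2) finite.insertI[OF finite.emptyI]]
    using s1 by (simp add: s4 s3 s2 words_simps comp_def)
  define s6 where "s6 = exec (print 6 final_row) s5"
  have s6: "s6 = s5(6 := map (cell x (Suc (slack x))) [0..<cols x])"
    unfolding s6_def generates_exec[OF generates_rows(3) finite_insert[THEN iffD2, OF finite_insert[THEN iffD2, OF finite_insert[THEN iffD2, OF finite.emptyI]]]]
    using s1 by (subst words_rows(2)) (auto simp: s2 s3 s4 s5)
  define s7 where "s7 = exec (print 7 near_gap) s6"
  have s65: "s6 5 = map (\<lambda>j. as_mid (cell x 0 j)) [0..<cols x]" by (simp add: s6 s5)
  have s7: "s7 = s6(7 := replicate (9 * (cols x * wid) - 10) (Bit False))"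
    unfolding s7_def generates_exec[OF generates_rows(4) finite.insertI[OF finite.emptyI]] words_gaps(1)[of s6 x, OF s65]
    using s1 by (simp add: s2 s3 s4 s5 s6)
  have s75: "s7 5 = map (\<lambda>j. as_mid (cell x 0 j)) [0..<cols x]" by (simp add: s7 s65)
  have s73: "length (s7 3) = slack x" by (simp add: s7 s6 s5 s4 s3)
  have "exec far_gap s7 = s7(8 := replicate (9 * ((rows x * hgt) * (cols x * wid)) - 2 * (9 * (cols x * wid))) (Bit False))"
  proof -
    have "s7 8 = []" using s1 by (simp add: s2 s3 s4 s5 s6 s7)
    then show ?thesis
      unfolding generates_exec[OF generates_far_gap finite.insertI[OF finite.insertI[OF finite.emptyI]]] words_gaps(2)[of s7 x, OF s75] concat_zeros s73
      by (simp only: zeros_def replicate_add[symmetric] far_gap_length append_Nil)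
  qed
  then have \<sigma>: "?\<sigma> = s7(8 := replicate (9 * ((rows x * hgt) * (cols x * wid)) - 2 * (9 * (cols x * wid))) (Bit False))"
    unfolding prepare_cmd_def by (simp only: exec.simps k_def[symmetric] s1_def[symmetric] s2_def[symmetric]
      s3_def[symmetric] s4_def[symmetric] s5_def[symmetric] s6_def[symmetric] s7_def[symmetric])
  show "prepared x ?\<sigma>" unfolding prepared_def \<sigma> using s73 s75 by (simp add: s7 s6 s5 s4)
  show "?\<sigma> 1 = []" "?\<sigma> 9 = []" "?\<sigma> 10 = []" using s1 unfolding \<sigma> s7 s6 s5 s4 s3 s2 by simp_all
qed

definition instance_word :: "bool list \<Rightarrow> bool list" where
  "instance_word x = encode_instance (picture.graph (rows x * hgt) (cols x * wid) (pic x))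
     (picture.col (rows x * hgt) (cols x * wid) (pic x)) (picture.budget (rows x * hgt) (cols x * wid) (pic x))"

lemma prepared_update: "prepared x \<sigma> \<Longrightarrow> r \<notin> {3, 4, 5, 6, 7, 8} \<Longrightarrow> prepared x (\<sigma>(r := ys))"
  unfolding prepared_def by auto

lemma map_Bit_concat: "concat (map (\<lambda>g. map Bit (f g)) gs) = map Bit (concat (map f gs))"
  by (induction gs) simp_all

lemma exec_output:
  assumes \<sigma>: "prepared x \<sigma>" "\<sigma> 1 = []" "\<sigma> 9 = []" "\<sigma> 10 = []"
  shows "exec output_cmd \<sigma> 1 = map Bit (instance_word x)"
proof -
  interpret picture "rows x * hgt" "cols x * wid" "pic x" by (rule picture_pic)
  define N B where "N = (rows x * hgt) * (cols x * wid)" and "B = cols x * wid"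
  define one where "one = concat (map (\<lambda>g. replicate 9 True) [0..<N])"
  define mat where "mat = concat (map (\<lambda>g. concat (map (chunk_pieces (g = 0) (Suc g = N) (slv (st g)) (B \<le> g \<and> sd (st (g - B)))
      (1 \<le> g \<and> sr (st (g - 1))) (sr (st g)) (sd (st g)) (9 * B - 10) (9 * N - 2 * (9 * B))) [0..<9])) [0..<N])"
  define clr where "clr = concat (map (\<lambda>g. concat (map (\<lambda>s. replicate (slot_col (st g) s) True @ [False]) [0..<9])) [0..<N])"
  have G: "st g = cell_site (cell x i j) (Suc i = rows x) a b"
    "(g = 0) = (i = 0 \<and> a = 0 \<and> first_cell (cell x i j) \<and> b = 0)"
    "(Suc g = N) = (Suc i = rows x \<and> Suc a = hgt \<and> last_cell (cell x i j) \<and> Suc b = wid)"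
    "(B \<le> g \<and> sd (st (g - B))) = up_edge (i = 0) (Suc i = rows x) (cell x i j) a b"
    "(1 \<le> g \<and> sr (st (g - 1))) = left_edge (Suc i = rows x) (cell x i j) a b"
    if "i < rows x" "a < hgt" "j < cols x" "b < wid" "g = (i * hgt + a) * (cols x * wid) + (j * wid + b)" for i a j b g
    using grid_site[OF that(1-4)] unfolding that(5) N_def B_def by blast+
  have one: "loop_word unary_tokens s = map Bit one" if "prepared x s" for s
    unfolding one_def N_def map_Bit_concat[symmetric]
    by (rule loop_word[OF that]) (simp only: unary_tokens_def words_simps)
  have mat: "loop_word matrix_tokens s = map Bit mat" if s: "prepared x s" for s
  proof -
    have s78: "s 7 = replicate (9 * B - 10) (Bit False)" "s 8 = replicate (9 * N - 2 * (9 * B)) (Bit False)"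
      using s unfolding prepared_def N_def B_def by blast+
    define f where "f = (\<lambda>g. concat (map (chunk_pieces (g = 0) (Suc g = N) (slv (st g)) (B \<le> g \<and> sd (st (g - B)))
      (1 \<le> g \<and> sr (st (g - 1))) (sr (st g)) (sd (st g)) (9 * B - 10) (9 * N - 2 * (9 * B))) [0..<9]))"
    have "loop_word matrix_tokens s = concat (map (\<lambda>g. map Bit (f g)) [0..<rows x * hgt * (cols x * wid)])"
    proof (rule loop_word[OF s])
      fix i a j b assume ij: "i < rows x" "a < hgt" "j < cols x" "b < wid"
      define g where "g = (i * hgt + a) * (cols x * wid) + (j * wid + b)"
      show "words (matrix_tokens (i = 0) (Suc i = rows x) (cell x i j) a b) s =
          map Bit (f ((i * hgt + a) * (cols x * wid) + (j * wid + b)))"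
        unfolding g_def[symmetric] f_def matrix_tokens_def words_concat map_map comp_def words_chunk_tokens[of s, OF s78]
          map_Bit_concat G[OF ij g_def] ..
    qed
    then show ?thesis unfolding mat_def f_def[symmetric] N_def[symmetric] map_Bit_concat .
  qed
  have clr: "loop_word colour_tokens s = map Bit clr" if s: "prepared x s" for s
  proof -
    define f where "f = (\<lambda>g. concat (map (\<lambda>s. replicate (slot_col (st g) s) True @ [False]) [0..<9]))"
    have "loop_word colour_tokens s = concat (map (\<lambda>g. map Bit (f g)) [0..<rows x * hgt * (cols x * wid)])"
      by (rule loop_word[OF s]) (simp only: colour_tokens_def words_simps f_def G(1)[OF _ _ _ _ refl])
    then show ?thesis unfolding clr_def f_def[symmetric] N_def[symmetric] map_Bit_concat .
  qed
  have bud: "loop_word budget_tokens s = concat (map (\<lambda>g. if 1 \<le> slv (st g) then [Bit True] else []) [0..<N])"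
    if s: "prepared x s" for s
    unfolding N_def
    by (rule loop_word[OF s]) (simp only: budget_tokens_def G(1)[OF _ _ _ _ refl] if_distrib[of "\<lambda>t. words t s"] words_simps token_word.simps append_Nil2)
  note fin = finite.insertI[OF finite.insertI[OF finite.insertI[OF finite.insertI[OF finite.insertI[OF finite.insertI[OF finite.emptyI]]]]]]
  define s1 where "s1 = \<sigma>(1 := map Bit one)"
  have 1: "exec (site_loop 1 unary_tokens) \<sigma> = s1"
    unfolding generates_exec[OF generates_loops(1) fin] one[OF \<sigma>(1)] s1_def \<sigma>(2) by simp
  define s2 where "s2 = s1(1 := map Bit (one @ [False]))"
  have 2: "exec (print 1 [Lit (Bit False)]) s1 = s2"
    unfolding generates_exec[OF generates_prints(1) finite.emptyI] by (simp add: words_simps s1_def s2_def)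
  have p2: "prepared x s2" unfolding s2_def s1_def by (intro prepared_update \<sigma>(1)) simp_all
  define s3 where "s3 = s2(1 := map Bit ((one @ [False]) @ mat))"
  have 3: "exec (site_loop 1 matrix_tokens) s2 = s3"
    unfolding generates_exec[OF generates_loops(2) fin] mat[OF p2] s3_def by (simp add: s2_def)
  have p3: "prepared x s3" unfolding s3_def by (intro prepared_update p2) simp_all
  define s4 where "s4 = s3(1 := map Bit (((one @ [False]) @ mat) @ clr))"
  have 4: "exec (site_loop 1 colour_tokens) s3 = s4"
    unfolding generates_exec[OF generates_loops(3) fin] clr[OF p3] s4_def by (simp add: s3_def)
  have p4: "prepared x s4" unfolding s4_def by (intro prepared_update p3) simp_all
  have s49: "s4 9 = []" "s4 10 = []" using \<sigma> by (simp_all add: s4_def s3_def s2_def s1_def)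
  define s5 where "s5 = s4(9 := concat (map (\<lambda>g. if 1 \<le> slv (st g) then [Bit True] else []) [0..<N]))"
  have 5: "exec (site_loop 9 budget_tokens) s4 = s5"
    unfolding generates_exec[OF generates_loops(4) fin] bud[OF p4] s5_def s49 by simp
  have "length (s5 9) = budget" unfolding s5_def fun_upd_same length_concat_card budget_def N_def ..
  then have 6: "exec (count 9 10) s5 = s5(10 := map Bit (binary_word budget))"
    using exec_count[of 9 10 s5] s49 by (simp add: s5_def)
  have "exec output_cmd \<sigma> 1 = map Bit (one @ [False] @ mat @ clr @ binary_word budget)"
    unfolding output_cmd_def exec.simps 1 2 3 4 5 6 generates_exec[OF generates_prints(2) finite.insertI[OF finite.emptyI]]
    by (simp add: words_simps s5_def s4_def comp_def)
  also have "one @ [False] @ mat @ clr @ binary_word budget = instance_word x"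
  proof -
    have "2 \<le> cols x * wid" "2 \<le> rows x * hgt"
      using mult_le_mono[OF pos(2)[of x] pos(4)] mult_le_mono[OF pos(1)[of x] pos(3)] by linarith+
    from encode_graph[OF this] show ?thesis unfolding instance_word_def one_def mat_def clr_def N_def B_def by (rule sym)
  qed
  finally show ?thesis .
qed

lemma polytime_computable_output: "polytime_computable instance_word"
  by (rule polytime_computable_program[OF polytime_program])
    (simp only: exec.simps exec_output[OF exec_prepare])

lemma output_instance:
  assumes "\<And>x. x \<in> L \<longleftrightarrow> (\<exists>s. label_tiling m H V (rows x) (cols x) (\<lambda>i j. A (cell x i j)) s)"
  shows "(x \<in> L \<longrightarrow> instance_word x \<in> yes_instances (Fix_Promise 3 {G. planar G})) \<and>
    (x \<notin> L \<longrightarrow> instance_word x \<in> no_instances (Fix_Promise 3 {G. planar G}))"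
proof -
  interpret picture "rows x * hgt" "cols x * wid" "pic x" by (rule picture_pic)
  have "x \<in> L \<longleftrightarrow> (\<exists>f. list_colouring (8 * (rows x * (3 * m + 2))) (8 * (cols x * (2 * m + 2))) (pic x) f)"
    unfolding assms labelling_iff_tiling[symmetric] pic_def list_colouring_iff_labelling ..
  then have L: "x \<in> L \<longleftrightarrow> fixable graph 3 col budget" unfolding fixable_graph_iff dims .
  \<comment> \<open>Instances require a positive budget. The left port of every tile kind forbids
    color 3, so there is a site with pendant neighbours.\<close>
  have "0 < budget"
  proof -
    have "((3, 0), (3, 2)) \<in> set (gsites k)" for k by (cases k) (simp_all add: cross_sites_def)
    then have k: "gcl k 3 0 = (3, 2)" for k by (rule gcl_gsites)
    have "3 < hgt" "0 < wid" using pos(3,4) by linarith+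
    from pic_site[OF this, of x 0 0] have "1 \<le> slv (pic x 3 0)" by (simp add: cell_site_def ksite_def k)
    moreover define g where "g = 3 * (cols x * wid)"
    have B0: "0 < cols x * wid" using B .
    have "g < rows x * hgt * (cols x * wid)" unfolding g_def
      by (rule mult_less_mono1[OF _ B0]) (use mult_le_mono[OF pos(1)[of x] pos(3)] in linarith)
    moreover have "st g = pic x 3 0" unfolding g_def st_def using B0 by simp
    ultimately have "g \<in> {g. g < rows x * hgt * (cols x * wid) \<and> 1 \<le> slv (st g)}" by simp
    then show ?thesis unfolding budget_def by (subst card_gt_0_iff) auto
  qed
  then have "fix_instance 3 graph col budget" unfolding fix_instance_def
    using pair_graph_graph col_colorings pverts_graph by blast
  then show ?thesis unfolding L instance_word_def Fix_Promise_def
    using planar_graph fix_promise_graph by auto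
qed

end

theorem theorem6:
  shows "NP_hard (Fix_Promise 3 {G. planar G})"
  unfolding NP_hard_def
proof
  fix L assume "L \<in> NP"
  then show "\<exists>f. polytime_computable f \<and> (\<forall>x. (x \<in> L \<longrightarrow> f x \<in> yes_instances (Fix_Promise 3 {G. planar G})) \<and>
      (x \<notin> L \<longrightarrow> f x \<in> no_instances (Fix_Promise 3 {G. planar G})))"
  proof (rule NP_label_tiling)
    fix m H V A and p U :: "nat poly"
    assume L: "\<And>x. x \<in> L \<longleftrightarrow> (\<exists>s. label_tiling m H V (poly U (length x) + 2)
       (tableau_width (encode_pair x []) (poly p (length x)) (poly U (length x)))
       (\<lambda>i j. A (tableau_cell (encode_pair x []) (poly p (length x)) (poly U (length x)) i j)) s)"
    interpret reduction m H V A p U .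
    have "x \<in> L \<longleftrightarrow> (\<exists>s. label_tiling m H V (rows x) (cols x) (\<lambda>i j. A (cell x i j)) s)" for x
      unfolding rows_def cols_def cell_def slack_def by (rule L)
    from output_instance[OF this] polytime_computable_output show ?thesis by blast
  qed
qed

end
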